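(* Algorithm RVCM (described in the context) guarantees rendezvous at cost $D$, for any two agents with a map and coherent compasses, in any terrain. Here $D$ is the distance between the starting positions of the agents in the terrain.
   Context: A terrain is a planar set $\mathcal{P}_0\setminus(\mathcal{P}_1\cup\dots\cup\mathcal{P}_k)$, where $\mathcal{P}_0$ is a closed polygon and $\mathcal{P}_1,\dots,\mathcal{P}_k$ (the obstacles, possibly none) are disjoint open polygons included in $\mathcal{P}_0$; the boundary of the terrain belongs to it. The distance between two points of the terrain is the length of a shortest path between them included in the terrain. Agents: two agents, modeled as points, start at different points of the terrain chosen by the adversary. Each has a unit of length and a compass (a direction called North); both use the same clockwise orientation. Compasses are coherent if both agents have the same North. An agent knows whether it is at an interior or a boundary point, and in the latter case the slope(s) of the boundary there; it cannot sense the terrain or the other agent in any vicinity of its location. A map available to an agent shows the terrain to scale, marks the starting positions of this agent and of the other agent, and is oriented according to the agent's compass. The agents may be anonymous, i.e., they execute identical algorithms. Routes: an agent constructs a finite polygonal path in the terrain (its route) in steps. In a step starting at a point, the agent chooses a direction (according to its compass) and a distance; if the segment of this length in this direction does not intersect the boundary, the step ends at the end of this segment, otherwise it ends at the closest boundary point in this direction. If the starting point of the step is on a segment of the boundary, the agent may alternatively follow this segment in either direction until its end or for a given distance. Walks: let the route be $(S_1,\dots,S_k)$ with $S_i=[a_i,a_{i+1}]$. The adversary chooses reals $0=t_1<t_2<\dots<t_{k+1}$ and continuous functions $f_i:[t_i,t_{i+1}]\to[a_i,a_{i+1}]$ with $f_i(t_i)=a_i$, $f_i(t_{i+1})=a_{i+1}$;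 the walk is $f(t)=f_i(t)$ for $t\in[t_i,t_{i+1}]$, and the agent is inert after $t_{k+1}$. Agents with walks $f_1,f_2$ meet (rendezvous) at time $t$ if $f_1(t)=f_2(t)$. Rendezvous is guaranteed if the agents meet at some time regardless of the walks chosen by the adversary. The trajectory of an agent is the sequence of segments of its route until rendezvous (the last one possibly being a portion of a route segment). The cost of an algorithm is the worst-case sum of the lengths of the segments of the trajectories of both agents, the worst case being taken over all terrains with the considered values of parameters and all adversarial decisions. Procedure UniquePath$(v,w)$, for points $v,w$ of the terrain: let $u:=v$, let $p$ be the path consisting of the point $v$, and let $\mathcal{S}$ be the set of all shortest paths between $v$ and $w$ in the terrain. While $u\neq w$: let $\mathcal{U}$ be the set of all paths $p_s\in\mathcal{S}$ such that the first segment of the subpath of $p_s$ leading from $u$ to $w$ is the first in clockwise order around $u$ starting from the direction $vw$; let $p'=\bigcap_{p_s\in\mathcal{U}}p_s$; extend $p$ with the connected part of $p'$ containing $u$; let $u$ be the new end of $p$. Return $p$. Algorithm RVCM: Let $v$ be the northernmost of the two starting positions of the agents; if both have the same latitude, let $v$ be the easternmost of them. Let $w$ be the other starting position. The agent starting at $v$ remains inert. The agent starting at $w$ computes the path $p=$ UniquePath$(w,v)$ and moves along $p$ until $v$. *)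

theory Defs
  imports "HOL-Analysis.Analysis" "HOL-Library.While_Combinator"
begin

text \<open>The plane is \<^typ>\<open>complex\<close>, with its usual orientation.\<close>

section \<open>Terrains\<close>

fun polyline :: "complex list \<Rightarrow> real \<Rightarrow> complex" where
  "polyline [] = (\<lambda>_. undefined)"
| "polyline [a] = linepath a a"
| "polyline [a, b] = linepath a b"
| "polyline (a # b # c # xs) = linepath a b +++ polyline (b # c # xs)"

definition polygon_curve :: "(real \<Rightarrow> complex) \<Rightarrow> bool" where
  "polygon_curve g \<longleftrightarrow>
     (\<exists>vs. length vs \<ge> 3 \<and> g = polyline (vs @ [hd vs]) \<and> simple_path g)"

definition closed_polygon :: "complex set \<Rightarrow> bool" where
  "closed_polygon P \<longleftrightarrow> (\<exists>g. polygon_curve g \<and> P = path_image g \<union> inside (path_image g))"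

definition open_polygon :: "complex set \<Rightarrow> bool" where
  "open_polygon P \<longleftrightarrow> (\<exists>g. polygon_curve g \<and> P = inside (path_image g))"

definition terrain :: "complex set \<Rightarrow> bool" where
  "terrain T \<longleftrightarrow> (\<exists>P0 \<O>. closed_polygon P0 \<and> finite \<O> \<and>
     (\<forall>P\<in>\<O>. open_polygon P \<and> P \<subseteq> P0) \<and> pairwise disjnt \<O> \<and> T = P0 - \<Union>\<O>)"

section \<open>Shortest paths and distance\<close>

definition curve_length :: "(real \<Rightarrow> complex) \<Rightarrow> ereal" where
  "curve_length g = (SUP ts \<in> {ts. sorted ts \<and> set ts \<subseteq> {0..1}}.
     ereal (\<Sum>i<length ts - 1. dist (g (ts ! i)) (g (ts ! Suc i))))"

definition paths_in :: "complex set \<Rightarrow> complex \<Rightarrow> complex \<Rightarrow> (real \<Rightarrow> complex) set" where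
  "paths_in T v w = {g. path g \<and> path_image g \<subseteq> T \<and> pathstart g = v \<and> pathfinish g = w}"

definition shortest_paths :: "complex set \<Rightarrow> complex \<Rightarrow> complex \<Rightarrow> (real \<Rightarrow> complex) set" where
  "shortest_paths T v w =
     {g \<in> paths_in T v w. \<forall>h \<in> paths_in T v w. curve_length g \<le> curve_length h}"

definition terrain_dist :: "complex set \<Rightarrow> complex \<Rightarrow> complex \<Rightarrow> real" where
  "terrain_dist T v w = (THE D. \<exists>g \<in> shortest_paths T v w. curve_length g = ereal D)"

section \<open>Agents\<close>

text \<open>
  A frame is the compass and the unit of length of an agent, together with the point
  of the plane at which the (otherwise arbitrary) origin of its map is placed.
  On the map, North is \<^term>\<open>\<i>\<close> and East is \<^term>\<open>1::complex\<close>.  The map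
  transformation preserves orientation: the two agents agree on what clockwise means.
\<close>

record frame =
  north :: complex
  len_unit :: real
  map_origin :: complex

definition valid_frame :: "frame \<Rightarrow> bool" where
  "valid_frame F \<longleftrightarrow> norm (north F) = 1 \<and> len_unit F > 0"

definition to_map :: "frame \<Rightarrow> complex \<Rightarrow> complex" where
  "to_map F z = \<i> * (z - map_origin F) / (of_real (len_unit F) * north F)"

definition from_map :: "frame \<Rightarrow> complex \<Rightarrow> complex" where
  "from_map F z = map_origin F + of_real (len_unit F) * north F * z / \<i>"

text \<open>
  A route is the list of end points of its segments; the one-element list is the
  route of an inert agent.  In a step the agent either moves freely, and then no boundary
  point lies strictly between the ends of the step, or it follows a segment of the boundary.
\<close>

definition route_step :: "complex set \<Rightarrow> complex \<Rightarrow> complex \<Rightarrow> bool" where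
  "route_step T a b \<longleftrightarrow>
     closed_segment a b \<subseteq> T \<and> open_segment a b \<inter> frontier T = {} \<or>
     closed_segment a b \<subseteq> frontier T"

definition route :: "complex set \<Rightarrow> complex \<Rightarrow> complex list \<Rightarrow> bool" where
  "route T a rs \<longleftrightarrow> rs \<noteq> [] \<and> hd rs = a \<and> a \<in> T \<and> successively (route_step T) rs"

text \<open>
  An algorithm for an agent with a map maps the depicted terrain and the marked positions
  of the agent itself and of the other agent to the routes, in map coordinates,
  that conform to it.  There can be several of them when the description of the algorithm
  leaves open how the prescribed path is cut into steps; the adversary then chooses.
  Agents are anonymous: both execute the same algorithm.
\<close>

type_synonym algorithm = "complex set \<Rightarrow> complex \<Rightarrow> complex \<Rightarrow> complex list set"

record scenario =
  ground :: "complex set"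
  start1 :: complex
  start2 :: complex
  frame1 :: frame
  frame2 :: frame

definition valid_scenario :: "scenario \<Rightarrow> bool" where
  "valid_scenario \<sigma> \<longleftrightarrow> terrain (ground \<sigma>) \<and> start1 \<sigma> \<in> ground \<sigma> \<and> start2 \<sigma> \<in> ground \<sigma> \<and>
     start1 \<sigma> \<noteq> start2 \<sigma> \<and> valid_frame (frame1 \<sigma>) \<and> valid_frame (frame2 \<sigma>)"

definition coherent_compasses :: "scenario \<Rightarrow> bool" where
  "coherent_compasses \<sigma> \<longleftrightarrow> north (frame1 \<sigma>) = north (frame2 \<sigma>)"

definition start_dist :: "scenario \<Rightarrow> real" where
  "start_dist \<sigma> = terrain_dist (ground \<sigma>) (start1 \<sigma>) (start2 \<sigma>)"

definition agent_routes ::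
  "algorithm \<Rightarrow> complex set \<Rightarrow> frame \<Rightarrow> complex \<Rightarrow> complex \<Rightarrow> complex list set" where
  "agent_routes alg T F own other =
     map (from_map F) ` alg (to_map F ` T) (to_map F own) (to_map F other)"

definition routes1 :: "algorithm \<Rightarrow> scenario \<Rightarrow> complex list set" where
  "routes1 alg \<sigma> = agent_routes alg (ground \<sigma>) (frame1 \<sigma>) (start1 \<sigma>) (start2 \<sigma>)"

definition routes2 :: "algorithm \<Rightarrow> scenario \<Rightarrow> complex list set" where
  "routes2 alg \<sigma> = agent_routes alg (ground \<sigma>) (frame2 \<sigma>) (start2 \<sigma>) (start1 \<sigma>)"

section \<open>Walks, rendezvous and cost\<close>

definition walk :: "complex list \<Rightarrow> real list \<Rightarrow> (real \<Rightarrow> complex) \<Rightarrow> bool" where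
  "walk rs ts f \<longleftrightarrow> rs \<noteq> [] \<and> length ts = length rs \<and> hd ts = 0 \<and> sorted_wrt (<) ts \<and>
     (\<forall>i. Suc i < length rs \<longrightarrow>
        continuous_on {ts ! i..ts ! Suc i} f \<and>
        f ` {ts ! i..ts ! Suc i} \<subseteq> closed_segment (rs ! i) (rs ! Suc i) \<and>
        f (ts ! i) = rs ! i \<and> f (ts ! Suc i) = rs ! Suc i) \<and>
     (\<forall>t \<ge> last ts. f t = last rs)"

definition meet_at :: "(real \<Rightarrow> complex) \<Rightarrow> (real \<Rightarrow> complex) \<Rightarrow> real \<Rightarrow> bool" where
  "meet_at f1 f2 t \<longleftrightarrow> 0 \<le> t \<and> f1 t = f2 t"

definition guarantees_rendezvous :: "algorithm \<Rightarrow> scenario \<Rightarrow> bool" where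
  "guarantees_rendezvous alg \<sigma> \<longleftrightarrow> routes1 alg \<sigma> \<noteq> {} \<and> routes2 alg \<sigma> \<noteq> {} \<and>
     (\<forall>r1 \<in> routes1 alg \<sigma>. \<forall>r2 \<in> routes2 alg \<sigma>.
        route (ground \<sigma>) (start1 \<sigma>) r1 \<and> route (ground \<sigma>) (start2 \<sigma>) r2 \<and>
        (\<forall>ts1 f1 ts2 f2. walk r1 ts1 f1 \<and> walk r2 ts2 f2 \<longrightarrow> (\<exists>t. meet_at f1 f2 t)))"

text \<open>
  Length of the trajectory up to time \<open>t\<close>: the segments completed by then count in full;
  of the segment being traversed, the portion from its beginning to the current position counts.
\<close>

definition trajectory_length ::
  "complex list \<Rightarrow> real list \<Rightarrow> (real \<Rightarrow> complex) \<Rightarrow> real \<Rightarrow> real" where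
  "trajectory_length rs ts f t = (\<Sum>i<length rs - 1.
     if ts ! Suc i \<le> t then dist (rs ! i) (rs ! Suc i)
     else if ts ! i \<le> t then dist (rs ! i) (f t) else 0)"

definition first_meeting :: "(real \<Rightarrow> complex) \<Rightarrow> (real \<Rightarrow> complex) \<Rightarrow> real \<Rightarrow> bool" where
  "first_meeting f1 f2 t \<longleftrightarrow> meet_at f1 f2 t \<and> (\<forall>s<t. \<not> meet_at f1 f2 s)"

definition execution_costs :: "algorithm \<Rightarrow> scenario \<Rightarrow> real set" where
  "execution_costs alg \<sigma> =
     {trajectory_length r1 ts1 f1 t + trajectory_length r2 ts2 f2 t | r1 r2 ts1 ts2 f1 f2 t.
        r1 \<in> routes1 alg \<sigma> \<and> r2 \<in> routes2 alg \<sigma> \<and>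
        walk r1 ts1 f1 \<and> walk r2 ts2 f2 \<and> first_meeting f1 f2 t}"

text \<open>
  Worst-case cost over a class of scenarios.  It only accounts for executions that end with
  a rendezvous, hence is meaningful together with \<^const>\<open>guarantees_rendezvous\<close>.
\<close>

definition algorithm_cost :: "algorithm \<Rightarrow> scenario set \<Rightarrow> ereal" where
  "algorithm_cost alg \<Sigma> = (SUP c \<in> (\<Union>\<sigma>\<in>\<Sigma>. execution_costs alg \<sigma>). ereal c)"

section \<open>Procedure UniquePath\<close>

text \<open>
  The subpath of \<open>g\<close> leading from \<open>u\<close> to the end of \<open>g\<close> begins with a
  (non-degenerate) segment of direction \<open>d\<close>.
\<close>

definition leaves_along :: "(real \<Rightarrow> complex) \<Rightarrow> complex \<Rightarrow> complex \<Rightarrow> bool" where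
  "leaves_along g u d \<longleftrightarrow> norm d = 1 \<and>
     (\<exists>t s r. 0 \<le> t \<and> t < s \<and> s \<le> 1 \<and> 0 < r \<and> g t = u \<and>
        g ` {t..s} = closed_segment u (u + of_real r * d))"

text \<open>The angle, in the range from \<open>0\<close> to \<open>2\<pi>\<close>, of the clockwise rotation from \<open>e\<close> to \<open>d\<close>.\<close>

definition clockwise_angle :: "complex \<Rightarrow> complex \<Rightarrow> real" where
  "clockwise_angle e d = Arg2pi (e / d)"

definition clockwise_first ::
  "complex set \<Rightarrow> complex \<Rightarrow> complex \<Rightarrow> complex \<Rightarrow> (real \<Rightarrow> complex) set" where
  "clockwise_first T v w u = {g \<in> shortest_paths T v w. \<exists>d. leaves_along g u d \<and>
     (\<forall>h \<in> shortest_paths T v w. \<forall>d'. leaves_along h u d' \<longrightarrow>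
        clockwise_angle (w - v) d \<le> clockwise_angle (w - v) d')}"

text \<open>The path \<open>p\<close> under construction is represented by its set of points; it starts at \<open>v\<close>.\<close>

definition path_end :: "complex \<Rightarrow> complex set \<Rightarrow> complex" where
  "path_end v p =
     (THE x. \<exists>g. arc g \<and> path_image g = p \<and> pathstart g = v \<and> pathfinish g = x)"

definition extend_path ::
  "complex set \<Rightarrow> complex \<Rightarrow> complex \<Rightarrow> complex set \<times> complex \<Rightarrow> complex set \<times> complex" where
  "extend_path T v w = (\<lambda>(p, u).
     let p' = (\<Inter>g \<in> clockwise_first T v w u. path_image g);
         q = p \<union> connected_component_set p' u
     in (q, path_end v q))"

text \<open>The result is \<^const>\<open>None\<close> if the loop does not terminate.\<close>

definition UniquePath :: "complex set \<Rightarrow> complex \<Rightarrow> complex \<Rightarrow> complex set option" where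
  "UniquePath T v w =
     map_option fst (while_option (\<lambda>(p, u). u \<noteq> w) (extend_path T v w) ({v}, v))"

section \<open>Algorithm RVCM\<close>

text \<open>In map coordinates: \<open>a\<close> is further north than \<open>b\<close>, or as far north and further east.\<close>

definition precedes :: "complex \<Rightarrow> complex \<Rightarrow> bool" where
  "precedes a b \<longleftrightarrow> Im a > Im b \<or> Im a = Im b \<and> Re a > Re b"

definition routes_along ::
  "complex set \<Rightarrow> complex set \<Rightarrow> complex \<Rightarrow> complex \<Rightarrow> complex list set" where
  "routes_along T p w v = {rs. route T w rs \<and> last rs = v \<and>
     arc (polyline rs) \<and> path_image (polyline rs) = p}"

definition RVCM :: algorithm where
  "RVCM T own other =
     (if precedes own other then {[own]}
      else (case UniquePath T own other of
              None \<Rightarrow> {}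
            | Some p \<Rightarrow> routes_along T p own other))"

end

(*
  In the intrinsic metric gdist of a terrain, every shortest path is a reparametrization of a
  unit-speed geodesic; geodesics exist by the Arzela-Ascoli theorem.  A terrain is star-shaped
  around each of its points and convex around all but finitely many of them (its nodes), because
  its border is a finite union of segments contained in it.  Hence a geodesic is straight between
  consecutive nodes.  Two geodesics that share a point reach it at the same time, so the path
  built by UniquePath is always an initial part of a geodesic.  One round of the loop ends at a
  node, since geodesics that arrive together at any other point leave it together; the rounds are
  therefore finitely many, and the result is a geodesic.  It splits into finitely many steps
  because the boundary is radial around every point.  The agent that follows it meets the inert
  one only at the end of the route, after travelling exactly D.
*)
theory Submission
  imports Defs "HOL-Complex_Analysis.Great_Picard"
begin

section \<open>Polygonal chains and the intrinsic distance\<close>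

text \<open>Shortest paths are arbitrary parametrizations that may pause, \<open>UniquePath\<close>
  handles only point sets, and a route is any polygonal arc with the right image. The function
  \<open>gdist T v\<close> ties these together: on every geodesic from \<open>v\<close> it inverts
  the parametrization, so times, components and end points can be read off points of the plane.
  \<open>gdist\<close> is an infimum over polygonal chains rather than over curves, which keeps
  lengths finite and turns the triangle inequality into concatenation; that no curve is shorter is
  proved by bisection. Straightness of a geodesic is always the equality case of the triangle
  inequality for a 1-Lipschitz curve. The algorithm runs on the agent's map, a similar copy of the
  terrain in its own units; the geometry is therefore done for \<open>segment_bordered\<close> sets,
  a class preserved by similarities, and the routes are carried back. The uniform constants of a
  round (\<open>e\<close> for the common first piece, \<open>\<rho>\<close> for the common
  continuation) are distances to a nearest node.\<close>

fun chain_length :: "'a::metric_space list \<Rightarrow> real" where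
  "chain_length (x # y # zs) = dist x y + chain_length (y # zs)"
| "chain_length _ = 0"

lemma chain_length_nonneg: "0 \<le> chain_length xs"
  by (induction xs rule: chain_length.induct) auto

lemma chain_length_eq_sum:
  "chain_length xs = (\<Sum>i<length xs - 1. dist (xs ! i) (xs ! Suc i))"
proof (induction xs rule: chain_length.induct)
  case (1 x y zs)
  then show ?case by (simp add: sum.lessThan_Suc_shift del: sum.lessThan_Suc)
qed auto

lemma chain_length_append:
  assumes "xs \<noteq> []" "ys \<noteq> []" "last xs = hd ys"
  shows "chain_length (xs @ tl ys) = chain_length xs + chain_length ys"
  using assms
proof (induction xs rule: chain_length.induct)
  case ("2_2" v)
  then show ?case by (cases ys) auto
qed auto

lemma chain_length_rev: "chain_length (rev xs) = chain_length xs"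
proof (induction xs rule: chain_length.induct)
  case (1 x y zs)
  have "chain_length (rev (x # y # zs)) = chain_length (rev (y # zs) @ tl [y, x])" by simp
  also have "\<dots> = chain_length (rev (y # zs)) + chain_length [y, x]"
    by (intro chain_length_append) auto
  finally show ?case using 1 by (simp add: dist_commute)
qed auto

lemma dist_le_chain_length: "xs \<noteq> [] \<Longrightarrow> dist (hd xs) (last xs) \<le> chain_length xs"
proof (induction xs rule: chain_length.induct)
  case (1 x y zs)
  then have "dist y (last (y # zs)) \<le> chain_length (y # zs)" by simp
  then show ?case using dist_triangle[of x "last (y # zs)" y] by simp
qed auto

lemma chain_length_map_similarity:
  assumes "\<And>x y. dist (f x) (f y) = c * dist x y"
  shows "chain_length (map f xs) = c * chain_length xs"
  by (induction xs rule: chain_length.induct) (auto simp: assms distrib_left)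

lemma chain_length_lipschitz:
  fixes f :: "real \<Rightarrow> 'a::metric_space"
  assumes "sorted ts" "ts \<noteq> []" "0 \<le> L"
    and "\<And>s t. s \<in> set ts \<Longrightarrow> t \<in> set ts \<Longrightarrow> dist (f s) (f t) \<le> L * \<bar>s - t\<bar>"
  shows "chain_length (map f ts) \<le> L * (last ts - hd ts)"
  using assms
proof (induction ts rule: chain_length.induct)
  case (1 x y zs)
  have "chain_length (map f (y # zs)) \<le> L * (last (y # zs) - hd (y # zs))"
    using 1 by auto
  moreover have "dist (f x) (f y) \<le> L * (y - x)"
    using 1(2) 1(5)[of x y] by simp
  ultimately show ?case by (simp add: algebra_simps)
qed auto

text \<open>The conjunct \<open>x \<in> T\<close> settles the one-point chain, on which
  \<open>successively\<close> is vacuous.\<close>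

definition poly_chain :: "'a::euclidean_space set \<Rightarrow> 'a \<Rightarrow> 'a \<Rightarrow> 'a list \<Rightarrow> bool" where
  "poly_chain T x y xs \<longleftrightarrow> xs \<noteq> [] \<and> hd xs = x \<and> last xs = y \<and> x \<in> T \<and>
     successively (\<lambda>a b. closed_segment a b \<subseteq> T) xs"

text \<open>The intrinsic (length) metric, with polygonal chains in place of rectifiable curves;
  \<open>terrain_dist_eq_gdist\<close> identifies it with \<open>terrain_dist\<close>. As an
  \<open>Inf\<close> of reals it is meaningful only where a chain exists, which connectedness
  provides.\<close>

definition gdist :: "'a::euclidean_space set \<Rightarrow> 'a \<Rightarrow> 'a \<Rightarrow> real" where
  "gdist T x y = Inf (chain_length ` {xs. poly_chain T x y xs})"

lemma poly_chain_segment: "closed_segment x y \<subseteq> T \<Longrightarrow> poly_chain T x y [x, y]"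
  by (auto simp: poly_chain_def)

lemma poly_chain_trans:
  assumes "poly_chain T x y xs" "poly_chain T y z ys"
  shows "poly_chain T x z (xs @ tl ys)"
    and "chain_length (xs @ tl ys) = chain_length xs + chain_length ys"
proof -
  obtain ys' where ys: "ys = y # ys'"
    using assms(2) by (cases ys) (auto simp: poly_chain_def)
  show "poly_chain T x z (xs @ tl ys)"
    using assms unfolding poly_chain_def ys
    by (cases ys') (auto simp: successively_append_iff successively_Cons)
  show "chain_length (xs @ tl ys) = chain_length xs + chain_length ys"
    using assms by (intro chain_length_append) (auto simp: poly_chain_def)
qed

lemma poly_chain_last_in:
  assumes "poly_chain T x y xs"
  shows "y \<in> T"
proof -
  have "xs \<noteq> [] \<Longrightarrow> hd xs \<in> T \<Longrightarrow> successively (\<lambda>a b. closed_segment a b \<subseteq> T) xs \<Longrightarrow> last xs \<in> T"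
    by (induction xs rule: induct_list012) auto
  then show ?thesis using assms by (auto simp: poly_chain_def)
qed

lemma poly_chain_rev:
  assumes "poly_chain T x y xs"
  shows "poly_chain T y x (rev xs)"
  using assms poly_chain_last_in[OF assms]
  by (auto simp: poly_chain_def hd_rev last_rev closed_segment_commute)

lemma poly_chain_affine_image:
  assumes "poly_chain T x y xs" and "\<And>a b. closed_segment (f a) (f b) = f ` closed_segment a b"
  shows "poly_chain (f ` T) (f x) (f y) (map f xs)"
  using assms(1) unfolding poly_chain_def
  by (auto simp: successively_map assms(2) hd_map last_map intro: successively_mono)

lemma gdist_lower: "poly_chain T x y xs \<Longrightarrow> gdist T x y \<le> chain_length xs"
  unfolding gdist_def by (rule cInf_lower) (auto intro!: bdd_belowI[of _ 0] chain_length_nonneg)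

lemma gdist_sym: "gdist T x y = gdist T y x"
proof -
  have "chain_length ` {xs. poly_chain T x y xs} \<subseteq> chain_length ` {xs. poly_chain T y x xs}" for x y :: 'a
    by (force simp: chain_length_rev intro: poly_chain_rev image_eqI[of _ _ "rev _"])
  then have "chain_length ` {xs. poly_chain T x y xs} = chain_length ` {xs. poly_chain T y x xs}"
    by blast
  then show ?thesis by (simp add: gdist_def)
qed

text \<open>Only the centre \<open>x\<close> is asked to see the nearby points: at a reflex corner
  two neighbours of \<open>x\<close> may fail to see each other. The radius depends on
  \<open>x\<close>, so statements about whole curves are obtained by bisection of the parameter
  interval.\<close>

locale star_space =
  fixes T :: "'a::euclidean_space set"
  assumes compact: "compact T"
    and connected: "connected T"
    and star: "x \<in> T \<Longrightarrow> \<exists>e>0. \<forall>y\<in>T \<inter> ball x e. closed_segment x y \<subseteq> T"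
begin

text \<open>Being joined by a chain is an equivalence relation whose classes are open by
  \<open>star\<close>, so a connected set has only one class.\<close>

lemma poly_chain_exists:
  assumes "x \<in> T" "y \<in> T"
  obtains xs where "poly_chain T x y xs"
proof -
  have "\<exists>xs. poly_chain T x y xs"
  proof (rule connected_equivalence_relation[OF connected assms])
    show "\<exists>xs. poly_chain T y x xs" if "\<exists>xs. poly_chain T x y xs" for x y
      using that poly_chain_rev by blast
    show "\<exists>xs. poly_chain T x z xs" if "\<exists>xs. poly_chain T x y xs" "\<exists>xs. poly_chain T y z xs" for x y z
      using that poly_chain_trans(1) by blast
    show "\<exists>U. openin (top_of_set T) U \<and> a \<in> U \<and> (\<forall>x\<in>U. \<exists>xs. poly_chain T a x xs)"
      if a: "a \<in> T" for a
    proof -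
      obtain e where e: "e > 0" "\<forall>y\<in>T \<inter> ball a e. closed_segment a y \<subseteq> T"
        using star[OF a] by blast
      then show ?thesis
        using a by (intro exI[of _ "T \<inter> ball a e"]) (auto intro: poly_chain_segment)
    qed
  qed
  then show ?thesis using that by blast
qed

lemma gdist_approx:
  assumes "x \<in> T" "y \<in> T" "e > 0"
  obtains xs where "poly_chain T x y xs" "chain_length xs < gdist T x y + e"
proof -
  obtain xs0 where "poly_chain T x y xs0" using poly_chain_exists assms by blast
  then have "chain_length ` {xs. poly_chain T x y xs} \<noteq> {}" by blast
  moreover have "bdd_below (chain_length ` {xs. poly_chain T x y xs})"
    by (auto intro!: bdd_belowI[of _ 0] chain_length_nonneg)
  moreover have "Inf (chain_length ` {xs. poly_chain T x y xs}) < gdist T x y + e"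
    using assms by (simp add: gdist_def)
  ultimately have "\<exists>z\<in>chain_length ` {xs. poly_chain T x y xs}. z < gdist T x y + e"
    by (simp add: cInf_less_iff)
  then show ?thesis using that by blast
qed

lemma dist_le_gdist:
  assumes "x \<in> T" "y \<in> T"
  shows "dist x y \<le> gdist T x y"
proof (rule field_le_epsilon)
  fix e :: real assume "e > 0"
  then obtain xs where "poly_chain T x y xs" "chain_length xs < gdist T x y + e"
    using gdist_approx assms by blast
  then show "dist x y \<le> gdist T x y + e"
    using dist_le_chain_length[of xs] by (auto simp: poly_chain_def)
qed

lemma gdist_nonneg: "x \<in> T \<Longrightarrow> y \<in> T \<Longrightarrow> 0 \<le> gdist T x y"
  using dist_le_gdist[of x y] zero_le_dist[of x y] by linarith

lemma gdist_segment:
  assumes "closed_segment x y \<subseteq> T"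
  shows "gdist T x y = dist x y"
proof (rule antisym)
  show "gdist T x y \<le> dist x y"
    using gdist_lower[OF poly_chain_segment[OF assms]] by simp
  show "dist x y \<le> gdist T x y"
    using assms by (intro dist_le_gdist) auto
qed

lemma gdist_refl: "x \<in> T \<Longrightarrow> gdist T x x = 0"
  using gdist_segment[of x x] by simp

lemma gdist_triangle:
  assumes "x \<in> T" "y \<in> T" "z \<in> T"
  shows "gdist T x z \<le> gdist T x y + gdist T y z"
proof (rule field_le_epsilon)
  fix e :: real assume "e > 0"
  then have "e / 2 > 0" by simp
  obtain xs where xs: "poly_chain T x y xs" "chain_length xs < gdist T x y + e / 2"
    using gdist_approx[OF assms(1,2) \<open>e / 2 > 0\<close>] .
  obtain ys where ys: "poly_chain T y z ys" "chain_length ys < gdist T y z + e / 2"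
    using gdist_approx[OF assms(2,3) \<open>e / 2 > 0\<close>] .
  have "gdist T x z \<le> chain_length xs + chain_length ys"
    using gdist_lower[OF poly_chain_trans(1)[OF xs(1) ys(1)]] poly_chain_trans(2)[OF xs(1) ys(1)] by simp
  then show "gdist T x z \<le> gdist T x y + gdist T y z + e" using xs ys by simp
qed

lemma gdist_local:
  assumes "x \<in> T"
  obtains e where "e > 0" "\<And>y. y \<in> T \<Longrightarrow> dist x y < e \<Longrightarrow> closed_segment x y \<subseteq> T \<and> gdist T x y = dist x y"
proof -
  obtain e where e: "e > 0" "\<forall>y\<in>T \<inter> ball x e. closed_segment x y \<subseteq> T"
    using star[OF assms] by blast
  show ?thesis
    by (rule that[OF e(1)]) (use e(2) gdist_segment in auto)
qed

text \<open>Near \<open>x\<close> the intrinsic and the Euclidean distance from \<open>x\<close>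
  agree, so the triangle inequality bounds the change of \<open>gdist T v\<close> at
  \<open>x\<close> by the Euclidean displacement.\<close>

lemma continuous_on_gdist:
  assumes "v \<in> T"
  shows "continuous_on T (gdist T v)"
  unfolding continuous_on_iff
proof (intro ballI allI impI)
  fix x and e :: real assume x: "x \<in> T" and e: "e > 0"
  obtain d where d: "d > 0" "\<And>y. y \<in> T \<Longrightarrow> dist x y < d \<Longrightarrow> closed_segment x y \<subseteq> T \<and> gdist T x y = dist x y"
    using gdist_local[OF x] by metis
  have "dist (gdist T v y) (gdist T v x) < e" if "y \<in> T" "dist y x < min d e" for y
  proof -
    have "gdist T x y = dist x y" "gdist T y x = dist x y"
      using d(2)[OF that(1)] that(2) by (auto simp: dist_commute gdist_sym[of T y])
    then show ?thesis
      using gdist_triangle[OF assms x that(1)] gdist_triangle[OF assms that(1) x] that(2)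
      by (auto simp: dist_real_def dist_commute)
  qed
  then show "\<exists>d>0. \<forall>x'\<in>T. dist x' x < d \<longrightarrow> dist (gdist T v x') (gdist T v x) < e"
    using d(1) e by (intro exI[of _ "min d e"]) auto
qed

text \<open>No curve in \<open>T\<close> beats the chains. Segments between sample points of
  \<open>g\<close> may leave \<open>T\<close>, so \<open>gdist\<close> of the end points is compared
  with an inscribed sum instead of exhibiting a chain. The property adds over adjacent intervals and
  holds on short ones; bisection does the rest.\<close>

lemma gdist_le_variation:
  fixes g :: "real \<Rightarrow> 'a"
  assumes "a \<le> b" "continuous_on {a..b} g" "g ` {a..b} \<subseteq> T"
  shows "\<exists>ts. ts \<noteq> [] \<and> sorted ts \<and> hd ts = a \<and> last ts = b \<and> set ts \<subseteq> {a..b} \<and>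
    gdist T (g a) (g b) \<le> chain_length (map g ts)"
proof -
  define P where "P = (\<lambda>s t. a \<le> s \<and> s \<le> t \<and> t \<le> b \<longrightarrow>
    (\<exists>ts. ts \<noteq> [] \<and> sorted ts \<and> hd ts = s \<and> last ts = t \<and> set ts \<subseteq> {s..t} \<and>
     gdist T (g s) (g t) \<le> chain_length (map g ts)))"
  have "P a b"
    using assms(1)
  proof (induction rule: Bolzano)
    case (trans r s t)
    show ?case
      unfolding P_def
    proof (intro impI)
      assume *: "a \<le> r \<and> r \<le> t \<and> t \<le> b"
      obtain ts1 where 1: "ts1 \<noteq> []" "sorted ts1" "hd ts1 = r" "last ts1 = s" "set ts1 \<subseteq> {r..s}"
          "gdist T (g r) (g s) \<le> chain_length (map g ts1)"
        using trans * unfolding P_def by fastforce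
      obtain ts2 where 2: "ts2 \<noteq> []" "sorted ts2" "hd ts2 = s" "last ts2 = t" "set ts2 \<subseteq> {s..t}"
          "gdist T (g s) (g t) \<le> chain_length (map g ts2)"
        using trans * unfolding P_def by fastforce
      have in_T: "g r \<in> T" "g s \<in> T" "g t \<in> T"
        using * trans(3,4) assms(3) by auto
      have len: "chain_length (map g ts1 @ tl (map g ts2)) = chain_length (map g ts1) + chain_length (map g ts2)"
        using 1 2 by (intro chain_length_append) (auto simp: hd_map last_map)
      have tl: "set (tl ts2) \<subseteq> {s..t}" using 2(5) list.set_sel(2)[OF 2(1)] by blast
      have "sorted (ts1 @ tl ts2)"
        using 1(2,5) 2(2) tl trans(3,4) by (auto simp: sorted_append sorted_tl) (meson atLeastAtMost_iff order_trans subsetD)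
      moreover have "last (ts1 @ tl ts2) = t"
        using 1(1,4) 2(1,3,4) by (cases ts2) (auto simp: last_append)
      moreover have "gdist T (g r) (g t) \<le> chain_length (map g (ts1 @ tl ts2))"
        using gdist_triangle[OF in_T] len 1(6) 2(6) by (simp add: map_tl)
      moreover have "set (ts1 @ tl ts2) \<subseteq> {r..t}" using 1(5) tl trans(3,4) by force
      ultimately show "\<exists>ts. ts \<noteq> [] \<and> sorted ts \<and> hd ts = r \<and> last ts = t \<and> set ts \<subseteq> {r..t} \<and>
          gdist T (g r) (g t) \<le> chain_length (map g ts)"
        using 1 by (intro exI[of _ "ts1 @ tl ts2"]) auto
    qed
  next
    case (local x)
    have gx: "g x \<in> T" using local assms(3) by auto
    obtain e where e: "e > 0" "\<And>y. y \<in> T \<Longrightarrow> dist (g x) y < e \<Longrightarrow> closed_segment (g x) y \<subseteq> T \<and> gdist T (g x) y = dist (g x) y"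
      using gdist_local[OF gx] by metis
    obtain d where d: "d > 0" "\<And>s. s \<in> {a..b} \<Longrightarrow> dist s x < d \<Longrightarrow> dist (g s) (g x) < e"
      using assms(2) local e(1) unfolding continuous_on_iff by (metis atLeastAtMost_iff)
    have "P s t" if st: "s \<le> x" "x \<le> t" "t - s < d" for s t
      unfolding P_def
    proof (intro impI)
      assume *: "a \<le> s \<and> s \<le> t \<and> t \<le> b"
      then have "g s \<in> T" "g t \<in> T" "dist (g s) (g x) < e" "dist (g t) (g x) < e"
        using assms(3) st d(2)[of s] d(2)[of t] by (auto simp: dist_real_def)
      then have "gdist T (g s) (g x) = dist (g s) (g x)" "gdist T (g x) (g t) = dist (g x) (g t)"
        using e(2)[of "g s"] e(2)[of "g t"] by (auto simp: dist_commute gdist_sym[of T "g s"])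
      \<comment> \<open>The sample point \<open>x\<close> is inserted because \<open>star\<close>
        speaks only of segments that end at \<open>x\<close>.\<close>
      then have "gdist T (g s) (g t) \<le> chain_length (map g [s, x, t])"
        using gdist_triangle[OF \<open>g s \<in> T\<close> gx \<open>g t \<in> T\<close>] by simp
      then show "\<exists>ts. ts \<noteq> [] \<and> sorted ts \<and> hd ts = s \<and> last ts = t \<and> set ts \<subseteq> {s..t} \<and>
          gdist T (g s) (g t) \<le> chain_length (map g ts)"
        using st by (intro exI[of _ "[s, x, t]"]) auto
    qed
    then show ?case using d(1) by blast
  qed
  then show ?thesis using assms(1) by (simp add: P_def)
qed

end

section \<open>Geodesics\<close>

text \<open>Arc-length parametrization, held constant outside the interval of the chain. Since it is
  1-Lipschitz on the whole line, parametrizations of chains of different lengths can be compared on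
  a common interval.\<close>

lemma poly_chain_parametrization:
  assumes "poly_chain T x y xs"
  shows "\<exists>\<gamma>. (\<forall>s\<le>0. \<gamma> s = x) \<and> (\<forall>s\<ge>chain_length xs. \<gamma> s = y) \<and> range \<gamma> \<subseteq> T \<and>
    (\<forall>s t. dist (\<gamma> s) (\<gamma> t) \<le> \<bar>s - t\<bar>)"
  using assms
proof (induction xs arbitrary: x rule: chain_length.induct)
  case (1 a b zs)
  have x: "x = a" and seg: "closed_segment a b \<subseteq> T" and "poly_chain T b y (b # zs)"
    using 1(2) by (auto simp: poly_chain_def)
  then obtain \<gamma> where \<gamma>: "\<forall>s\<le>0. \<gamma> s = b" "\<forall>s\<ge>chain_length (b # zs). \<gamma> s = y" "range \<gamma> \<subseteq> T"
      "\<forall>s t. dist (\<gamma> s) (\<gamma> t) \<le> \<bar>s - t\<bar>"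
    using 1(1) by blast
  define d where "d = dist a b"
  \<comment> \<open>A degenerate first edge has \<open>d = 0\<close>; division by zero yields
    \<open>0\<close>, so the first branch is then the constant \<open>a\<close>, which equals
    \<open>b\<close>.\<close>
  define \<delta> where "\<delta> = (\<lambda>s. if s \<le> d then a + (max 0 s / d) *\<^sub>R (b - a) else \<gamma> (s - d))"
  have d0: "0 \<le> d" by (simp add: d_def)
  have nb: "norm (b - a) = d" by (simp add: d_def dist_norm norm_minus_commute)
  have aux: "dist (\<delta> s) (\<delta> t) \<le> t - s" if "s \<le> t" for s t
  proof -
    consider "t \<le> d" | "s \<le> d" "d < t" | "d < s" using that by linarith
    then show ?thesis
    proof cases
      case 1
      have "\<delta> s - \<delta> t = (max 0 s / d - max 0 t / d) *\<^sub>R (b - a)"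
        using 1 that by (simp add: \<delta>_def algebra_simps)
      then have "dist (\<delta> s) (\<delta> t) = \<bar>max 0 s / d - max 0 t / d\<bar> * d"
        by (simp add: dist_norm nb)
      also have "\<dots> \<le> \<bar>max 0 s - max 0 t\<bar>"
        using d0 by (cases "d = 0") (auto simp: diff_divide_distrib[symmetric])
      also have "\<dots> \<le> t - s" using that by auto
      finally show ?thesis .
    next
      case 2
      have "dist (\<delta> s) b \<le> d - s"
      proof (cases "d = 0")
        case True
        then show ?thesis using 2 nb by (simp add: \<delta>_def)
      next
        case False
        have "\<delta> s - b = (max 0 s / d - 1) *\<^sub>R (b - a)"
          using 2 by (simp add: \<delta>_def algebra_simps)
        then have "dist (\<delta> s) b = \<bar>max 0 s / d - 1\<bar> * d"
          by (simp add: dist_norm nb)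
        also have "\<dots> = \<bar>max 0 s - d\<bar>"
        proof -
          have "max 0 s / d - 1 = (max 0 s - d) / d" using False by (simp add: field_simps)
          then show ?thesis using False d0 by simp
        qed
        also have "\<dots> \<le> d - s" using 2 d0 by auto
        finally show ?thesis .
      qed
      moreover have "dist b (\<delta> t) \<le> t - d"
      proof -
        have "dist (\<gamma> 0) (\<gamma> (t - d)) \<le> \<bar>0 - (t - d)\<bar>" using \<gamma>(4) by blast
        then show ?thesis using 2 \<gamma>(1) by (simp add: \<delta>_def)
      qed
      ultimately show ?thesis using dist_triangle[of "\<delta> s" "\<delta> t" b] by linarith
    next
      case 3
      have "dist (\<gamma> (s - d)) (\<gamma> (t - d)) \<le> \<bar>(s - d) - (t - d)\<bar>" using \<gamma>(4) by blast
      then show ?thesis using 3 that by (simp add: \<delta>_def)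
    qed
  qed
  have "dist (\<delta> s) (\<delta> t) \<le> \<bar>s - t\<bar>" for s t
    using aux[of s t] aux[of t s] by (cases "s \<le> t") (auto simp: dist_commute)
  moreover have "\<delta> s = x" if "s \<le> 0" for s
    using that d0 by (simp add: \<delta>_def x)
  moreover have "\<delta> s = y" if "s \<ge> chain_length (a # b # zs)" for s
  proof (cases "s = d")
    case True
    then have "chain_length (b # zs) \<le> 0" using that by (simp add: d_def)
    then have "\<gamma> 0 = y" using \<gamma>(2) by blast
    then have "y = b" using \<gamma>(1) by auto
    then show ?thesis using True nb by (cases "d = 0") (auto simp: \<delta>_def d0 d_def)
  next
    case False
    then have "s > d" using that chain_length_nonneg[of "b # zs"] by (simp add: d_def)
    then show ?thesis using that \<gamma>(2) by (simp add: \<delta>_def d_def)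
  qed
  moreover have "\<delta> s \<in> T" for s
  proof (cases "s \<le> d")
    case True
    have "0 \<le> max 0 s / d" "max 0 s / d \<le> 1" using True d0 by (auto simp: divide_simps)
    then have "a + (max 0 s / d) *\<^sub>R (b - a) \<in> closed_segment a b"
      unfolding in_segment by (intro exI[of _ "max 0 s / d"]) (auto simp: algebra_simps)
    then show ?thesis using seg True by (auto simp: \<delta>_def)
  next
    case False
    then show ?thesis using \<gamma>(3) by (auto simp: \<delta>_def)
  qed
  ultimately show ?case by (intro exI[of _ \<delta>]) blast
next
  case "2_1"
  then show ?case by (simp add: poly_chain_def)
next
  case ("2_2" v)
  then show ?case by (intro exI[of _ "\<lambda>_. v"]) (auto simp: poly_chain_def)
qed

text \<open>The Lipschitz bound is an inequality, which survives limits; unit speed follows in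
  \<open>gdist_geodesic\<close>, because the domain has exactly the length
  \<open>gdist T v w\<close>.\<close>

definition geodesic :: "'a::euclidean_space set \<Rightarrow> 'a \<Rightarrow> 'a \<Rightarrow> (real \<Rightarrow> 'a) \<Rightarrow> bool" where
  "geodesic T v w \<gamma> \<longleftrightarrow> v \<in> T \<and> w \<in> T \<and> \<gamma> 0 = v \<and> \<gamma> (gdist T v w) = w \<and>
     (\<forall>s\<in>{0..gdist T v w}. \<gamma> s \<in> T) \<and>
     (\<forall>s\<in>{0..gdist T v w}. \<forall>t\<in>{0..gdist T v w}. dist (\<gamma> s) (\<gamma> t) \<le> \<bar>s - t\<bar>)"

lemma geodesicD:
  assumes "geodesic T v w \<gamma>"
  shows "v \<in> T" "w \<in> T" "\<gamma> 0 = v" "\<gamma> (gdist T v w) = w"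
    and "s \<in> {0..gdist T v w} \<Longrightarrow> \<gamma> s \<in> T"
    and "s \<in> {0..gdist T v w} \<Longrightarrow> t \<in> {0..gdist T v w} \<Longrightarrow> dist (\<gamma> s) (\<gamma> t) \<le> \<bar>s - t\<bar>"
  using assms unfolding geodesic_def by blast+

text \<open>Tightness forces equality in the triangle inequality through \<open>\<gamma> r\<close>,
  which in a Euclidean space places \<open>\<gamma> r\<close> on the segment.\<close>

lemma lipschitz_segment:
  fixes \<gamma> :: "real \<Rightarrow> 'a::euclidean_space"
  assumes lip: "\<And>r r'. r \<in> {s..t} \<Longrightarrow> r' \<in> {s..t} \<Longrightarrow> dist (\<gamma> r) (\<gamma> r') \<le> \<bar>r - r'\<bar>"
    and tight: "dist (\<gamma> s) (\<gamma> t) = t - s" and r: "r \<in> {s..t}"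
  shows "\<gamma> r = \<gamma> s + (r - s) *\<^sub>R sgn (\<gamma> t - \<gamma> s)"
proof (cases "s = t")
  case False
  then have st: "s < t" using r by auto
  have "dist (\<gamma> s) (\<gamma> r) \<le> r - s" "dist (\<gamma> r) (\<gamma> t) \<le> t - r"
    using lip[of s r] lip[of r t] r by auto
  then have *: "dist (\<gamma> s) (\<gamma> r) = r - s" "dist (\<gamma> r) (\<gamma> t) = t - r"
    using dist_triangle[of "\<gamma> s" "\<gamma> t" "\<gamma> r"] tight by linarith+
  then have "dist (\<gamma> s) (\<gamma> t) = dist (\<gamma> s) (\<gamma> r) + dist (\<gamma> r) (\<gamma> t)" using tight by simp
  then have "(r - s) *\<^sub>R (\<gamma> r - \<gamma> t) = (t - r) *\<^sub>R (\<gamma> s - \<gamma> r)"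
    using * dist_triangle_eq[of "\<gamma> s" "\<gamma> t" "\<gamma> r"] by (simp add: dist_norm)
  then have "(t - s) *\<^sub>R \<gamma> r = (t - s) *\<^sub>R \<gamma> s + (r - s) *\<^sub>R (\<gamma> t - \<gamma> s)"
    by (simp add: algebra_simps)
  then have "(1 / (t - s)) *\<^sub>R (t - s) *\<^sub>R \<gamma> r = (1 / (t - s)) *\<^sub>R ((t - s) *\<^sub>R \<gamma> s + (r - s) *\<^sub>R (\<gamma> t - \<gamma> s))"
    by simp
  then have "\<gamma> r = \<gamma> s + ((r - s) / (t - s)) *\<^sub>R (\<gamma> t - \<gamma> s)"
    using st by (simp add: scaleR_add_right)
  moreover have "norm (\<gamma> t - \<gamma> s) = t - s"
    using tight by (simp add: dist_norm norm_minus_commute)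
  ultimately show ?thesis by (simp add: sgn_div_norm divide_inverse)
qed (use r in auto)

text \<open>The two straight pieces overlap in \<open>{b..c}\<close>, and since \<open>b < c\<close>
  the overlap fixes a common direction; pieces that merely touch could form a turn.\<close>

lemma lipschitz_segment_join:
  fixes \<gamma> :: "real \<Rightarrow> 'a::euclidean_space"
  assumes lip: "\<And>r r'. r \<in> {a..d} \<Longrightarrow> r' \<in> {a..d} \<Longrightarrow> dist (\<gamma> r) (\<gamma> r') \<le> \<bar>r - r'\<bar>"
    and "a \<le> b" "b < c" "c \<le> d"
    and ac: "dist (\<gamma> a) (\<gamma> c) = c - a" and bd: "dist (\<gamma> b) (\<gamma> d) = d - b"
  shows "dist (\<gamma> a) (\<gamma> d) = d - a"
proof -
  define u where "u = sgn (\<gamma> c - \<gamma> a)"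
  define u' where "u' = sgn (\<gamma> d - \<gamma> b)"
  have 1: "\<gamma> r = \<gamma> a + (r - a) *\<^sub>R u" if "r \<in> {a..c}" for r
    using lipschitz_segment[of a c \<gamma> r] lip ac that assms(2-4) by (auto simp: u_def)
  have 2: "\<gamma> r = \<gamma> b + (r - b) *\<^sub>R u'" if "r \<in> {b..d}" for r
    using lipschitz_segment[of b d \<gamma> r] lip bd that assms(2-4) by (auto simp: u'_def)
  have "\<gamma> c - \<gamma> b = (c - a) *\<^sub>R u - (b - a) *\<^sub>R u"
    using 1[of b] 1[of c] assms(2-4) by simp
  then have "\<gamma> c - \<gamma> b = (c - b) *\<^sub>R u"
    by (simp add: scaleR_diff_left[symmetric])
  moreover have "\<gamma> c - \<gamma> b = (c - b) *\<^sub>R u'"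
    using 2[of c] assms(2-4) by (simp add: algebra_simps)
  ultimately have "u = u'" using assms(3) by simp
  then have "\<gamma> d - \<gamma> a = (b - a) *\<^sub>R u + (d - b) *\<^sub>R u"
    using 1[of b] 2[of d] assms(2-4) by simp
  then have "\<gamma> d - \<gamma> a = (d - a) *\<^sub>R u"
    by (simp add: scaleR_add_left[symmetric])
  moreover have "norm u = 1"
    using ac assms(2-4) by (auto simp: u_def norm_sgn)
  ultimately show ?thesis
    using assms(2-4) by (simp add: dist_norm norm_minus_commute[of "\<gamma> a"])
qed

context star_space
begin

text \<open>Chains of length less than \<open>D + 1 / Suc n\<close> give 1-Lipschitz curves on
  \<open>{0..D}\<close>; a uniform limit keeps the bound and stays in the closed set
  \<open>T\<close>. It ends at \<open>w\<close> because at time \<open>D\<close> the approximating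
  curves have at most \<open>1 / Suc n\<close> left to go.\<close>

lemma geodesic_exists:
  assumes v: "v \<in> T" and w: "w \<in> T"
  obtains \<gamma> where "geodesic T v w \<gamma>"
proof -
  define D where "D = gdist T v w"
  have D0: "0 \<le> D" using gdist_nonneg v w by (simp add: D_def)
  have "\<exists>\<gamma> L. (\<forall>s\<le>0. \<gamma> s = v) \<and> \<gamma> L = w \<and> range \<gamma> \<subseteq> T \<and>
      (\<forall>s t. dist (\<gamma> s) (\<gamma> t) \<le> \<bar>s - t\<bar>) \<and> D \<le> L \<and> L < D + 1 / real (Suc n)" for n
  proof -
    obtain xs where xs: "poly_chain T v w xs" "chain_length xs < D + 1 / real (Suc n)"
      using gdist_approx[OF v w, of "1 / real (Suc n)"] by (auto simp: D_def)
    then show ?thesis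
      using poly_chain_parametrization[OF xs(1)] gdist_lower[OF xs(1)] unfolding D_def by blast
  qed
  then obtain F L where F: "\<And>n s. s \<le> 0 \<Longrightarrow> F n s = v" "\<And>n. F n (L n) = w" "\<And>n s. F n s \<in> T"
      "\<And>n s t. dist (F n s) (F n t) \<le> \<bar>s - t\<bar>" "\<And>n. D \<le> L n" "\<And>n. L n < D + 1 / real (Suc n)"
    by (metis range_subsetD)
  obtain M where M: "\<And>x. x \<in> T \<Longrightarrow> norm x \<le> M"
    using compact_imp_bounded[OF compact] by (auto simp: bounded_iff)
  obtain g k where gk: "strict_mono (k :: nat \<Rightarrow> nat)"
      "\<And>e. 0 < e \<Longrightarrow> \<exists>N. \<forall>n x. n \<ge> N \<and> x \<in> {0..D} \<longrightarrow> norm (F (k n) x - g x) < e"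
  proof (rule Arzela_Ascoli[of "{0..D}" F M])
    show "\<exists>d. 0 < d \<and> (\<forall>n y. y \<in> {0..D} \<and> norm (x - y) < d \<longrightarrow> norm (F n x - F n y) < e)"
      if "0 < e" for x e
      using that F(4) by (intro exI[of _ e]) (auto simp: dist_norm intro: le_less_trans)
  qed (use M F(3) in auto)
  have lim: "(\<lambda>n. F (k n) s) \<longlonglongrightarrow> g s" if "s \<in> {0..D}" for s
    unfolding LIMSEQ_def dist_norm using gk(2) that by blast
  have "g s \<in> T" if "s \<in> {0..D}" for s
    using closed_sequentially[OF compact_imp_closed[OF compact] _ lim[OF that]] F(3) by blast
  moreover have "dist (g s) (g t) \<le> \<bar>s - t\<bar>" if "s \<in> {0..D}" "t \<in> {0..D}" for s t
    using tendsto_dist[OF lim[OF that(1)] lim[OF that(2)]] F(4)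
    by (intro LIMSEQ_le_const2) auto
  moreover have "g 0 = v"
    using LIMSEQ_unique[OF lim[of 0]] F(1) D0 by auto
  moreover have "g D = w"
  proof -
    have "dist (F (k n) D) w \<le> 1 / real (Suc n)" for n
    proof -
      have "dist (F (k n) D) (F (k n) (L (k n))) \<le> \<bar>D - L (k n)\<bar>" by (rule F(4))
      also have "\<dots> \<le> 1 / real (Suc (k n))" using F(5,6)[of "k n"] by simp
      also have "\<dots> \<le> 1 / real (Suc n)"
        using seq_suble[OF gk(1), of n] by (simp add: frac_le)
      finally show ?thesis by (simp add: F(2))
    qed
    then have "\<forall>\<^sub>F n in sequentially. dist (F (k n) D) w \<le> 1 / real (Suc n)"
      by (intro always_eventually allI)
    then have "(\<lambda>n. dist (F (k n) D) w) \<longlonglongrightarrow> 0"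
      by (rule tendsto_sandwich[OF always_eventually _ tendsto_const LIMSEQ_Suc[OF lim_1_over_n], rotated])
        simp
    then have "(\<lambda>n. F (k n) D) \<longlonglongrightarrow> w" by (rule iffD2[OF tendsto_dist_iff])
    then show ?thesis using LIMSEQ_unique[OF lim[of D]] D0 by auto
  qed
  ultimately have "geodesic T v w g"
    using v w by (auto simp: geodesic_def D_def)
  then show ?thesis using that by blast
qed

lemma geodesic_continuous: "geodesic T v w \<gamma> \<Longrightarrow> continuous_on {0..gdist T v w} \<gamma>"
  unfolding continuous_on_iff
proof (intro ballI allI impI)
  fix s and e :: real
  assume \<gamma>: "geodesic T v w \<gamma>" and s: "s \<in> {0..gdist T v w}" and "e > 0"
  have "dist (\<gamma> t) (\<gamma> s) \<le> dist t s" if "t \<in> {0..gdist T v w}" for t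
    using \<gamma> s that unfolding geodesic_def dist_real_def by blast
  then show "\<exists>d>0. \<forall>t\<in>{0..gdist T v w}. dist t s < d \<longrightarrow> dist (\<gamma> t) (\<gamma> s) < e"
    using \<open>e > 0\<close> by (intro exI[of _ e]) (blast intro: le_less_trans)
qed

text \<open>By the Lipschitz bound each piece costs at most its parameter length. The pieces
  \<open>{0..s}\<close>, \<open>{s..t}\<close> and \<open>{t..gdist T v w}\<close> together cost at
  least \<open>gdist T v w\<close>, so none can cost less.\<close>

lemma gdist_geodesic:
  assumes \<gamma>: "geodesic T v w \<gamma>" and st: "0 \<le> s" "s \<le> t" "t \<le> gdist T v w"
  shows "gdist T (\<gamma> s) (\<gamma> t) = t - s"
proof -
  have upper: "gdist T (\<gamma> s) (\<gamma> t) \<le> t - s" if st: "0 \<le> s" "s \<le> t" "t \<le> gdist T v w" for s t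
  proof -
    have sub: "{s..t} \<subseteq> {0..gdist T v w}" using st by auto
    then have "\<gamma> ` {s..t} \<subseteq> T" using geodesicD(5)[OF \<gamma>] by blast
    then obtain ts where ts: "ts \<noteq> []" "sorted ts" "hd ts = s" "last ts = t" "set ts \<subseteq> {s..t}"
        "gdist T (\<gamma> s) (\<gamma> t) \<le> chain_length (map \<gamma> ts)"
      using gdist_le_variation[OF st(2) continuous_on_subset[OF geodesic_continuous[OF \<gamma>] sub]] by blast
    have "chain_length (map \<gamma> ts) \<le> 1 * (last ts - hd ts)"
    proof (rule chain_length_lipschitz)
      fix r r' assume "r \<in> set ts" "r' \<in> set ts"
      then have "r \<in> {0..gdist T v w}" "r' \<in> {0..gdist T v w}" using ts(5) sub by blast+
      then show "dist (\<gamma> r) (\<gamma> r') \<le> 1 * \<bar>r - r'\<bar>"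
        using geodesicD(6)[OF \<gamma>] by simp
    qed (use ts in auto)
    with ts show ?thesis by simp
  qed
  have in_T: "\<gamma> s \<in> T" "\<gamma> t \<in> T" "v \<in> T" "w \<in> T" using \<gamma> st by (auto simp: geodesic_def)
  have "gdist T v w \<le> gdist T v (\<gamma> s) + gdist T (\<gamma> s) w" "gdist T (\<gamma> s) w \<le> gdist T (\<gamma> s) (\<gamma> t) + gdist T (\<gamma> t) w"
    using in_T by (auto intro: gdist_triangle)
  then show ?thesis
    using upper[of 0 s] upper[OF st] upper[of t "gdist T v w"] st \<gamma> by (auto simp: geodesic_def)
qed

text \<open>So \<open>gdist T v\<close> inverts every geodesic from \<open>v\<close>: the parameter
  can be read off the point, whichever geodesic is used.\<close>

lemma gdist_geodesic_start:
  "geodesic T v w \<gamma> \<Longrightarrow> s \<in> {0..gdist T v w} \<Longrightarrow> gdist T v (\<gamma> s) = s"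
  using gdist_geodesic[of v w \<gamma> 0 s] by (auto simp: geodesic_def)

lemma geodesic_inj_on: "geodesic T v w \<gamma> \<Longrightarrow> inj_on \<gamma> {0..gdist T v w}"
  by (rule inj_onI) (metis gdist_geodesic_start)

text \<open>Switching is possible because both curves are at the common point at the same time
  \<open>s\<close>; times on different sides of \<open>s\<close> are compared through this
  point.\<close>

lemma geodesic_splice:
  assumes \<gamma>: "geodesic T v w \<gamma>" and \<delta>: "geodesic T v w \<delta>"
    and s: "s \<in> {0..gdist T v w}" "\<gamma> s = \<delta> s"
  shows "geodesic T v w (\<lambda>r. if r \<le> s then \<gamma> r else \<delta> r)"
proof -
  have aux: "dist (\<gamma> r) (\<delta> t) \<le> t - r" if "0 \<le> r" "r \<le> s" "s < t" "t \<le> gdist T v w" for r t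
  proof -
    have "dist (\<gamma> r) (\<gamma> s) \<le> \<bar>r - s\<bar>" "dist (\<delta> s) (\<delta> t) \<le> \<bar>s - t\<bar>"
      by (rule geodesicD(6)[OF \<gamma>] geodesicD(6)[OF \<delta>]; use s(1) that in auto)+
    then have "dist (\<gamma> r) (\<gamma> s) \<le> s - r" "dist (\<delta> s) (\<delta> t) \<le> t - s"
      using that by auto
    then show ?thesis using dist_triangle[of "\<gamma> r" "\<delta> t" "\<gamma> s"] s(2) by simp
  qed
  have "dist (if r \<le> s then \<gamma> r else \<delta> r) (if t \<le> s then \<gamma> t else \<delta> t) \<le> \<bar>r - t\<bar>"
    if "r \<in> {0..gdist T v w}" "t \<in> {0..gdist T v w}" for r t
    using aux[of r t] aux[of t r] that \<gamma> \<delta>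
    by (auto simp: geodesic_def dist_commute)
  then show ?thesis
    using \<gamma> \<delta> s unfolding geodesic_def by (auto split: if_splits)
qed

text \<open>Close to \<open>\<gamma> s\<close> the intrinsic distance from \<open>\<gamma> s\<close>
  is Euclidean, so the tightness that a geodesic has in \<open>gdist\<close> becomes tightness in
  \<open>dist\<close>.\<close>

lemma geodesic_leaves_straight:
  assumes \<gamma>: "geodesic T v w \<gamma>" and s: "0 \<le> s" "s < gdist T v w"
  obtains e where "e > 0" "s + e \<le> gdist T v w" "dist (\<gamma> s) (\<gamma> (s + e)) = e"
proof -
  have "\<gamma> s \<in> T" using \<gamma> s by (auto simp: geodesic_def)
  then obtain d where d: "d > 0" "\<And>y. y \<in> T \<Longrightarrow> dist (\<gamma> s) y < d \<Longrightarrow>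
      closed_segment (\<gamma> s) y \<subseteq> T \<and> gdist T (\<gamma> s) y = dist (\<gamma> s) y"
    using gdist_local by metis
  define e where "e = min (d / 2) (gdist T v w - s)"
  have e: "e > 0" "s + e \<le> gdist T v w" "e < d" using d(1) s by (auto simp: e_def)
  have "dist (\<gamma> s) (\<gamma> (s + e)) \<le> \<bar>s - (s + e)\<bar>" "\<gamma> (s + e) \<in> T"
    by (rule geodesicD(5,6)[OF \<gamma>]; use s e(1,2) in auto)+
  then have "dist (\<gamma> s) (\<gamma> (s + e)) = e"
    using d(2)[of "\<gamma> (s + e)"] e gdist_geodesic[OF \<gamma>, of s "s + e"] s by auto
  then show ?thesis using that e by blast
qed

end

section \<open>Shortest paths are reparametrized geodesics\<close>

locale planar_star_space = star_space T for T :: "complex set"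
begin

lemma curve_length_upperI:
  assumes "\<And>ts. sorted ts \<Longrightarrow> set ts \<subseteq> {0..1} \<Longrightarrow> chain_length (map g ts) \<le> L"
  shows "curve_length g \<le> ereal L"
  unfolding curve_length_def
proof (rule SUP_least)
  fix ts :: "real list" assume "ts \<in> {ts. sorted ts \<and> set ts \<subseteq> {0..1}}"
  then have "chain_length (map g ts) \<le> L" using assms by blast
  then show "ereal (\<Sum>i<length ts - 1. dist (g (ts ! i)) (g (ts ! Suc i))) \<le> ereal L"
    by (simp add: chain_length_eq_sum)
qed

lemma chain_length_le_curve_length:
  assumes "sorted ts" "set ts \<subseteq> {0..1}"
  shows "ereal (chain_length (map g ts)) \<le> curve_length g"
proof -
  have "chain_length (map g ts) = (\<Sum>i<length ts - 1. dist (g (ts ! i)) (g (ts ! Suc i)))"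
    by (simp add: chain_length_eq_sum)
  then show ?thesis
    unfolding curve_length_def using assms by (auto intro: SUP_upper2)
qed

text \<open>Three distances rather than one: with \<open>s\<close> and \<open>t\<close> free, a
  curve of minimal length is seen to waste nothing between them, which makes
  \<open>gdist T v\<close> monotone along it.\<close>

lemma gdist_three_le_curve_length:
  assumes g: "g \<in> paths_in T v w" and st: "0 \<le> s" "s \<le> t" "t \<le> 1"
  shows "ereal (gdist T v (g s) + gdist T (g s) (g t) + gdist T (g t) w) \<le> curve_length g"
proof -
  have cont: "continuous_on {0..1} g" and im: "g ` {0..1} \<subseteq> T" and ends: "g 0 = v" "g 1 = w"
    using g by (auto simp: paths_in_def path_def path_image_def pathstart_def pathfinish_def)
  have var: "\<exists>ts. ts \<noteq> [] \<and> sorted ts \<and> hd ts = a \<and> last ts = b \<and> set ts \<subseteq> {a..b} \<and>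
    gdist T (g a) (g b) \<le> chain_length (map g ts)" if "0 \<le> a" "a \<le> b" "b \<le> 1" for a b
    using that cont im by (intro gdist_le_variation) (auto elim: continuous_on_subset)
  obtain ts1 where 1: "ts1 \<noteq> []" "sorted ts1" "hd ts1 = 0" "last ts1 = s" "set ts1 \<subseteq> {0..s}"
    "gdist T (g 0) (g s) \<le> chain_length (map g ts1)" using var[of 0 s] st by auto
  obtain ts2 where 2: "ts2 \<noteq> []" "sorted ts2" "hd ts2 = s" "last ts2 = t" "set ts2 \<subseteq> {s..t}"
    "gdist T (g s) (g t) \<le> chain_length (map g ts2)" using var[of s t] st by auto
  obtain ts3 where 3: "ts3 \<noteq> []" "sorted ts3" "hd ts3 = t" "last ts3 = 1" "set ts3 \<subseteq> {t..1}"
    "gdist T (g t) (g 1) \<le> chain_length (map g ts3)" using var[of t 1] st by auto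
  obtain us2 where us2: "ts2 = s # us2" using 2 by (cases ts2) auto
  obtain us3 where us3: "ts3 = t # us3" using 3 by (cases ts3) auto
  define ts where "ts = ts1 @ us2 @ us3"
  have "chain_length (map g (ts1 @ us2)) = chain_length (map g ts1) + chain_length (map g ts2)"
    using chain_length_append[of "map g ts1" "map g ts2"] 1 us2 by (simp add: last_map)
  moreover have l12: "last (ts1 @ us2) = t" using 1 2 us2 by (auto split: if_splits)
  then have "chain_length (map g ts) = chain_length (map g (ts1 @ us2)) + chain_length (map g ts3)"
    using chain_length_append[of "map g (ts1 @ us2)" "map g ts3"] 1(1) us3
    by (simp add: last_map ts_def del: last_append map_append) simp
  ultimately have "gdist T v (g s) + gdist T (g s) (g t) + gdist T (g t) w \<le> chain_length (map g ts)"
    using 1(6) 2(6) 3(6) unfolding ends by linarith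
  moreover have "sorted (us2 @ us3)"
    using 2(2,5) 3(2,5) by (force simp: us2 us3 sorted_append)
  then have "sorted ts"
    using 1(2,5) 2(5) 3(5) st by (force simp: ts_def us2 us3 sorted_append)
  moreover have "set ts \<subseteq> {0..1}"
    using 1(5) 2(5) 3(5) st by (auto simp: ts_def us2 us3)
  ultimately have "ereal (chain_length (map g ts)) \<le> curve_length g"
    "gdist T v (g s) + gdist T (g s) (g t) + gdist T (g t) w \<le> chain_length (map g ts)"
    by (auto intro: chain_length_le_curve_length)
  then show ?thesis by (meson ereal_less_eq(3) order_trans)
qed

lemma gdist_le_curve_length:
  assumes "g \<in> paths_in T v w"
  shows "ereal (gdist T v w) \<le> curve_length g"
proof -
  have "v \<in> T" "w \<in> T" "g 0 = v" "g 1 = w"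
    using assms by (auto simp: paths_in_def path_image_def pathstart_def pathfinish_def)
  then show ?thesis
    using gdist_three_le_curve_length[OF assms, of 0 1] by (simp add: gdist_refl)
qed

text \<open>Speed \<open>gdist T v w\<close> on the unit interval bounds every inscribed sum by
  \<open>gdist T v w\<close>, and no curve is shorter than that.\<close>

lemma geodesic_shortest_path:
  assumes \<gamma>: "geodesic T v w \<gamma>"
  defines "g \<equiv> \<lambda>t. \<gamma> (gdist T v w * t)"
  shows "g \<in> shortest_paths T v w" "curve_length g = ereal (gdist T v w)"
proof -
  have D0: "0 \<le> gdist T v w" using \<gamma> gdist_nonneg by (auto simp: geodesic_def)
  have scale: "gdist T v w * t \<in> {0..gdist T v w}" if "t \<in> {0..1}" for t
    using that D0 by (auto simp: mult_left_le)
  have "continuous_on {0..1} g"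
    unfolding g_def
    by (rule continuous_on_compose2[OF geodesic_continuous[OF \<gamma>]]) (use scale in \<open>auto intro!: continuous_intros\<close>)
  then have g: "g \<in> paths_in T v w"
    using \<gamma> scale by (auto simp: paths_in_def path_def path_image_def pathstart_def pathfinish_def geodesic_def g_def)
  have "curve_length g \<le> ereal (gdist T v w)"
  proof (rule curve_length_upperI)
    fix ts :: "real list" assume ts: "sorted ts" "set ts \<subseteq> {0..1}"
    show "chain_length (map g ts) \<le> gdist T v w"
    proof (cases "ts = []")
      case False
      have "dist (g s) (g t) \<le> gdist T v w * \<bar>s - t\<bar>" if "s \<in> set ts" "t \<in> set ts" for s t
      proof -
        have "dist (g s) (g t) \<le> \<bar>gdist T v w * s - gdist T v w * t\<bar>"
          using \<gamma> scale[of s] scale[of t] that ts(2) unfolding geodesic_def g_def by blast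
        then show ?thesis using D0 by (simp add: right_diff_distrib[symmetric] abs_mult)
      qed
      then have "chain_length (map g ts) \<le> gdist T v w * (last ts - hd ts)"
        using ts False D0 by (intro chain_length_lipschitz) auto
      also have "\<dots> \<le> gdist T v w * 1"
      proof (intro mult_left_mono D0)
        have "hd ts \<in> {0..1}" "last ts \<in> {0..1}"
          using ts(2) hd_in_set[OF False] last_in_set[OF False] by blast+
        then show "last ts - hd ts \<le> 1" by auto
      qed
      finally show ?thesis by simp
    qed (simp add: D0)
  qed
  then show "g \<in> shortest_paths T v w" "curve_length g = ereal (gdist T v w)"
    using g gdist_le_curve_length by (auto simp: shortest_paths_def intro: order.trans antisym)
qed

lemma curve_length_shortest:
  assumes "g \<in> shortest_paths T v w"
  shows "curve_length g = ereal (gdist T v w)"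
proof -
  have g: "g \<in> paths_in T v w" using assms by (auto simp: shortest_paths_def)
  then have "v \<in> T" "w \<in> T"
    by (auto simp: paths_in_def path_image_def pathstart_def pathfinish_def)
  then obtain \<gamma> where \<gamma>: "geodesic T v w \<gamma>" using geodesic_exists by blast
  have "curve_length g \<le> ereal (gdist T v w)"
    using assms geodesic_shortest_path[OF \<gamma>] by (fastforce simp: shortest_paths_def)
  then show ?thesis using gdist_le_curve_length[OF g] by (rule antisym)
qed

lemma terrain_dist_eq_gdist:
  assumes "v \<in> T" "w \<in> T"
  shows "terrain_dist T v w = gdist T v w"
proof -
  obtain \<gamma> where \<gamma>: "geodesic T v w \<gamma>" using geodesic_exists assms by blast
  show ?thesis
    unfolding terrain_dist_def
  proof (rule the_equality)
    show "\<exists>g\<in>shortest_paths T v w. curve_length g = ereal (gdist T v w)"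
      using geodesic_shortest_path[OF \<gamma>] by blast
  qed (use curve_length_shortest in auto)
qed

text \<open>The clock \<open>\<phi>\<close> shows the distance from \<open>v\<close>. A shortest
  path may pause, so \<open>\<phi>\<close> need not be injective; but \<open>g\<close> moves no more
  than \<open>\<phi>\<close> does, hence \<open>g\<close> factors through \<open>\<phi>\<close>, and
  the other factor is the geodesic.\<close>

lemma shortest_path_geodesic:
  assumes "g \<in> shortest_paths T v w"
  obtains \<gamma> \<phi> where "geodesic T v w \<gamma>" "continuous_on {0..1} \<phi>" "mono_on {0..1} \<phi>"
    "\<phi> 0 = 0" "\<phi> 1 = gdist T v w" "\<And>t. t \<in> {0..1} \<Longrightarrow> g t = \<gamma> (\<phi> t)"
proof -
  define D where "D = gdist T v w"
  have g: "g \<in> paths_in T v w" using assms by (auto simp: shortest_paths_def)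
  have cont: "continuous_on {0..1} g" and im: "g ` {0..1} \<subseteq> T" and ends: "g 0 = v" "g 1 = w"
    using g by (auto simp: paths_in_def path_def path_image_def pathstart_def pathfinish_def)
  have vw: "v \<in> T" "w \<in> T" using im ends by auto
  define \<phi> where "\<phi> = (\<lambda>t. gdist T v (g t))"
  have contphi: "continuous_on {0..1} \<phi>"
    unfolding \<phi>_def by (rule continuous_on_compose2[OF continuous_on_gdist[OF vw(1)] cont im])
  have three: "\<phi> s + gdist T (g s) (g t) + gdist T (g t) w \<le> D" if "0 \<le> s" "s \<le> t" "t \<le> 1" for s t
    using gdist_three_le_curve_length[OF g that] curve_length_shortest[OF assms] by (simp add: \<phi>_def D_def)
  have diff: "gdist T (g s) (g t) \<le> \<phi> t - \<phi> s" if "0 \<le> s" "s \<le> t" "t \<le> 1" for s t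
  proof -
    have "g t \<in> T" using im that by auto
    then show ?thesis
      using three[OF that] gdist_triangle[of v "g t" w] vw by (simp add: \<phi>_def D_def)
  qed
  have ends_phi: "\<phi> 0 = 0" "\<phi> 1 = D" using ends vw by (auto simp: \<phi>_def D_def gdist_refl)
  have mono: "mono_on {0..1} \<phi>"
  proof (rule mono_onI)
    fix s t :: real assume st: "s \<in> {0..1}" "t \<in> {0..1}" "s \<le> t"
    have "0 \<le> gdist T (g s) (g t)" using im st by (intro gdist_nonneg) auto
    then show "\<phi> s \<le> \<phi> t" using diff[of s t] st by simp
  qed
  have lip: "dist (g s) (g t) \<le> \<bar>\<phi> s - \<phi> t\<bar>" if "s \<in> {0..1}" "t \<in> {0..1}" for s t
  proof -
    have "dist (g s) (g t) \<le> gdist T (g s) (g t)" "dist (g t) (g s) \<le> gdist T (g t) (g s)"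
      using im that by (auto intro!: dist_le_gdist)
    then show ?thesis
      using diff[of s t] diff[of t s] that by (cases "s \<le> t") (auto simp: dist_commute)
  qed
  have "\<exists>t\<in>{0..1}. \<phi> t = s" if "s \<in> {0..D}" for s
    using IVT'[of \<phi> 0 s 1] contphi that ends_phi by auto
  \<comment> \<open>\<open>\<tau>\<close> picks any time at which the clock shows \<open>s\<close>;
    by \<open>lip\<close> the choice does not affect \<open>g (\<tau> s)\<close>.\<close>
  then obtain \<tau> where \<tau>: "\<And>s. s \<in> {0..D} \<Longrightarrow> \<tau> s \<in> {0..1} \<and> \<phi> (\<tau> s) = s" by metis
  define \<gamma> where "\<gamma> = g \<circ> \<tau>"
  have D0: "0 \<le> D" using vw gdist_nonneg by (simp add: D_def)
  have phiD: "\<phi> t \<in> {0..D}" if "t \<in> {0..1}" for t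
    using mono_onD[OF mono, of 0 t] mono_onD[OF mono, of t 1] that ends_phi by auto
  have gphi: "g t = \<gamma> (\<phi> t)" if "t \<in> {0..1}" for t
    using lip[of t "\<tau> (\<phi> t)"] \<tau>[OF phiD[OF that]] that by (simp add: \<gamma>_def)
  have "geodesic T v w \<gamma>"
    unfolding geodesic_def D_def[symmetric]
  proof (intro conjI ballI)
    show "\<gamma> 0 = v" "\<gamma> D = w" using gphi[of 0] gphi[of 1] ends ends_phi by auto
    show "\<gamma> s \<in> T" if "s \<in> {0..D}" for s using \<tau>[OF that] im by (auto simp: \<gamma>_def)
    show "dist (\<gamma> s) (\<gamma> t) \<le> \<bar>s - t\<bar>" if "s \<in> {0..D}" "t \<in> {0..D}" for s t
      using \<tau>[OF that(1)] \<tau>[OF that(2)] lip[of "\<tau> s" "\<tau> t"] by (simp add: \<gamma>_def)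
  qed (use vw in auto)
  then show ?thesis
    using that contphi mono ends_phi gphi by (simp add: D_def)
qed

text \<open>A continuous monotone clock maps intervals onto intervals, so pauses leave images
  unchanged.\<close>

lemma shortest_path_image:
  fixes \<phi> :: "real \<Rightarrow> real"
  assumes "continuous_on {0..1} \<phi>" "mono_on {0..1} \<phi>" "0 \<le> s" "s \<le> t" "t \<le> 1"
    and "\<And>t. t \<in> {0..1} \<Longrightarrow> g t = \<gamma> (\<phi> t)"
  shows "g ` {s..t} = \<gamma> ` {\<phi> s..\<phi> t}"
proof -
  have "\<phi> ` {s..t} = {\<phi> s..\<phi> t}"
  proof
    show "\<phi> ` {s..t} \<subseteq> {\<phi> s..\<phi> t}"
      using assms(3-5) by (auto intro!: mono_onD[OF assms(2)])
    show "{\<phi> s..\<phi> t} \<subseteq> \<phi> ` {s..t}"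
    proof
      fix y assume "y \<in> {\<phi> s..\<phi> t}"
      then show "y \<in> \<phi> ` {s..t}"
        using IVT'[of \<phi> s y t] continuous_on_subset[OF assms(1), of "{s..t}"] assms(3-5) by force
    qed
  qed
  moreover have "g ` {s..t} = (\<lambda>t. \<gamma> (\<phi> t)) ` {s..t}"
    using assms(3-6) by (intro image_cong) auto
  ultimately show ?thesis by (metis image_image)
qed

end

section \<open>Termination and correctness of UniquePath\<close>

text \<open>If the inner part fell short of its parameter length, the triangle inequality would make
  the whole fall short as well.\<close>

lemma lipschitz_tight_subinterval:
  fixes \<gamma> :: "real \<Rightarrow> 'a::metric_space"
  assumes lip: "\<And>r r'. r \<in> {a..d} \<Longrightarrow> r' \<in> {a..d} \<Longrightarrow> dist (\<gamma> r) (\<gamma> r') \<le> \<bar>r - r'\<bar>"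
    and "a \<le> b" "b \<le> c" "c \<le> d" and "dist (\<gamma> a) (\<gamma> d) = d - a"
  shows "dist (\<gamma> b) (\<gamma> c) = c - b"
proof -
  have "dist (\<gamma> a) (\<gamma> b) \<le> \<bar>a - b\<bar>" "dist (\<gamma> b) (\<gamma> c) \<le> \<bar>b - c\<bar>" "dist (\<gamma> c) (\<gamma> d) \<le> \<bar>c - d\<bar>"
    by (rule lip; use assms(2-4) in auto)+
  then show ?thesis
    using dist_triangle[of "\<gamma> a" "\<gamma> d" "\<gamma> b"] dist_triangle[of "\<gamma> b" "\<gamma> d" "\<gamma> c"] assms(2-5) by linarith
qed

text \<open>Makes the clockwise first direction unique: a tie in the angle is an equality of
  directions.\<close>

lemma clockwise_angle_eq_imp_eq:
  assumes "e \<noteq> 0" "norm d = 1" "norm d' = 1" "clockwise_angle e d = clockwise_angle e d'"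
  shows "d = d'"
proof -
  have "e / d = of_real (norm (e / d)) * exp (\<i> * of_real (Arg2pi (e / d)))"
    "e / d' = of_real (norm (e / d')) * exp (\<i> * of_real (Arg2pi (e / d')))"
    by (simp_all only: Arg2pi_eq[symmetric])
  then have "e / d = e / d'"
    using assms(2-4) by (simp add: clockwise_angle_def norm_divide)
  then show ?thesis using assms(1-3) by (auto simp: field_simps)
qed

text \<open>\<open>V\<close> holds the nodes, the only points where a geodesic may turn: elsewhere
  two neighbours of \<open>x\<close> see each other and not only \<open>x\<close>.
  \<open>frontier_ray\<close> serves to cut paths into steps, each of which must follow the boundary
  or avoid it.\<close>

locale tame_domain = planar_star_space +
  fixes V :: "complex set"
  assumes finite_V: "finite V"
    and locally_convex: "x \<in> T \<Longrightarrow> x \<notin> V \<Longrightarrow>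
      \<exists>e>0. \<forall>y\<in>T \<inter> ball x e. \<forall>z\<in>T \<inter> ball x e. closed_segment y z \<subseteq> T"
    and frontier_ray: "x \<in> T \<Longrightarrow> \<exists>e>0. \<forall>d. norm d = 1 \<longrightarrow>
      (\<forall>r\<in>{0<..<e}. x + r *\<^sub>R d \<in> frontier T) \<or> (\<forall>r\<in>{0<..<e}. x + r *\<^sub>R d \<notin> frontier T)"
begin

section \<open>Geodesics are straight between nodes\<close>

lemma geodesic_straight_through:
  assumes \<gamma>: "geodesic T v w \<gamma>" and s: "0 < s" "s < gdist T v w" "\<gamma> s \<notin> V"
  obtains e where "e > 0" "e \<le> s" "s + e \<le> gdist T v w" "dist (\<gamma> (s - e)) (\<gamma> (s + e)) = 2 * e"
proof -
  have "\<gamma> s \<in> T" by (rule geodesicD(5)[OF \<gamma>]) (use s in auto)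
  then obtain d where d: "d > 0" "\<And>y z. y \<in> T \<inter> ball (\<gamma> s) d \<Longrightarrow> z \<in> T \<inter> ball (\<gamma> s) d \<Longrightarrow> closed_segment y z \<subseteq> T"
    using locally_convex[OF _ s(3)] by blast
  define e where "e = min (d / 2) (min s (gdist T v w - s))"
  have e: "e > 0" "e \<le> s" "s + e \<le> gdist T v w" "e < d" using d(1) s by (auto simp: e_def)
  have "dist (\<gamma> s) (\<gamma> (s - e)) \<le> \<bar>s - (s - e)\<bar>" "dist (\<gamma> s) (\<gamma> (s + e)) \<le> \<bar>s - (s + e)\<bar>"
    "\<gamma> (s - e) \<in> T" "\<gamma> (s + e) \<in> T"
    by (rule geodesicD(5,6)[OF \<gamma>]; use s e in auto)+
  then have "closed_segment (\<gamma> (s - e)) (\<gamma> (s + e)) \<subseteq> T"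
    using e by (intro d(2)) auto
  then have "dist (\<gamma> (s - e)) (\<gamma> (s + e)) = 2 * e"
    using gdist_segment gdist_geodesic[OF \<gamma>, of "s - e" "s + e"] e s by simp
  then show ?thesis using that e by blast
qed

text \<open>Let \<open>m\<close> be the last time up to which \<open>\<gamma>\<close> is straight
  from \<open>s0\<close>. If \<open>m < s1\<close>, the straight piece around \<open>m\<close>
  overlaps the one before \<open>m\<close> and extends it; for \<open>m = s0\<close> nothing lies
  before, and straightness on leaving is used.\<close>

lemma geodesic_straight_until:
  assumes \<gamma>: "geodesic T v w \<gamma>" and s: "0 \<le> s0" "s0 \<le> s1" "s1 \<le> gdist T v w"
    and V: "\<And>s. s \<in> {s0<..<s1} \<Longrightarrow> \<gamma> s \<notin> V"
  shows "dist (\<gamma> s0) (\<gamma> s1) = s1 - s0"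
proof -
  have lip: "dist (\<gamma> r) (\<gamma> r') \<le> \<bar>r - r'\<bar>" if "0 \<le> r" "r \<le> gdist T v w" "0 \<le> r'" "r' \<le> gdist T v w" for r r'
    using geodesicD(6)[OF \<gamma>] that by simp
  define A where "A = {s \<in> {s0..s1}. dist (\<gamma> s0) (\<gamma> s) - (s - s0) = 0}"
  have "continuous_on {s0..s1} (\<lambda>s. dist (\<gamma> s0) (\<gamma> s) - (s - s0))"
    using continuous_on_subset[OF geodesic_continuous[OF \<gamma>], of "{s0..s1}"] s
    by (auto intro!: continuous_intros)
  then have "closed A" unfolding A_def by (rule continuous_closed_preimage_constant) auto
  moreover have "bounded A" by (rule bounded_subset[of "{s0..s1}"]) (auto simp: A_def)
  ultimately have "compact A" by (simp add: compact_eq_bounded_closed)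
  moreover have "s0 \<in> A" using s by (simp add: A_def)
  ultimately obtain m where m: "m \<in> A" "\<And>s. s \<in> A \<Longrightarrow> s \<le> m"
    using compact_attains_sup[of A] by blast
  have m': "s0 \<le> m" "m \<le> s1" "dist (\<gamma> s0) (\<gamma> m) = m - s0" using m(1) by (auto simp: A_def)
  have "m = s1"
  proof (rule ccontr)
    assume "m \<noteq> s1"
    then have ms: "m < s1" using m' by simp
    show False
    proof (cases "m = s0")
      case True
      obtain e where e: "e > 0" "s0 + e \<le> gdist T v w" "dist (\<gamma> s0) (\<gamma> (s0 + e)) = e"
      proof -
        have "s0 < gdist T v w" using s ms True by simp
        then show ?thesis using geodesic_leaves_straight[OF \<gamma> s(1)] that by blast
      qed
      define e' where "e' = min e (s1 - s0)"
      have e': "0 < e'" "e' \<le> e" "s0 + e' \<le> s1" using e ms True by (auto simp: e'_def)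
      have "dist (\<gamma> s0) (\<gamma> (s0 + e')) = s0 + e' - s0"
        by (rule lipschitz_tight_subinterval[of s0 "s0 + e"]) (use e e' s in \<open>auto intro!: lip\<close>)
      then have "s0 + e' \<in> A" using e' by (simp add: A_def)
      then show False using m(2)[of "s0 + e'"] e'(1) True by simp
    next
      case False
      then have m0: "s0 < m" using m' by simp
      obtain e where e: "e > 0" "e \<le> m" "m + e \<le> gdist T v w" "dist (\<gamma> (m - e)) (\<gamma> (m + e)) = 2 * e"
      proof -
        have "0 < m" "m < gdist T v w" "\<gamma> m \<notin> V" using V[of m] m0 ms s by auto
        then show ?thesis using geodesic_straight_through[OF \<gamma>] that by blast
      qed
      define b d where "b = max (m - e) s0" and "d = min (m + e) s1"
      have bd: "m - e \<le> b" "s0 \<le> b" "b < m" "m < d" "d \<le> m + e" "d \<le> s1"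
        using e m0 ms by (auto simp: b_def d_def)
      have "dist (\<gamma> b) (\<gamma> d) = d - b"
        by (rule lipschitz_tight_subinterval[of "m - e" "m + e"]) (use e bd in \<open>auto intro!: lip\<close>)
      then have "dist (\<gamma> s0) (\<gamma> d) = d - s0"
        using bd m' s by (intro lipschitz_segment_join[of s0 d \<gamma> b m]) (auto intro!: lip)
      then have "d \<in> A" using bd s m0 by (simp add: A_def)
      then show False using m(2)[of d] bd by simp
    qed
  qed
  then show ?thesis using m' by simp
qed

text \<open>A geodesic is injective, so it visits each of the finitely many nodes at most once;
  adding \<open>w\<close> to them guarantees that a next visit exists.\<close>

lemma geodesic_next_node:
  assumes \<gamma>: "geodesic T v w \<gamma>" and s: "0 \<le> s" "s < gdist T v w"
  obtains n where "n \<in> insert w V" "n \<noteq> \<gamma> s" "s + norm (n - \<gamma> s) \<le> gdist T v w"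
    "\<And>r. r \<in> {0..norm (n - \<gamma> s)} \<Longrightarrow> \<gamma> (s + r) = \<gamma> s + r *\<^sub>R sgn (n - \<gamma> s)"
proof -
  define D where "D = gdist T v w"
  define S where "S = {r \<in> {s<..D}. \<gamma> r \<in> insert w V}"
  have "inj_on \<gamma> S"
    by (rule inj_on_subset[OF geodesic_inj_on[OF \<gamma>]]) (use s in \<open>auto simp: S_def D_def\<close>)
  moreover have "finite (\<gamma> ` S)"
    by (rule finite_subset[of _ "insert w V"]) (auto simp: S_def finite_V)
  ultimately have "finite S" by (simp add: finite_image_iff)
  have "D \<in> S" using s geodesicD(4)[OF \<gamma>] by (simp add: S_def D_def)
  define t where "t = Min S"
  have t: "t \<in> S" "\<And>r. r \<in> S \<Longrightarrow> t \<le> r"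
    using \<open>finite S\<close> \<open>D \<in> S\<close> by (auto simp: t_def intro!: Min_in)
  have t': "s < t" "t \<le> D" "\<gamma> t \<in> insert w V" using t(1) by (auto simp: S_def)
  have tight: "dist (\<gamma> s) (\<gamma> t) = t - s"
  proof (rule geodesic_straight_until[OF \<gamma>])
    fix r assume r: "r \<in> {s<..<t}"
    show "\<gamma> r \<notin> V"
    proof
      assume "\<gamma> r \<in> V"
      then have "r \<in> S" using r t' by (simp add: S_def)
      then show False using t(2) r by fastforce
    qed
  qed (use s t' in \<open>auto simp: D_def\<close>)
  then have nrm: "norm (\<gamma> t - \<gamma> s) = t - s" by (simp add: dist_norm norm_minus_commute)
  show ?thesis
  proof (rule that[of "\<gamma> t"])
    show "\<gamma> t \<in> insert w V" by (rule t')
    show "\<gamma> t \<noteq> \<gamma> s" using nrm t' by auto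
    show "s + norm (\<gamma> t - \<gamma> s) \<le> gdist T v w" using nrm t' by (simp add: D_def)
    fix r assume "r \<in> {0..norm (\<gamma> t - \<gamma> s)}"
    then have "s + r \<in> {s..t}" using nrm by simp
    moreover have "dist (\<gamma> a) (\<gamma> b) \<le> \<bar>a - b\<bar>" if "a \<in> {s..t}" "b \<in> {s..t}" for a b
      by (rule geodesicD(6)[OF \<gamma>]) (use that s t' in \<open>auto simp: D_def\<close>)
    ultimately show "\<gamma> (s + r) = \<gamma> s + r *\<^sub>R sgn (\<gamma> t - \<gamma> s)"
      using lipschitz_segment[of s t \<gamma> "s + r"] tight by simp
  qed
qed

text \<open>Turns a condition on images of parameter intervals of \<open>g\<close> into one on the
  unit-speed curve. One point determines the direction: it lies on the given segment and also on the
  straight piece of \<open>\<gamma>\<close> after \<open>s\<close>.\<close>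

lemma leaves_along_iff:
  assumes \<gamma>: "geodesic T v w \<gamma>"
    and \<phi>: "continuous_on {0..1} \<phi>" "mono_on {0..1} \<phi>" "\<phi> 0 = 0" "\<phi> 1 = gdist T v w"
    and g: "\<And>t. t \<in> {0..1} \<Longrightarrow> g t = \<gamma> (\<phi> t)"
  shows "leaves_along g u d \<longleftrightarrow> norm d = 1 \<and> (\<exists>s e. 0 \<le> s \<and> 0 < e \<and> s + e \<le> gdist T v w \<and>
    \<gamma> s = u \<and> (\<forall>r\<in>{0..e}. \<gamma> (s + r) = u + r *\<^sub>R d))" (is "?L \<longleftrightarrow> ?R")
proof
  have range: "\<phi> t \<in> {0..gdist T v w}" if "t \<in> {0..1}" for t
    using mono_onD[OF \<phi>(2), of 0 t] mono_onD[OF \<phi>(2), of t 1] that \<phi>(3,4) by auto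
  assume ?L
  then obtain t t' r where *: "norm d = 1" "0 \<le> t" "t < t'" "t' \<le> 1" "0 < r" "g t = u"
      "g ` {t..t'} = closed_segment u (u + of_real r * d)"
    unfolding leaves_along_def by blast
  define s where "s = \<phi> t"
  have im: "\<gamma> ` {s..\<phi> t'} = closed_segment u (u + of_real r * d)"
    using shortest_path_image[OF \<phi>(1,2), of t t' g \<gamma>] * g by (simp add: s_def)
  have s: "0 \<le> s" "s \<le> \<phi> t'" "\<phi> t' \<le> gdist T v w" "\<gamma> s = u"
    using range[of t] range[of t'] mono_onD[OF \<phi>(2), of t t'] * g[of t] by (auto simp: s_def)
  \<comment> \<open>A clock standing still on \<open>{t..t'}\<close> would shrink the image to a
    point, but the segment has length \<open>r > 0\<close>.\<close>
  have "s \<noteq> \<phi> t'"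
  proof
    assume "s = \<phi> t'"
    then have "closed_segment u (u + of_real r * d) = {u}" using im s by simp
    then have "u + of_real r * d = u" by (metis ends_in_segment(2) singletonD)
    then show False using *(1,5) by auto
  qed
  then have "s < gdist T v w" using s by simp
  then obtain n where n: "n \<noteq> \<gamma> s" "s + norm (n - \<gamma> s) \<le> gdist T v w"
    "\<And>r. r \<in> {0..norm (n - \<gamma> s)} \<Longrightarrow> \<gamma> (s + r) = \<gamma> s + r *\<^sub>R sgn (n - \<gamma> s)"
    using geodesic_next_node[OF \<gamma>, of s] s by metis
  define e where "e = min (norm (n - \<gamma> s)) (\<phi> t' - s)"
  have e: "e > 0" "s + e \<le> gdist T v w" "e \<le> norm (n - \<gamma> s)" "s + e \<le> \<phi> t'"
    using n s \<open>s \<noteq> \<phi> t'\<close> by (auto simp: e_def)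
  define d' where "d' = sgn (n - \<gamma> s)"
  have d': "norm d' = 1" using n(1) by (simp add: d'_def norm_sgn)
  have "u + e *\<^sub>R d' \<in> closed_segment u (u + of_real r * d)"
  proof -
    have "\<gamma> (s + e) \<in> \<gamma> ` {s..\<phi> t'}" using e by (intro imageI) auto
    then show ?thesis using im e n(3)[of e] s by (simp add: d'_def)
  qed
  then obtain c where c: "0 \<le> c" "u + e *\<^sub>R d' = u + (c * r) *\<^sub>R d"
    by (auto simp: in_segment algebra_simps scaleR_conv_of_real)
  then have "norm (e *\<^sub>R d') = norm ((c * r) *\<^sub>R d)" by simp
  then have "e = c * r" using c e(1) d' *(1,5) by simp
  then have "d' = d" using c(2) e(1) by auto
  then show ?R
    using *(1) s e n(3) by (intro conjI exI[of _ s] exI[of _ e]) (auto simp: d'_def)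
next
  assume ?R
  then obtain s e where *: "norm d = 1" "0 \<le> s" "0 < e" "s + e \<le> gdist T v w" "\<gamma> s = u"
    "\<And>r. r \<in> {0..e} \<Longrightarrow> \<gamma> (s + r) = u + r *\<^sub>R d" by blast
  have "\<exists>t\<ge>0. t \<le> 1 \<and> \<phi> t = r" if "0 \<le> r" "r \<le> gdist T v w" for r
    using IVT'[of \<phi> 0 r 1] \<phi> that by auto
  from this[of s] this[of "s + e"] obtain t t' where t: "t \<in> {0..1}" "t' \<in> {0..1}" "\<phi> t = s" "\<phi> t' = s + e"
    using *(2-4) by auto
  have "t < t'"
  proof (rule ccontr)
    assume "\<not> t < t'"
    then show False using mono_onD[OF \<phi>(2), of t' t] t *(3) by simp
  qed
  have "g ` {t..t'} = \<gamma> ` {s..s + e}"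
    using shortest_path_image[OF \<phi>(1,2), of t t' g \<gamma>] t \<open>t < t'\<close> g by simp
  also have "\<dots> = (\<lambda>r. \<gamma> (s + r)) ` {0..e}"
  proof -
    have "{s..s + e} = (\<lambda>r. s + r) ` {0..e}" by simp
    then show ?thesis by (metis image_image)
  qed
  also have "\<dots> = (\<lambda>r. u + r *\<^sub>R d) ` {0..e}" using *(6) by (intro image_cong) auto
  also have "\<dots> = closed_segment u (u + of_real e * d)"
  proof -
    have "{0..e} = (\<lambda>c. c * e) ` {0..1}" using *(3) image_mult_atLeastAtMost_if'[of e 0 1] by simp
    moreover have "(\<lambda>r. u + r *\<^sub>R d) ` (\<lambda>c. c * e) ` {0..1} = closed_segment u (u + of_real e * d)"
      unfolding closed_segment_image_interval image_image
      by (rule image_cong) (auto simp: algebra_simps scaleR_conv_of_real)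
    ultimately show ?thesis by simp
  qed
  finally show ?L
    unfolding leaves_along_def using * t \<open>t < t'\<close> g[of t]
    by (intro conjI exI[of _ t] exI[of _ t'] exI[of _ e]) auto
qed

section \<open>One round of the loop\<close>

lemma geodesic_path_image:
  assumes "geodesic T v w \<gamma>"
  shows "path_image (\<lambda>t. \<gamma> (gdist T v w * t)) = \<gamma> ` {0..gdist T v w}"
proof -
  have "0 \<le> gdist T v w" using assms gdist_nonneg geodesicD(1,2) by blast
  then have "(\<lambda>t. gdist T v w * t) ` {0..1} = {0..gdist T v w}"
    using image_mult_atLeastAtMost_if[of "gdist T v w" 0 1] by auto
  then show ?thesis by (metis image_image path_image_def)
qed

text \<open>Each geodesic leaves \<open>\<gamma> s\<close> straight towards a node or
  \<open>w\<close>, so only finitely many directions occur and a first one exists. Only path images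
  are compared, since \<open>clockwise_first\<close> contains every reparametrization.\<close>

lemma clockwise_first_geodesics:
  assumes \<gamma>: "geodesic T v w \<gamma>" and s: "0 \<le> s" "s < gdist T v w"
  obtains d e where "e > 0" "s + e \<le> gdist T v w"
    "\<exists>\<delta>. geodesic T v w \<delta> \<and> (\<forall>r\<in>{0..e}. \<delta> (s + r) = \<gamma> s + r *\<^sub>R d)"
    "path_image ` clockwise_first T v w (\<gamma> s) =
      (\<lambda>\<delta>. \<delta> ` {0..gdist T v w}) ` {\<delta>. geodesic T v w \<delta> \<and> (\<forall>r\<in>{0..e}. \<delta> (s + r) = \<gamma> s + r *\<^sub>R d)}"
proof -
  define D where "D = gdist T v w"
  define u where "u = \<gamma> s"
  define leaves where "leaves = (\<lambda>\<delta> d. norm d = 1 \<and>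
    (\<exists>e>0. s + e \<le> D \<and> (\<forall>r\<in>{0..e}. \<delta> (s + r) = u + r *\<^sub>R d)))"
  define G where "G = {\<delta>. geodesic T v w \<delta> \<and> \<delta> s = u}"
  define dirs where "dirs = {d. \<exists>\<delta>\<in>G. leaves \<delta> d}"
  have next_node: "\<exists>n\<in>insert w V - {u}. sgn (n - u) = d \<and> s + norm (n - u) \<le> D \<and>
      (\<forall>r\<in>{0..norm (n - u)}. \<delta> (s + r) = u + r *\<^sub>R d)" if \<delta>: "\<delta> \<in> G" and d: "leaves \<delta> d" for \<delta> d
  proof -
    have \<delta>': "geodesic T v w \<delta>" "\<delta> s = u" using \<delta> by (auto simp: G_def)
    obtain n where n: "n \<in> insert w V" "n \<noteq> u" "s + norm (n - u) \<le> D"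
      "\<And>r. r \<in> {0..norm (n - u)} \<Longrightarrow> \<delta> (s + r) = u + r *\<^sub>R sgn (n - u)"
      using geodesic_next_node[OF \<delta>'(1) s] \<delta>'(2) unfolding D_def by metis
    obtain e where e: "e > 0" "\<And>r. r \<in> {0..e} \<Longrightarrow> \<delta> (s + r) = u + r *\<^sub>R d"
      using d unfolding leaves_def by blast
    define r where "r = min e (norm (n - u))"
    have r: "0 < r" "r \<in> {0..e}" "r \<in> {0..norm (n - u)}" using e(1) n(2) by (auto simp: r_def)
    then have "r *\<^sub>R d = r *\<^sub>R sgn (n - u)" using e(2)[of r] n(4)[of r] by simp
    then have "sgn (n - u) = d" using r(1) by simp
    then show ?thesis using n by blast
  qed
  have "dirs \<subseteq> (\<lambda>n. sgn (n - u)) ` insert w V"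
    using next_node unfolding dirs_def by blast
  then have "finite dirs" using finite_V finite_subset by blast
  have "\<gamma> \<in> G" using \<gamma> by (simp add: G_def u_def)
  have ex_leaves: "\<exists>d. leaves \<delta> d" if \<delta>: "\<delta> \<in> G" for \<delta>
  proof -
    have \<delta>': "geodesic T v w \<delta>" "\<delta> s = u" using \<delta> by (auto simp: G_def)
    obtain n where n: "n \<noteq> u" "s + norm (n - u) \<le> D"
      "\<And>r. r \<in> {0..norm (n - u)} \<Longrightarrow> \<delta> (s + r) = u + r *\<^sub>R sgn (n - u)"
      using geodesic_next_node[OF \<delta>'(1) s] \<delta>'(2) unfolding D_def by metis
    then have "leaves \<delta> (sgn (n - u))"
      unfolding leaves_def by (intro conjI exI[of _ "norm (n - u)"]) (auto simp: norm_sgn)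
    then show ?thesis by blast
  qed
  then have "dirs \<noteq> {}" using \<open>\<gamma> \<in> G\<close> unfolding dirs_def by blast
  define d where "d = arg_min_on (clockwise_angle (w - v)) dirs"
  have d: "d \<in> dirs" "\<And>d'. d' \<in> dirs \<Longrightarrow> clockwise_angle (w - v) d \<le> clockwise_angle (w - v) d'"
    using arg_min_if_finite(1)[OF \<open>finite dirs\<close> \<open>dirs \<noteq> {}\<close>] arg_min_least[OF \<open>finite dirs\<close> \<open>dirs \<noteq> {}\<close>]
    by (auto simp: d_def)
  have vw: "w - v \<noteq> 0"
    using s \<gamma> gdist_refl geodesicD(1)[OF \<gamma>] by auto
  \<comment> \<open>Every selected geodesic runs straight for at least the distance to the nearest
    other node, so the minimum \<open>e\<close> serves all of them at once.\<close>
  define R where "R = (\<lambda>n. norm (n - u)) ` (insert w V - {u})"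
  define e where "e = Min R"
  have R: "finite R" "R \<noteq> {}"
  proof -
    show "finite R" using finite_V by (simp add: R_def)
    show "R \<noteq> {}" using next_node d(1) unfolding dirs_def R_def by blast
  qed
  have "e > 0" using R Min_in[OF R] by (auto simp: e_def R_def)
  have eR: "e \<le> norm (n - u)" if "n \<in> insert w V - {u}" for n
    unfolding e_def using that by (intro Min_le R) (auto simp: R_def)
  define H where "H = {\<delta>. geodesic T v w \<delta> \<and> (\<forall>r\<in>{0..e}. \<delta> (s + r) = u + r *\<^sub>R d)}"
  have "norm d = 1" using d(1) by (auto simp: dirs_def leaves_def)
  have H_iff: "\<delta> \<in> H \<longleftrightarrow> \<delta> \<in> G \<and> leaves \<delta> d" and sD: "\<delta> \<in> G \<and> leaves \<delta> d \<Longrightarrow> s + e \<le> D" for \<delta>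
  proof -
    have 1: "s + e \<le> D \<and> \<delta> \<in> H" if \<delta>: "\<delta> \<in> G \<and> leaves \<delta> d" for \<delta>
    proof -
      obtain n where n: "n \<in> insert w V - {u}" "s + norm (n - u) \<le> D"
        "\<forall>r\<in>{0..norm (n - u)}. \<delta> (s + r) = u + r *\<^sub>R d" using next_node[of \<delta> d] \<delta> by blast
      then show ?thesis using eR[OF n(1)] \<delta> by (auto simp: H_def G_def)
    qed
    then show "\<delta> \<in> G \<and> leaves \<delta> d \<Longrightarrow> s + e \<le> D" by blast
    obtain \<delta>0 where "\<delta>0 \<in> G \<and> leaves \<delta>0 d" using d(1) by (auto simp: dirs_def)
    then have "s + e \<le> D" using 1 by blast
    have "\<delta> \<in> G \<and> leaves \<delta> d" if "\<delta> \<in> H"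
    proof -
      have *: "geodesic T v w \<delta>" "\<forall>r\<in>{0..e}. \<delta> (s + r) = u + r *\<^sub>R d" using that by (simp_all add: H_def)
      moreover have "\<delta> s = u" using *(2)[rule_format, of 0] \<open>e > 0\<close> by simp
      ultimately show ?thesis
        unfolding G_def leaves_def using \<open>e > 0\<close> \<open>norm d = 1\<close> \<open>s + e \<le> D\<close> by blast
    qed
    then show "\<delta> \<in> H \<longleftrightarrow> \<delta> \<in> G \<and> leaves \<delta> d" using 1 by blast
  qed
  have H_ne: "H \<noteq> {}" using d(1) H_iff unfolding dirs_def by blast
  have leaves_iff: "leaves_along g u d' \<longleftrightarrow> \<delta> \<in> G \<and> leaves \<delta> d'"
    if "geodesic T v w \<delta>" "continuous_on {0..1} \<phi>" "mono_on {0..1} \<phi>" "\<phi> 0 = 0" "\<phi> 1 = gdist T v w"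
      "\<And>t. t \<in> {0..1} \<Longrightarrow> g t = \<delta> (\<phi> t)" for g \<delta> \<phi> d'
  proof -
    have *: "leaves_along g u d' \<longleftrightarrow> norm d' = 1 \<and> (\<exists>s' e. 0 \<le> s' \<and> 0 < e \<and> s' + e \<le> D \<and>
      \<delta> s' = u \<and> (\<forall>r\<in>{0..e}. \<delta> (s' + r) = u + r *\<^sub>R d'))"
      unfolding D_def by (rule leaves_along_iff[OF that])
    \<comment> \<open>\<open>leaves_along\<close> mentions no time of departure; the distance of
      \<open>u\<close> from \<open>v\<close> fixes it.\<close>
    have "s' = s" if "0 \<le> s'" "0 < e" "s' + e \<le> D" "\<delta> s' = u" for s' e
    proof -
      have "gdist T v u = s'" using gdist_geodesic_start[OF \<open>geodesic T v w \<delta>\<close>, of s'] that by (simp add: D_def)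
      moreover have "gdist T v u = s" using gdist_geodesic_start[OF \<gamma>, of s] s by (simp add: u_def)
      ultimately show ?thesis by simp
    qed
    then show ?thesis
      unfolding * G_def leaves_def using s(1) that(1)
      by (safe; (metis | auto))
  qed
  have image: "path_image ` clockwise_first T v w u = (\<lambda>\<delta>. \<delta> ` {0..D}) ` H"
  proof (intro equalityI subsetI)
    fix p assume "p \<in> path_image ` clockwise_first T v w u"
    then obtain g where g: "p = path_image g" "g \<in> clockwise_first T v w u" by blast
    then obtain d' where g': "g \<in> shortest_paths T v w" "leaves_along g u d'"
      "\<And>h d''. h \<in> shortest_paths T v w \<Longrightarrow> leaves_along h u d'' \<Longrightarrow>
        clockwise_angle (w - v) d' \<le> clockwise_angle (w - v) d''"
      unfolding clockwise_first_def by blast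
    obtain \<delta> \<phi> where \<delta>: "geodesic T v w \<delta>" "continuous_on {0..1} \<phi>" "mono_on {0..1} \<phi>" "\<phi> 0 = 0"
      "\<phi> 1 = gdist T v w" "\<And>t. t \<in> {0..1} \<Longrightarrow> g t = \<delta> (\<phi> t)"
      using shortest_path_geodesic[OF g'(1)] by metis
    have \<delta>d: "\<delta> \<in> G" "leaves \<delta> d'" using leaves_iff[OF \<delta>] g'(2) by auto
    then have "d' \<in> dirs" by (auto simp: dirs_def)
    obtain \<delta>0 where \<delta>0: "\<delta>0 \<in> G" "leaves \<delta>0 d" using d(1) by (auto simp: dirs_def)
    then have g0: "geodesic T v w \<delta>0" by (simp add: G_def)
    have "gdist T v w > 0" using s by simp
    \<comment> \<open>A geodesic leaving in the minimal direction \<open>d\<close> is itself a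
      shortest path, so \<open>g\<close> has to compete with it.\<close>
    then have "leaves_along (\<lambda>t. \<delta>0 (gdist T v w * t)) u d"
      using \<delta>0 by (subst leaves_iff[OF g0, of "\<lambda>t. gdist T v w * t"]) (auto intro!: continuous_intros mono_onI)
    then have "clockwise_angle (w - v) d' \<le> clockwise_angle (w - v) d"
      using g'(3) geodesic_shortest_path(1)[OF g0] by blast
    then have "clockwise_angle (w - v) d' = clockwise_angle (w - v) d"
      using d(2)[OF \<open>d' \<in> dirs\<close>] by simp
    then have "d' = d"
      using clockwise_angle_eq_imp_eq[OF vw, of d' d] \<open>norm d = 1\<close> \<delta>d(2) by (simp add: leaves_def)
    then have "\<delta> \<in> H" using \<delta>d H_iff by blast
    moreover have "p = \<delta> ` {0..D}"
      using shortest_path_image[OF \<delta>(2,3), of 0 1 g \<delta>] \<delta>(4-6) g(1) by (simp add: path_image_def D_def)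
    ultimately show "p \<in> (\<lambda>\<delta>. \<delta> ` {0..D}) ` H" by blast
  next
    fix p assume "p \<in> (\<lambda>\<delta>. \<delta> ` {0..D}) ` H"
    then obtain \<delta> where \<delta>: "p = \<delta> ` {0..D}" "\<delta> \<in> H" by blast
    then have \<delta>': "geodesic T v w \<delta>" "\<delta> \<in> G" "leaves \<delta> d" using H_iff by (auto simp: H_def)
    define g where "g = (\<lambda>t. \<delta> (gdist T v w * t))"
    have "gdist T v w > 0" using s by simp
    then have "leaves_along g u d"
      using \<delta>' unfolding g_def
      by (subst leaves_iff[OF \<delta>'(1), of "\<lambda>t. gdist T v w * t"]) (auto intro!: continuous_intros mono_onI)
    moreover have "clockwise_angle (w - v) d \<le> clockwise_angle (w - v) d'"
      if h: "h \<in> shortest_paths T v w" "leaves_along h u d'" for h d'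
    proof -
      obtain \<epsilon> \<phi> where \<epsilon>: "geodesic T v w \<epsilon>" "continuous_on {0..1} \<phi>" "mono_on {0..1} \<phi>" "\<phi> 0 = 0"
        "\<phi> 1 = gdist T v w" "\<And>t. t \<in> {0..1} \<Longrightarrow> h t = \<epsilon> (\<phi> t)"
        using shortest_path_geodesic[OF h(1)] by metis
      have "d' \<in> dirs" using leaves_iff[OF \<epsilon>] h(2) by (auto simp: dirs_def)
      then show ?thesis by (rule d(2))
    qed
    ultimately have "g \<in> clockwise_first T v w u"
      using geodesic_shortest_path(1)[OF \<delta>'(1)] unfolding clockwise_first_def g_def by blast
    moreover have "p = path_image g"
      using geodesic_path_image[OF \<delta>'(1)] \<delta>(1) by (simp add: g_def D_def)
    ultimately show "p \<in> path_image ` clockwise_first T v w u" by blast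
  qed
  show ?thesis
  proof (rule that[of e d])
    show "e > 0" by fact
    show "s + e \<le> gdist T v w" using sD H_ne H_iff unfolding D_def by blast
    show "\<exists>\<delta>. geodesic T v w \<delta> \<and> (\<forall>r\<in>{0..e}. \<delta> (s + r) = \<gamma> s + r *\<^sub>R d)"
      using H_ne unfolding H_def u_def by blast
    show "path_image ` clockwise_first T v w (\<gamma> s) = (\<lambda>\<delta>. \<delta> ` {0..gdist T v w}) `
        {\<delta>. geodesic T v w \<delta> \<and> (\<forall>r\<in>{0..e}. \<delta> (s + r) = \<gamma> s + r *\<^sub>R d)}"
      using image unfolding H_def u_def D_def .
  qed
qed

text \<open>For uniqueness, any arc with this image and start is read by the clock
  \<open>gdist T v\<close>. The clock starts at \<open>0\<close> and shows \<open>b\<close> at some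
  time \<open>t\<close>; by then it has shown every value in \<open>{0..b}\<close>, including that
  of the arc's end, so injectivity forces \<open>t = 1\<close>.\<close>

lemma path_end_geodesic:
  assumes \<gamma>: "geodesic T v w \<gamma>" and b: "0 < b" "b \<le> gdist T v w"
  shows "path_end v (\<gamma> ` {0..b}) = \<gamma> b"
  unfolding path_end_def
proof (rule the_equality)
  define g where "g = (\<lambda>t. \<gamma> (b * t))"
  have im: "(\<lambda>t. b * t) ` {0..1} = {0..b}"
    using b image_mult_atLeastAtMost_if[of b 0 1] by auto
  have "continuous_on {0..1} g"
    unfolding g_def
  proof (rule continuous_on_compose2[OF geodesic_continuous[OF \<gamma>]])
    show "(\<lambda>t. b * t) ` {0..1} \<subseteq> {0..gdist T v w}" unfolding im using b by auto
  qed (intro continuous_intros)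
  moreover have "inj_on g {0..1}"
  proof (rule inj_onI)
    fix s t :: real assume *: "s \<in> {0..1}" "t \<in> {0..1}" "g s = g t"
    have "b * s \<in> {0..b}" "b * t \<in> {0..b}" using * im by blast+
    moreover have "{0..b} \<subseteq> {0..gdist T v w}" using b by auto
    ultimately have in_D: "b * s \<in> {0..gdist T v w}" "b * t \<in> {0..gdist T v w}" by blast+
    have "b * s = b * t"
      by (rule inj_onD[OF geodesic_inj_on[OF \<gamma>] _ in_D]) (use *(3) in \<open>simp add: g_def\<close>)
    then show "s = t" using b by simp
  qed
  moreover have "path_image g = \<gamma> ` {0..b}"
    unfolding path_image_def g_def using im by (metis image_image)
  ultimately show "\<exists>g. arc g \<and> path_image g = \<gamma> ` {0..b} \<and> pathstart g = v \<and> pathfinish g = \<gamma> b"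
    using geodesicD(3)[OF \<gamma>]
    by (intro exI[of _ g]) (auto simp: arc_def path_def pathstart_def pathfinish_def g_def)
next
  fix x assume "\<exists>g. arc g \<and> path_image g = \<gamma> ` {0..b} \<and> pathstart g = v \<and> pathfinish g = x"
  then obtain g where g: "arc g" "path_image g = \<gamma> ` {0..b}" "g 0 = v" "g 1 = x"
    by (auto simp: pathstart_def pathfinish_def)
  have sub: "{0..b} \<subseteq> {0..gdist T v w}" using b by auto
  have gin: "g t \<in> \<gamma> ` {0..b}" if "t \<in> {0..1}" for t using that g(2) by (auto simp: path_image_def)
  define k where "k = (\<lambda>t. gdist T v (g t))"
  have \<gamma>k: "\<gamma> (k t) = g t" "k t \<in> {0..b}" if "t \<in> {0..1}" for t
  proof -
    obtain s where "s \<in> {0..b}" "g t = \<gamma> s" using gin \<open>t \<in> {0..1}\<close> by blast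
    then show "\<gamma> (k t) = g t" "k t \<in> {0..b}"
      using gdist_geodesic_start[OF \<gamma>, of s] sub by (auto simp: k_def)
  qed
  have "\<gamma> ` {0..b} \<subseteq> T"
    using sub by (intro image_subsetI geodesicD(5)[OF \<gamma>]) blast
  then have "g ` {0..1} \<subseteq> T" using gin by blast
  then have cont: "continuous_on {0..1} k"
    unfolding k_def using g(1)
    by (intro continuous_on_compose2[OF continuous_on_gdist[OF geodesicD(1)[OF \<gamma>]], of _ g])
      (simp_all add: arc_def path_def)
  have "\<gamma> b \<in> g ` {0..1}" using g(2) b by (auto simp: path_image_def)
  then obtain t where t: "t \<in> {0..1}" "g t = \<gamma> b" by auto
  have kt: "k t = b" using gdist_geodesic_start[OF \<gamma>, of b] b t(2) by (simp add: k_def)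
  have k0: "k 0 = 0" using g(3) gdist_refl geodesicD(1)[OF \<gamma>] by (simp add: k_def)
  have "\<exists>r\<ge>0. r \<le> t \<and> k r = k 1"
    using IVT'[of k 0 "k 1" t] k0 kt \<gamma>k(2)[of 1] t continuous_on_subset[OF cont, of "{0..t}"] by auto
  then obtain r where r: "0 \<le> r" "r \<le> t" "k r = k 1" by blast
  then have "g r = g 1" using \<gamma>k(1)[of r] \<gamma>k(1)[of 1] t by auto
  then have "r = 1" using g(1) r t by (auto simp: arc_def inj_on_def)
  then show "x = \<gamma> b" using r t g(4) by auto
qed

text \<open>The new geodesic \<open>\<delta>\<close> follows \<open>\<gamma>\<close> up to
  \<open>u\<close> and a selected geodesic afterwards, so it contains the path built so far and is
  itself selected. Through \<open>gdist T v\<close> the component that is added corresponds to a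
  parameter interval of \<open>\<delta>\<close>.\<close>

lemma extend_path_geodesic:
  assumes \<gamma>: "geodesic T v w \<gamma>" and s: "0 \<le> s" "s < gdist T v w"
  obtains \<delta> b where "geodesic T v w \<delta>" "s < b" "b \<le> gdist T v w" "\<delta> b \<in> insert w V"
    "extend_path T v w (\<gamma> ` {0..s}, \<gamma> s) = (\<delta> ` {0..b}, \<delta> b)"
proof -
  define D where "D = gdist T v w"
  define u where "u = \<gamma> s"
  obtain d e where e: "e > 0" "s + e \<le> D"
    and ex: "\<exists>\<delta>. geodesic T v w \<delta> \<and> (\<forall>r\<in>{0..e}. \<delta> (s + r) = u + r *\<^sub>R d)"
    and im: "path_image ` clockwise_first T v w u =
      (\<lambda>\<delta>. \<delta> ` {0..D}) ` {\<delta>. geodesic T v w \<delta> \<and> (\<forall>r\<in>{0..e}. \<delta> (s + r) = u + r *\<^sub>R d)}"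
    by (rule clockwise_first_geodesics[OF \<gamma> s, folded D_def u_def])
  define H where "H = {\<delta>. geodesic T v w \<delta> \<and> (\<forall>r\<in>{0..e}. \<delta> (s + r) = u + r *\<^sub>R d)}"
  have Hs: "\<delta> s = u" and Hg: "geodesic T v w \<delta>" if "\<delta> \<in> H" for \<delta>
  proof -
    have "\<forall>r\<in>{0..e}. \<delta> (s + r) = u + r *\<^sub>R d" using that by (simp add: H_def)
    from this[rule_format, of 0] show "\<delta> s = u" using e(1) by simp
  qed (use that in \<open>simp add: H_def\<close>)
  obtain \<delta>0 where \<delta>0: "\<delta>0 \<in> H" using ex by (auto simp: H_def)
  define \<delta> where "\<delta> = (\<lambda>r. if r \<le> s then \<gamma> r else \<delta>0 r)"
  have \<delta>: "geodesic T v w \<delta>"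
    unfolding \<delta>_def using s Hs[OF \<delta>0] Hg[OF \<delta>0] by (intro geodesic_splice[OF \<gamma>]) (auto simp: u_def)
  have "\<delta> (s + r) = u + r *\<^sub>R d" if "r \<in> {0..e}" for r
    using that \<delta>0 by (cases "r = 0") (auto simp: \<delta>_def u_def H_def)
  then have \<delta>H: "\<delta> \<in> H" using \<delta> by (simp add: H_def)
  define p' where "p' = (\<Inter>g\<in>clockwise_first T v w u. path_image g)"
  have p': "p' = (\<Inter>\<epsilon>\<in>H. \<epsilon> ` {0..D})"
    using im unfolding p'_def H_def by simp
  \<comment> \<open>Geodesics share points only at equal times, so the common points are the values
    of \<open>\<delta>\<close> at the times where all members of \<open>H\<close> agree.\<close>
  define P where "P = {r \<in> {0..D}. \<forall>\<epsilon>\<in>H. \<epsilon> r = \<delta> r}"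
  have p'_P: "p' = \<delta> ` P"
  proof (intro equalityI subsetI)
    fix x assume x: "x \<in> p'"
    define r where "r = gdist T v x"
    have r: "r \<in> {0..D} \<and> \<epsilon> r = x" if \<epsilon>: "\<epsilon> \<in> H" for \<epsilon>
    proof -
      obtain r' where r': "r' \<in> {0..D}" "x = \<epsilon> r'" using x \<epsilon> p' by blast
      then have "r' = r" using gdist_geodesic_start[OF Hg[OF \<epsilon>], of r'] by (simp add: D_def r_def)
      then show ?thesis using r' by simp
    qed
    then have "r \<in> P" "\<delta> r = x" using \<delta>H by (auto simp: P_def)
    then show "x \<in> \<delta> ` P" by blast
  next
    fix x assume "x \<in> \<delta> ` P"
    then obtain r where "r \<in> {0..D}" "x = \<delta> r" "\<forall>\<epsilon>\<in>H. \<epsilon> r = x" by (auto simp: P_def)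
    then show "x \<in> p'" unfolding p' by (metis INT_I image_eqI)
  qed
  have cont: "continuous_on {0..D} \<epsilon>" if "\<epsilon> \<in> H" for \<epsilon>
    using geodesic_continuous[OF Hg[OF that]] by (simp add: D_def)
  have "P = (\<Inter>\<epsilon>\<in>H. {r \<in> {0..D}. dist (\<epsilon> r) (\<delta> r) = 0})" using \<delta>H by (auto simp: P_def)
  moreover have "closed {r \<in> {0..D}. dist (\<epsilon> r) (\<delta> r) = 0}" if "\<epsilon> \<in> H" for \<epsilon>
    by (rule continuous_closed_preimage_constant) (auto intro!: continuous_intros cont that \<delta>H)
  ultimately have "closed P" by auto
  define C where "C = connected_component_set P s"
  have "closed C" unfolding C_def by (rule closed_connected_component[OF \<open>closed P\<close>])
  have CP: "C \<subseteq> P" unfolding C_def by (rule connected_component_subset)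
  then have "C \<subseteq> {0..D}" by (auto simp: P_def)
  have sP: "{s..s + e} \<subseteq> P"
  proof
    fix r assume r: "r \<in> {s..s + e}"
    have "\<epsilon> r = u + (r - s) *\<^sub>R d" if "\<epsilon> \<in> H" for \<epsilon>
    proof -
      have "\<forall>r\<in>{0..e}. \<epsilon> (s + r) = u + r *\<^sub>R d" using that by (simp add: H_def)
      from this[rule_format, of "r - s"] show ?thesis using r by simp
    qed
    then have "\<forall>\<epsilon>\<in>H. \<epsilon> r = \<delta> r" using \<delta>H by metis
    then show "r \<in> P" using r s e by (auto simp: P_def)
  qed
  have sC: "{s..s + e} \<subseteq> C"
    unfolding C_def using e by (intro connected_component_maximal sP) auto
  have "s \<in> C" using sC e(1) by auto
  have "C \<noteq> {}" using \<open>s \<in> C\<close> by blast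
  have "compact C" "connected C"
    using \<open>closed C\<close> bounded_subset[OF bounded_closed_interval \<open>C \<subseteq> {0..D}\<close>]
    by (auto simp: compact_eq_bounded_closed C_def)
  \<comment> \<open>\<open>a\<close> can be smaller than \<open>s\<close>, since the members of
    \<open>H\<close> may already agree before \<open>u\<close>. There \<open>\<delta>\<close> is
    \<open>\<gamma>\<close>, so this piece already belongs to the path.\<close>
  then obtain a b where ab: "C = {a..b}"
    using connected_compact_interval_1 \<open>C \<noteq> {}\<close> by blast
  have ab': "0 \<le> a" "a \<le> s" "s + e \<le> b" "b \<le> D"
    using sC e \<open>C \<subseteq> {0..D}\<close> unfolding ab by auto
  have comp: "connected_component_set p' u = \<delta> ` C"
  proof
    have "connected (\<delta> ` C)"
      by (rule connected_continuous_image[OF continuous_on_subset[OF cont[OF \<delta>H] \<open>C \<subseteq> {0..D}\<close>] \<open>connected C\<close>])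
    moreover have "u \<in> \<delta> ` C" using sC e Hs[OF \<delta>H] by force
    ultimately show "\<delta> ` C \<subseteq> connected_component_set p' u"
      using CP unfolding p'_P by (intro connected_component_maximal) auto
    \<comment> \<open>Conversely, \<open>gdist T v\<close> maps the component continuously into
      \<open>P\<close> and takes \<open>u\<close> to \<open>s\<close>, so its image stays in
      \<open>C\<close>.\<close>
    define K where "K = connected_component_set p' u"
    have "K \<subseteq> p'" unfolding K_def by (rule connected_component_subset)
    have Kim: "x = \<delta> (gdist T v x) \<and> gdist T v x \<in> P" if x: "x \<in> K" for x
    proof -
      obtain r where "r \<in> P" "x = \<delta> r" using x \<open>K \<subseteq> p'\<close> p'_P by blast
      then show ?thesis using gdist_geodesic_start[OF \<delta>, of r] by (auto simp: P_def D_def)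
    qed
    have "K \<subseteq> T"
    proof
      fix x assume "x \<in> K"
      then show "x \<in> T" using Kim[of x] geodesicD(5)[OF \<delta>, of "gdist T v x"] by (auto simp: P_def D_def)
    qed
    then have "connected (gdist T v ` K)"
      using continuous_on_subset[OF continuous_on_gdist[OF geodesicD(1)[OF \<gamma>]]]
      by (intro connected_continuous_image) (auto simp: K_def)
    moreover have "s \<in> gdist T v ` K"
    proof -
      have "u \<in> p'" using sP e Hs[OF \<delta>H] unfolding p'_P by force
      then have "u \<in> K" by (simp add: K_def)
      moreover have "gdist T v u = s" using gdist_geodesic_start[OF \<gamma>, of s] s by (simp add: u_def)
      ultimately show ?thesis by force
    qed
    ultimately have "gdist T v ` K \<subseteq> C"
      unfolding C_def using Kim by (intro connected_component_maximal) auto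
    then show "K \<subseteq> \<delta> ` C" using Kim by (metis image_eqI image_subset_iff subsetI)
  qed
  have "\<gamma> ` {0..s} \<union> \<delta> ` {a..b} = \<delta> ` {0..b}"
  proof -
    have "\<gamma> ` {0..s} = \<delta> ` {0..s}" by (intro image_cong) (auto simp: \<delta>_def)
    moreover have "{0..s} \<union> {a..b} = {0..b}" using ab' e s by auto
    ultimately show ?thesis by (metis image_Un)
  qed
  moreover have "path_end v (\<delta> ` {0..b}) = \<delta> b"
    using ab' e s by (intro path_end_geodesic[OF \<delta>]) (auto simp: D_def)
  ultimately have ext: "extend_path T v w (\<gamma> ` {0..s}, \<gamma> s) = (\<delta> ` {0..b}, \<delta> b)"
    using comp unfolding extend_path_def p'_def ab u_def by (simp add: Let_def)
  have "\<delta> b \<in> insert w V"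
  proof (rule ccontr)
    assume not: "\<delta> b \<notin> insert w V"
    then have "b \<noteq> D" using geodesicD(4)[OF \<delta>] by (auto simp: D_def)
    then have b: "0 < b" "b < D" "\<delta> b \<notin> V" using ab' e s not by auto
    \<comment> \<open>All members of \<open>H\<close> arrive at \<open>\<delta> b\<close> along the same direction and do not turn there.\<close>
    define N where "N = (\<lambda>n. norm (n - \<delta> b)) ` insert w V"
    define \<rho> where "\<rho> = Min N"
    have N: "finite N" "N \<noteq> {}" using finite_V by (auto simp: N_def)
    have \<rho>: "\<rho> > 0" using Min_in[OF N] not by (auto simp: N_def \<rho>_def)
    have \<rho>N: "\<rho> \<le> norm (n - \<delta> b)" if "n \<in> insert w V" for n
      unfolding \<rho>_def by (rule Min_le[OF N(1)]) (use that in \<open>auto simp: N_def\<close>)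
    define \<sigma> where "\<sigma> = \<delta> b"
    \<comment> \<open>The bound \<open>c \<le> e\<close> keeps \<open>b - c\<close> in
      \<open>{s..b}\<close>, where all members of \<open>H\<close> agree, so their incoming
      directions can be compared there. The length \<open>\<rho>\<close> of the straight
      continuation is the same for all of them.\<close>
    have key: "b + \<rho> \<le> D \<and> (\<exists>d' c. 0 < c \<and> c \<le> e \<and> (\<forall>r\<in>{0..c}. \<epsilon> (b - r) = \<sigma> - r *\<^sub>R d') \<and>
      (\<forall>r\<in>{0..\<rho>}. \<epsilon> (b + r) = \<sigma> + r *\<^sub>R d'))" if \<epsilon>: "\<epsilon> \<in> H" for \<epsilon>
    proof -
      have "b \<in> P" using CP ab' e ab by auto
      then have \<epsilon>b: "\<epsilon> b = \<sigma>" using \<epsilon> by (simp add: P_def \<sigma>_def)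
      obtain n where n: "n \<in> insert w V" "n \<noteq> \<sigma>" "b + norm (n - \<sigma>) \<le> D"
        "\<And>r. r \<in> {0..norm (n - \<sigma>)} \<Longrightarrow> \<epsilon> (b + r) = \<sigma> + r *\<^sub>R sgn (n - \<sigma>)"
        using geodesic_next_node[OF Hg[OF \<epsilon>], of b] b \<epsilon>b unfolding D_def by (metis less_imp_le)
      obtain c where c: "c > 0" "c \<le> b" "b + c \<le> D" "dist (\<epsilon> (b - c)) (\<epsilon> (b + c)) = 2 * c"
        using geodesic_straight_through[OF Hg[OF \<epsilon>], of b] b \<epsilon>b unfolding D_def \<sigma>_def by metis
      define d' where "d' = sgn (\<epsilon> (b + c) - \<epsilon> (b - c))"
      have lin: "\<epsilon> r = \<epsilon> (b - c) + (r - (b - c)) *\<^sub>R d'" if "r \<in> {b - c..b + c}" for r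
        unfolding d'_def
      proof (rule lipschitz_segment)
        fix r r' assume "r \<in> {b - c..b + c}" "r' \<in> {b - c..b + c}"
        then show "dist (\<epsilon> r) (\<epsilon> r') \<le> \<bar>r - r'\<bar>"
          using c by (intro geodesicD(6)[OF Hg[OF \<epsilon>]]) (auto simp: D_def)
      qed (use c that in auto)
      have lin': "\<epsilon> (b + r) = \<sigma> + r *\<^sub>R d'" if "\<bar>r\<bar> \<le> c" for r
      proof -
        have "b + r \<in> {b - c..b + c}" using that by auto
        then have "\<epsilon> (b + r) - \<epsilon> b = r *\<^sub>R d'"
          using lin[of "b + r"] lin[of b] c by (simp add: algebra_simps)
        then show ?thesis using \<epsilon>b by (simp add: algebra_simps)
      qed
      define r where "r = min c (norm (n - \<sigma>))"
      have r: "r > 0" "\<bar>r\<bar> \<le> c" "r \<in> {0..norm (n - \<sigma>)}" using c n(2) by (auto simp: r_def)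
      then have "r *\<^sub>R d' = r *\<^sub>R sgn (n - \<sigma>)" using lin'[of r] n(4)[of r] by simp
      then have d': "d' = sgn (n - \<sigma>)" using r(1) by simp
      have "\<rho> \<le> norm (n - \<sigma>)" using \<rho>N[OF n(1)] by (simp add: \<sigma>_def)
      moreover have "\<epsilon> (b - r) = \<sigma> - r *\<^sub>R d'" if "r \<in> {0..min c e}" for r
        using lin'[of "- r"] that by simp
      ultimately show ?thesis
        using n(3,4) d' c(1) e(1) by (intro conjI exI[of _ d'] exI[of _ "min c e"]) auto
    qed
    obtain d1 c1 where d1: "0 < c1" "c1 \<le> e" "\<forall>r\<in>{0..c1}. \<delta> (b - r) = \<sigma> - r *\<^sub>R d1"
      "\<forall>r\<in>{0..\<rho>}. \<delta> (b + r) = \<sigma> + r *\<^sub>R d1" "b + \<rho> \<le> D" using key[OF \<delta>H] by blast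
    have "{a..b + \<rho>} \<subseteq> P"
    proof
      fix t assume t: "t \<in> {a..b + \<rho>}"
      have "\<epsilon> t = \<delta> t" if \<epsilon>: "\<epsilon> \<in> H" for \<epsilon>
      proof (cases "t \<le> b")
        case True
        then have "t \<in> P" using t CP ab by auto
        then show ?thesis using \<epsilon> by (simp add: P_def)
      next
        case False
        obtain d2 c2 where d2: "0 < c2" "c2 \<le> e" "\<forall>r\<in>{0..c2}. \<epsilon> (b - r) = \<sigma> - r *\<^sub>R d2"
          "\<forall>r\<in>{0..\<rho>}. \<epsilon> (b + r) = \<sigma> + r *\<^sub>R d2" using key[OF \<epsilon>] by blast
        define c where "c = min c1 c2"
        have c: "c > 0" "c \<le> e" "c \<in> {0..c1}" "c \<in> {0..c2}" using d1 d2 by (auto simp: c_def)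
        then have "b - c \<in> P" using CP ab ab' by auto
        then have "\<epsilon> (b - c) = \<delta> (b - c)" using \<epsilon> by (simp add: P_def)
        then have "c *\<^sub>R d1 = c *\<^sub>R d2" using d1(3) d2(3) c by simp
        then have "d1 = d2" using c(1) by simp
        moreover have "t - b \<in> {0..\<rho>}" using t False by auto
        ultimately have "\<epsilon> (b + (t - b)) = \<delta> (b + (t - b))" using d1(4) d2(4) by metis
        then show ?thesis by simp
      qed
      then show "t \<in> P" using t ab' d1(5) by (auto simp: P_def)
    qed
    then have "{a..b + \<rho>} \<subseteq> C"
      unfolding C_def using ab' \<rho> e by (intro connected_component_maximal) auto
    then show False using ab ab' \<rho> e by auto
  qed
  then show ?thesis using that[OF \<delta> _ _ _ ext] ab' e by (auto simp: D_def)
qed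

text \<open>The invariant remembers the point set as the image of an initial interval of some
  geodesic, which may change from round to round.\<close>

lemma UniquePath_geodesic:
  assumes "v \<in> T" "w \<in> T"
  obtains \<gamma> where "geodesic T v w \<gamma>" "UniquePath T v w = Some (\<gamma> ` {0..gdist T v w})"
proof -
  define I where "I = (\<lambda>(p, u). \<exists>\<gamma> s. geodesic T v w \<gamma> \<and> 0 \<le> s \<and> s \<le> gdist T v w \<and> p = \<gamma> ` {0..s} \<and> u = \<gamma> s)"
  \<comment> \<open>Counts the nodes, and \<open>w\<close>, strictly farther from \<open>v\<close>
    than the current point. A round ends at such a node, which then drops out of the count.\<close>
  define f where "f = (\<lambda>(p :: complex set, u). card {n \<in> insert w V. gdist T v u < gdist T v n})"
  obtain \<gamma>0 where "geodesic T v w \<gamma>0" using geodesic_exists assms by blast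
  moreover have "{v} = \<gamma>0 ` {0..0}" "v = \<gamma>0 0" using geodesicD(3)[OF \<open>geodesic T v w \<gamma>0\<close>] by auto
  ultimately have init: "I ({v}, v)"
    using gdist_nonneg[OF assms] unfolding I_def by blast
  have step: "I (extend_path T v w st) \<and> f (extend_path T v w st) < f st"
    if I: "I st" and b: "(\<lambda>(p, u). u \<noteq> w) st" for st
  proof -
    obtain \<gamma> s where st: "st = (\<gamma> ` {0..s}, \<gamma> s)" and \<gamma>: "geodesic T v w \<gamma>" and s: "0 \<le> s" "s \<le> gdist T v w"
      using I unfolding I_def by blast
    have "s \<noteq> gdist T v w" using b geodesicD(4)[OF \<gamma>] by (auto simp: st)
    then obtain \<delta> t where \<delta>: "geodesic T v w \<delta>" "s < t" "t \<le> gdist T v w" "\<delta> t \<in> insert w V"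
      "extend_path T v w st = (\<delta> ` {0..t}, \<delta> t)"
      using extend_path_geodesic[OF \<gamma>, of s] s unfolding st by (metis less_le)
    have g: "gdist T v (\<delta> t) = t" "gdist T v (\<gamma> s) = s"
      using gdist_geodesic_start[OF \<delta>(1), of t] gdist_geodesic_start[OF \<gamma>, of s] s \<delta> by auto
    have "{n \<in> insert w V. t < gdist T v n} \<subset> {n \<in> insert w V. s < gdist T v n}"
    proof
      show "{n \<in> insert w V. t < gdist T v n} \<subseteq> {n \<in> insert w V. s < gdist T v n}"
        using \<delta>(2) by auto
      have "\<delta> t \<in> {n \<in> insert w V. s < gdist T v n}" "\<delta> t \<notin> {n \<in> insert w V. t < gdist T v n}"
        using \<delta>(2,4) g(1) by auto
      then show "{n \<in> insert w V. t < gdist T v n} \<noteq> {n \<in> insert w V. s < gdist T v n}" by blast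
    qed
    then have "card {n \<in> insert w V. t < gdist T v n} < card {n \<in> insert w V. s < gdist T v n}"
      using finite_V by (intro psubset_card_mono) auto
    then have "f (extend_path T v w st) < f st" unfolding \<delta>(5) unfolding st by (simp add: f_def g)
    moreover have "I (extend_path T v w st)"
      unfolding I_def \<delta>(5) using \<delta>(1-3) s by (auto intro!: exI[of _ \<delta>] exI[of _ t])
    ultimately show ?thesis by blast
  qed
  obtain st where st: "while_option (\<lambda>(p, u). u \<noteq> w) (extend_path T v w) ({v}, v) = Some st"
    using measure_while_option_Some[of I "\<lambda>(p, u). u \<noteq> w" "extend_path T v w" f, OF step init] by blast
  have "I st" by (rule while_option_rule[of I, OF _ st init]) (use step in blast)
  then obtain \<gamma> s where \<gamma>: "geodesic T v w \<gamma>" "0 \<le> s" "s \<le> gdist T v w" "st = (\<gamma> ` {0..s}, \<gamma> s)"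
    unfolding I_def by blast
  have "\<gamma> s = w" using while_option_stop[OF st] \<gamma>(4) by simp
  then have "s = gdist T v w" using gdist_geodesic_start[OF \<gamma>(1), of s] \<gamma> by simp
  then show ?thesis using that \<gamma> st by (simp add: UniquePath_def)
qed

end

section \<open>Polygonal routes and walks\<close>

lemma polyline_ends: "xs \<noteq> [] \<Longrightarrow> pathstart (polyline xs) = hd xs \<and> pathfinish (polyline xs) = last xs"
  by (induction xs rule: polyline.induct) auto

lemma path_image_polyline_Cons:
  "path_image (polyline (a # b # xs)) = closed_segment a b \<union> path_image (polyline (b # xs))"
  by (cases xs) (auto simp: path_image_join polyline_ends)

lemma arc_polyline_Cons:
  "arc (polyline (a # b # c # xs)) \<longleftrightarrow> a \<noteq> b \<and> arc (polyline (b # c # xs)) \<and>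
     closed_segment a b \<inter> path_image (polyline (b # c # xs)) \<subseteq> {b}"
  using arc_distinct_ends[of "linepath a b"] by (auto simp: arc_join_eq polyline_ends)

lemma arc_polyline_distinct:
  "arc (polyline xs) \<Longrightarrow> Suc i < length xs \<Longrightarrow> xs ! i \<noteq> xs ! Suc i"
proof (induction xs arbitrary: i rule: polyline.induct)
  case (4 a b c xs)
  then show ?case by (cases i) (auto simp only: arc_polyline_Cons nth_Cons_0 nth_Cons_Suc length_Cons)
qed (auto dest: arc_distinct_ends)

text \<open>Excludes an early visit to the end of the route, hence an early meeting with an inert
  agent waiting there.\<close>

lemma arc_polyline_last_notin:
  "arc (polyline xs) \<Longrightarrow> Suc (Suc i) < length xs \<Longrightarrow> last xs \<notin> closed_segment (xs ! i) (xs ! Suc i)"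
proof (induction xs arbitrary: i rule: polyline.induct)
  case (4 a b c xs)
  have arc: "arc (polyline (b # c # xs))" and int: "closed_segment a b \<inter> path_image (polyline (b # c # xs)) \<subseteq> {b}"
    using 4(2) unfolding arc_polyline_Cons by auto
  show ?case
  proof (cases i)
    case 0
    have "last (b # c # xs) \<in> path_image (polyline (b # c # xs))" "last (b # c # xs) \<noteq> b"
      using pathfinish_in_path_image[of "polyline (b # c # xs)"] arc_distinct_ends[OF arc]
      by (simp_all only: polyline_ends list.sel not_False_eq_True list.distinct)
    then show ?thesis using int 0 by auto
  next
    case (Suc j)
    then show ?thesis using 4(1)[OF arc, of j] 4(3) by simp
  qed
qed auto

text \<open>Whatever the adversary does, standing at the last point means that at most the last
  segment is unfinished, and the portion of it that counts already reaches its end.\<close>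

lemma trajectory_length_complete:
  assumes arc: "arc (polyline rs)" and walk: "walk rs ts f" and t: "0 \<le> t" "f t = last rs"
  shows "trajectory_length rs ts f t = chain_length rs"
  unfolding trajectory_length_def chain_length_eq_sum
proof (rule sum.cong)
  fix i assume "i \<in> {..<length rs - 1}"
  then have i: "Suc i < length rs" by auto
  have w: "length ts = length rs" "hd ts = 0" "sorted_wrt (<) ts"
    "\<And>i. Suc i < length rs \<Longrightarrow> f ` {ts ! i..ts ! Suc i} \<subseteq> closed_segment (rs ! i) (rs ! Suc i)"
    using walk unfolding walk_def by blast+
  have last_seg: "Suc (Suc j) = length rs" if "Suc j < length rs" "ts ! j \<le> t" "t < ts ! Suc j" for j
  proof (rule ccontr)
    assume "Suc (Suc j) \<noteq> length rs"
    then have "last rs \<notin> closed_segment (rs ! j) (rs ! Suc j)"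
      using arc_polyline_last_notin[OF arc] that(1) by simp
    moreover have "f t \<in> closed_segment (rs ! j) (rs ! Suc j)"
      using w(4)[OF that(1)] that by auto
    ultimately show False using t by simp
  qed
  consider "ts ! Suc i \<le> t" | "ts ! i \<le> t" "t < ts ! Suc i" | "t < ts ! i" by linarith
  then show "(if ts ! Suc i \<le> t then dist (rs ! i) (rs ! Suc i)
      else if ts ! i \<le> t then dist (rs ! i) (f t) else 0) = dist (rs ! i) (rs ! Suc i)"
  proof cases
    case 2
    then have "last rs = rs ! Suc i" using last_seg[OF i] by (metis diff_Suc_1 last_conv_nth list.size(3) nat.distinct(1))
    then show ?thesis using 2 t by simp
  next
    case 3
    have "ts \<noteq> []" using i w(1) by auto
    then have "ts ! 0 \<le> t" using w(2) t(1) by (simp add: hd_conv_nth)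
    \<comment> \<open>\<open>j\<close> is the segment being traversed at time \<open>t\<close>; it
      has to be the last one, yet \<open>j < i\<close>.\<close>
    define j where "j = (GREATEST j. j < i \<and> ts ! j \<le> t)"
    have "0 < i" using 3 \<open>ts ! 0 \<le> t\<close> by (cases i) auto
    then have j: "j < i" "ts ! j \<le> t" and greatest: "\<And>k. k < i \<Longrightarrow> ts ! k \<le> t \<Longrightarrow> k \<le> j"
      unfolding j_def
      using GreatestI_nat[of "\<lambda>j. j < i \<and> ts ! j \<le> t" 0 i] \<open>ts ! 0 \<le> t\<close>
        Greatest_le_nat[of "\<lambda>j. j < i \<and> ts ! j \<le> t" _ i] by auto
    have "t < ts ! Suc j"
    proof (cases "Suc j = i")
      case False
      then show ?thesis using greatest[of "Suc j"] j(1) by force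
    qed (use 3 in simp)
    then have "Suc (Suc j) = length rs" using last_seg[of j] j i by simp
    then show ?thesis using j(1) i by simp
  qed auto
qed simp

text \<open>One unit of time per segment, arriving for the first time at \<open>real n\<close>. This
  supplies an actual execution, so that the set of costs is not empty.\<close>

lemma walk_exists:
  assumes arc: "arc (polyline rs)" and len: "2 \<le> length rs"
  obtains ts f t where "walk rs ts f" "0 \<le> t" "f t = last rs" "\<And>s. 0 \<le> s \<Longrightarrow> s < t \<Longrightarrow> f s \<noteq> last rs"
proof -
  define n where "n = length rs - 1"
  have n: "length rs = Suc n" "0 < n" using len by (auto simp: n_def)
  define ts where "ts = map real [0..<Suc n]"
  define f where "f = (\<lambda>t. if t \<ge> real n then last rs
    else linepath (rs ! nat \<lfloor>t\<rfloor>) (rs ! Suc (nat \<lfloor>t\<rfloor>)) (t - real_of_int \<lfloor>t\<rfloor>))"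
  have ts: "ts ! i = real i" if "i < Suc n" for i using that unfolding ts_def by (simp del: upt_Suc)
  have last: "last rs = rs ! n" using n by (metis diff_Suc_1 last_conv_nth length_0_conv nat.distinct(1))
  have f_seg: "f t = linepath (rs ! i) (rs ! Suc i) (t - real i)" if i: "i < n" and t: "real i \<le> t" "t \<le> real (Suc i)" for i t
  proof (cases "t = real (Suc i)")
    case True
    show ?thesis
    proof (cases "Suc i = n")
      case True
      then have "f t = rs ! Suc i" using \<open>t = real (Suc i)\<close> last by (simp add: f_def)
      then show ?thesis using \<open>t = real (Suc i)\<close> by (simp add: linepath_1')
    next
      case False
      then have "t < real n" using i True by simp
      moreover have "\<lfloor>t\<rfloor> = int (Suc i)" using True by simp
      ultimately have "f t = rs ! Suc i" using True by (simp add: f_def linepath_0' nat_add_distrib)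
      then show ?thesis using True by (simp add: linepath_1')
    qed
  next
    case False
    then have "\<lfloor>t\<rfloor> = int i" using t by (intro floor_unique) auto
    then show ?thesis using t False i by (auto simp: f_def)
  qed
  have "walk rs ts f"
    unfolding walk_def
  proof (intro conjI allI impI)
    show "rs \<noteq> []" "length ts = length rs" using n by (auto simp: ts_def)
    show "hd ts = 0" unfolding ts_def by (simp add: hd_map hd_upt del: upt_Suc)
    show "sorted_wrt (<) ts" unfolding ts_def by (simp add: sorted_wrt_map del: upt_Suc)
    fix i assume "Suc i < length rs"
    then have i: "i < n" using n by simp
    have tsi: "ts ! i = real i" "ts ! Suc i = real (Suc i)" using i by (simp_all add: ts)
    have eq: "f t = linepath (rs ! i) (rs ! Suc i) (t - real i)" if "t \<in> {real i..real (Suc i)}" for t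
      using f_seg[OF i] that by simp
    show "continuous_on {ts ! i..ts ! Suc i} f"
      unfolding tsi by (subst continuous_on_cong[OF refl eq]) (auto simp: linepath_def intro!: continuous_intros)
    show "f ` {ts ! i..ts ! Suc i} \<subseteq> closed_segment (rs ! i) (rs ! Suc i)"
      unfolding tsi using eq by (auto intro!: linepath_in_path)
    show "f (ts ! i) = rs ! i" "f (ts ! Suc i) = rs ! Suc i"
      unfolding tsi using eq[of "real i"] eq[of "real (Suc i)"] by (simp_all add: linepath_0' linepath_1')
  next
    fix t assume "last ts \<le> t"
    moreover have "last ts = real n" unfolding ts_def by simp
    ultimately show "f t = last rs" by (simp add: f_def)
  qed
  moreover have "f s \<noteq> last rs" if s: "0 \<le> s" "s < real n" for s
  proof
    define i where "i = nat \<lfloor>s\<rfloor>"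
    have i: "real i \<le> s" "s < real (Suc i)" using s(1) unfolding i_def by linarith+
    then have "i < n" using s(2) by linarith
    assume "f s = last rs"
    then have fs: "linepath (rs ! i) (rs ! Suc i) (s - real i) = last rs"
      using f_seg[OF \<open>i < n\<close>, of s] i by simp
    show False
    proof (cases "Suc i = n")
      case True
      have "linepath (rs ! i) (rs ! Suc i) (s - real i) - rs ! Suc i = (1 - (s - real i)) *\<^sub>R (rs ! i - rs ! Suc i)"
        by (simp add: linepath_def algebra_simps)
      then have "(1 - (s - real i)) *\<^sub>R (rs ! i - rs ! Suc i) = 0" using fs last True by simp
      then have "rs ! i = rs ! Suc i" using i by auto
      then show False using arc_polyline_distinct[OF arc, of i] True n by simp
    next
      case False
      then have "last rs \<notin> closed_segment (rs ! i) (rs ! Suc i)"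
        using arc_polyline_last_notin[OF arc, of i] \<open>i < n\<close> n by simp
      moreover have "linepath (rs ! i) (rs ! Suc i) (s - real i) \<in> closed_segment (rs ! i) (rs ! Suc i)"
        using i by (intro linepath_in_path) auto
      ultimately show False using fs by simp
    qed
  qed
  ultimately show ?thesis using that[of ts f "real n"] by (simp add: f_def)
qed

lemma walk_inert:
  assumes "walk [a] ts f" "0 \<le> t"
  shows "f t = a"
proof -
  obtain t0 where "ts = [t0]" using assms(1) by (auto simp: walk_def length_Suc_conv)
  then show ?thesis using assms by (auto simp: walk_def)
qed

lemma walk_inert_exists: "walk [a] [0] (\<lambda>_. a)"
  by (simp add: walk_def)

lemma walk_reaches_end:
  assumes "walk rs ts f"
  obtains t where "0 \<le> t" "f t = last rs"
  using assms that[of "max 0 (last ts)"] by (simp add: walk_def)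

lemma trajectory_length_inert: "trajectory_length [a] ts f t = 0"
  by (simp add: trajectory_length_def)

section \<open>Length of a polygonal arc on a geodesic\<close>

context planar_star_space
begin

text \<open>A route is prescribed only as an arc with a given image, so its length must come from
  the image. Each segment lies in \<open>T\<close>, hence has length \<open>gdist\<close>; as the
  arc never runs backwards, these distances telescope.\<close>

lemma chain_length_arc_in_geodesic:
  assumes \<gamma>: "geodesic T v w \<gamma>"
  shows "arc (polyline rs) \<Longrightarrow> 2 \<le> length rs \<Longrightarrow> path_image (polyline rs) \<subseteq> \<gamma> ` {0..gdist T v w} \<Longrightarrow>
    last rs = w \<Longrightarrow> chain_length rs = gdist T v w - gdist T v (hd rs)"
proof (induction rs rule: polyline.induct)
  case (3 a b)
  have im: "\<gamma> ` {0..gdist T v w} \<subseteq> T" by (intro image_subsetI geodesicD(5)[OF \<gamma>])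
  have ab: "closed_segment a b \<subseteq> \<gamma> ` {0..gdist T v w}" "b = w" using 3 by auto
  then have d: "dist a b = gdist T a b" using gdist_segment im by (metis order_trans)
  obtain s where s: "a = \<gamma> s" "s \<in> {0..gdist T v w}" using ab(1) ends_in_segment(1)[of a b] by blast
  then have "gdist T a w = gdist T v w - s"
    using gdist_geodesic[OF \<gamma>, of s "gdist T v w"] geodesicD(4)[OF \<gamma>] by simp
  then show ?case using d gdist_geodesic_start[OF \<gamma> s(2)] s(1) ab(2) by simp
next
  case (4 a b c rs)
  define D where "D = gdist T v w"
  let ?k = "gdist T v"
  let ?rest = "path_image (polyline (b # c # rs))"
  have "\<gamma> ` {0..D} \<subseteq> T" unfolding D_def by (intro image_subsetI geodesicD(5)[OF \<gamma>])
  have arc: "arc (polyline (b # c # rs))" "a \<noteq> b" and int: "closed_segment a b \<inter> ?rest \<subseteq> {b}"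
    using 4(2) unfolding arc_polyline_Cons by auto
  have sub: "closed_segment a b \<subseteq> \<gamma> ` {0..D}" "?rest \<subseteq> \<gamma> ` {0..D}"
    using 4(4) by (simp_all only: path_image_polyline_Cons Un_subset_iff D_def)
  have IH: "chain_length (b # c # rs) = D - ?k b"
    using 4(1) arc(1) sub(2) 4(5) by (simp add: D_def)
  have \<gamma>k: "\<gamma> (?k x) = x" "?k x \<in> {0..D}" if x: "x \<in> \<gamma> ` {0..D}" for x
  proof -
    obtain s where "s \<in> {0..D}" "x = \<gamma> s" using x by blast
    then show "\<gamma> (?k x) = x" "?k x \<in> {0..D}" using gdist_geodesic_start[OF \<gamma>, of s] by (auto simp: D_def)
  qed
  have a: "a \<in> \<gamma> ` {0..D}" "b \<in> \<gamma> ` {0..D}" using sub(1) by auto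
  \<comment> \<open>If the segment ran back towards \<open>v\<close>, the remaining arc from
    \<open>b\<close> to \<open>w\<close> would pass the level of \<open>a\<close>, hence
    \<open>a\<close> itself, against injectivity.\<close>
  have "?k a \<le> ?k b"
  proof (rule ccontr)
    assume less: "\<not> ?k a \<le> ?k b"
    have "b \<in> ?rest" "w \<in> ?rest"
      using pathstart_in_path_image[of "polyline (b # c # rs)"] pathfinish_in_path_image[of "polyline (b # c # rs)"]
        polyline_ends[of "b # c # rs"] 4(5) by auto
    then have ends: "?k b \<in> ?k ` ?rest" "?k w \<in> ?k ` ?rest" by (auto intro: imageI)
    have conn: "connected (?k ` ?rest)"
      using sub(2) \<open>\<gamma> ` {0..D} \<subseteq> T\<close> arc(1)
      by (intro connected_continuous_image continuous_on_subset[OF continuous_on_gdist[OF geodesicD(1)[OF \<gamma>]]]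
          connected_path_image arc_imp_path) auto
    have "?k a \<le> ?k w" using \<gamma>k(2)[OF a(1)] by (simp add: D_def)
    moreover have "?k b \<le> ?k a" using less by simp
    ultimately have "?k a \<in> ?k ` ?rest" by (rule connectedD_interval[OF conn ends, rotated])
    then obtain x where x: "x \<in> ?rest" "?k x = ?k a" by auto
    then have "x = a" using \<gamma>k(1)[of x] \<gamma>k(1)[OF a(1)] sub(2) by (metis subsetD)
    then show False using x(1) int arc(2) by auto
  qed
  moreover have "dist a b = gdist T a b"
    using gdist_segment sub(1) \<open>\<gamma> ` {0..D} \<subseteq> T\<close> by (metis order_trans)
  moreover have "gdist T a b = ?k b - ?k a"
    using gdist_geodesic[OF \<gamma>, of "?k a" "?k b"] \<gamma>k[OF a(1)] \<gamma>k[OF a(2)] calculation(1) by (simp add: D_def)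
  ultimately show ?case using IH by (simp add: D_def)
qed auto

end

section \<open>Cutting a geodesic into route steps\<close>

lemma route_step_ray:
  assumes T: "closed_segment x (x + l *\<^sub>R d) \<subseteq> T" and d: "norm d = 1" and l: "0 < l" "l < e"
    and ray: "(\<forall>r\<in>{0<..<e}. x + r *\<^sub>R d \<in> frontier T) \<or> (\<forall>r\<in>{0<..<e}. x + r *\<^sub>R d \<notin> frontier T)"
  shows "route_step T x (x + l *\<^sub>R d)" "route_step T (x + l *\<^sub>R d) x"
proof -
  define y where "y = x + l *\<^sub>R d"
  have "x \<noteq> y" using d l by (auto simp: y_def)
  have open_sub: "open_segment x y \<subseteq> (\<lambda>r. x + r *\<^sub>R d) ` {0<..<e}"
  proof
    fix z assume "z \<in> open_segment x y"
    then obtain u where u: "0 < u" "u < 1" "z = (1 - u) *\<^sub>R x + u *\<^sub>R y" by (auto simp: in_segment)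
    then have "z = x + (u * l) *\<^sub>R d" by (simp add: y_def algebra_simps)
    moreover have "u * l \<le> l" using u l by (intro mult_left_le_one_le) auto
    then have "u * l < e" using l(2) by (rule le_less_trans)
    then have "u * l \<in> {0<..<e}" using u l by simp
    ultimately show "z \<in> (\<lambda>r. x + r *\<^sub>R d) ` {0<..<e}" by blast
  qed
  from ray have "open_segment x y \<subseteq> frontier T \<or> open_segment x y \<inter> frontier T = {}"
    using open_sub by blast
  then have "route_step T x y"
  proof
    assume "open_segment x y \<subseteq> frontier T"
    \<comment> \<open>The hypothesis on the ray says nothing about \<open>x\<close> itself; since
      the frontier is closed, following it includes both end points.\<close>
    then have "closure (open_segment x y) \<subseteq> frontier T" by (rule closure_minimal) simp
    then show ?thesis using \<open>x \<noteq> y\<close> by (simp add: route_step_def closure_open_segment)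
  qed (use T in \<open>simp add: route_step_def y_def\<close>)
  then show "route_step T x (x + l *\<^sub>R d)" "route_step T (x + l *\<^sub>R d) x"
    by (simp_all add: y_def route_step_def closed_segment_commute open_segment_commute)
qed

context tame_domain
begin

text \<open>Bisection again: a short interval around \<open>x\<close> is cut at \<open>x\<close>,
  because visibility and \<open>frontier_ray\<close> concern rays from \<open>\<gamma> x\<close>
  only.\<close>

lemma geodesic_route_partition:
  assumes \<gamma>: "geodesic T v w \<gamma>"
  obtains ts where "ts \<noteq> []" "hd ts = 0" "last ts = gdist T v w"
    "successively (\<lambda>s t. s < t \<and> dist (\<gamma> s) (\<gamma> t) = t - s \<and> route_step T (\<gamma> s) (\<gamma> t)) ts"
proof -
  define D where "D = gdist T v w"
  define good where "good = (\<lambda>s t. s < t \<and> dist (\<gamma> s) (\<gamma> t) = t - s \<and> route_step T (\<gamma> s) (\<gamma> t))"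
  define P where "P = (\<lambda>a b. 0 \<le> a \<and> b \<le> D \<longrightarrow> (\<exists>ts. ts \<noteq> [] \<and> hd ts = a \<and> last ts = b \<and> successively good ts))"
  have P_trans: "P a c" if P: "P a b" "P b c" "a \<le> b" "b \<le> c" for a b c
    unfolding P_def
  proof
    assume *: "0 \<le> a \<and> c \<le> D"
    then have "0 \<le> a" "b \<le> D" "0 \<le> b" "c \<le> D" using P(3,4) by auto
    then obtain ts1 ts2' where 1: "ts1 \<noteq> []" "hd ts1 = a" "last ts1 = b" "successively good ts1"
      and ts2': "ts2' \<noteq> []" "hd ts2' = b" "last ts2' = c" "successively good ts2'"
      using P(1,2) unfolding P_def by blast
    then obtain ts2 where 2: "last (b # ts2) = c" "successively good (b # ts2)"
      by (cases ts2') auto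
    show "\<exists>ts. ts \<noteq> [] \<and> hd ts = a \<and> last ts = c \<and> successively good ts"
      using 1 2 by (intro exI[of _ "ts1 @ ts2"]) (auto simp: successively_append_iff successively_Cons)
  qed
  have "0 \<le> D" using gdist_nonneg geodesicD(1,2)[OF \<gamma>] by (simp add: D_def)
  then have "P 0 D"
  proof (induction rule: Bolzano)
    case (trans a b c)
    then show ?case using P_trans by blast
  next
    case (local x)
    have x: "\<gamma> x \<in> T" by (rule geodesicD(5)[OF \<gamma>]) (use local in \<open>auto simp: D_def\<close>)
    obtain e1 where e1: "e1 > 0" "\<And>y. y \<in> T \<Longrightarrow> dist (\<gamma> x) y < e1 \<Longrightarrow>
        closed_segment (\<gamma> x) y \<subseteq> T \<and> gdist T (\<gamma> x) y = dist (\<gamma> x) y"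
      using gdist_local[OF x] by metis
    obtain e2 where e2: "e2 > 0" "\<And>d. norm d = 1 \<Longrightarrow>
        (\<forall>r\<in>{0<..<e2}. \<gamma> x + r *\<^sub>R d \<in> frontier T) \<or> (\<forall>r\<in>{0<..<e2}. \<gamma> x + r *\<^sub>R d \<notin> frontier T)"
      using frontier_ray[OF x] by blast
    have near: "dist (\<gamma> x) (\<gamma> t) = \<bar>t - x\<bar> \<and> route_step T (\<gamma> x) (\<gamma> t) \<and> route_step T (\<gamma> t) (\<gamma> x)"
      if t: "0 \<le> t" "t \<le> D" "t \<noteq> x" "\<bar>t - x\<bar> < min e1 e2" for t
    proof -
      have "\<gamma> t \<in> T" by (rule geodesicD(5)[OF \<gamma>]) (use t in \<open>auto simp: D_def\<close>)
      moreover have "dist (\<gamma> x) (\<gamma> t) \<le> \<bar>x - t\<bar>"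
        by (rule geodesicD(6)[OF \<gamma>]) (use t local in \<open>auto simp: D_def\<close>)
      ultimately have seg: "closed_segment (\<gamma> x) (\<gamma> t) \<subseteq> T" and d: "gdist T (\<gamma> x) (\<gamma> t) = dist (\<gamma> x) (\<gamma> t)"
        using e1(2)[of "\<gamma> t"] t by (simp_all add: abs_minus_commute)
      have "gdist T (\<gamma> x) (\<gamma> t) = \<bar>t - x\<bar>"
        using gdist_geodesic[OF \<gamma>, of x t] gdist_geodesic[OF \<gamma>, of t x] t local gdist_sym[of T "\<gamma> x"]
        by (cases "x \<le> t") (auto simp: D_def)
      then have dist: "dist (\<gamma> x) (\<gamma> t) = \<bar>t - x\<bar>" using d by simp
      define d where "d = sgn (\<gamma> t - \<gamma> x)"
      have ne: "\<gamma> t \<noteq> \<gamma> x" using dist t(3) by auto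
      then have nd: "norm d = 1" by (simp add: d_def norm_sgn)
      have "\<gamma> t = \<gamma> x + \<bar>t - x\<bar> *\<^sub>R d"
        using ne t(3) dist by (simp add: d_def sgn_div_norm dist_norm norm_minus_commute[of "\<gamma> x"])
      then show ?thesis
        using route_step_ray[of "\<gamma> x" "\<bar>t - x\<bar>" d T e2] seg nd t e2(2)[OF nd] dist by auto
    qed
    have "P a b" if ab: "a \<le> x" "x \<le> b" "b - a < min e1 e2" for a b
    proof -
      have "P a x"
        unfolding P_def
      proof
        assume *: "0 \<le> a \<and> x \<le> D"
        show "\<exists>ts. ts \<noteq> [] \<and> hd ts = a \<and> last ts = x \<and> successively good ts"
        proof (cases "a = x")
          case False
          then show ?thesis
            using near[of a] ab * by (intro exI[of _ "[a, x]"]) (auto simp: good_def dist_commute)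
        qed (auto intro: exI[of _ "[x]"])
      qed
      moreover have "P x b"
        unfolding P_def
      proof
        assume *: "0 \<le> x \<and> b \<le> D"
        show "\<exists>ts. ts \<noteq> [] \<and> hd ts = x \<and> last ts = b \<and> successively good ts"
        proof (cases "x = b")
          case False
          then show ?thesis
            using near[of b] ab * by (intro exI[of _ "[x, b]"]) (auto simp: good_def)
        qed (auto intro: exI[of _ "[b]"])
      qed
      ultimately show ?thesis using P_trans ab by blast
    qed
    then show ?case using e1(1) e2(1) by (intro exI[of _ "min e1 e2"]) auto
  qed
  then obtain ts where "ts \<noteq> []" "hd ts = 0" "last ts = D" "successively good ts"
    using \<open>0 \<le> D\<close> by (auto simp: P_def)
  then show ?thesis using that unfolding good_def D_def by blast
qed

text \<open>Straight pieces of an injective curve meet only at a shared cut point, so joining them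
  gives an arc.\<close>

lemma polyline_geodesic:
  assumes \<gamma>: "geodesic T v w \<gamma>"
  shows "2 \<le> length ts \<Longrightarrow> successively (\<lambda>s t. s < t \<and> dist (\<gamma> s) (\<gamma> t) = t - s) ts \<Longrightarrow>
    0 \<le> hd ts \<Longrightarrow> last ts \<le> gdist T v w \<Longrightarrow>
    hd ts < last ts \<and> arc (polyline (map \<gamma> ts)) \<and> path_image (polyline (map \<gamma> ts)) = \<gamma> ` {hd ts..last ts}"
proof (induction ts rule: induct_list012)
  case (3 a b ts)
  define D where "D = gdist T v w"
  have ab: "a < b" "dist (\<gamma> a) (\<gamma> b) = b - a" and succ: "successively (\<lambda>s t. s < t \<and> dist (\<gamma> s) (\<gamma> t) = t - s) (b # ts)"
    using 3(4) by auto
  have b_last: "b \<le> last (b # ts)"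
    using 3(2) succ 3(5,6) ab by (cases ts) auto
  then have bD: "b \<le> D" "0 \<le> a" using 3(5,6) by (auto simp: D_def)
  have seg: "closed_segment (\<gamma> a) (\<gamma> b) = \<gamma> ` {a..b}"
  proof -
    define d where "d = sgn (\<gamma> b - \<gamma> a)"
    have lin: "\<gamma> r = \<gamma> a + (r - a) *\<^sub>R d" if r: "r \<in> {a..b}" for r
      unfolding d_def
    proof (rule lipschitz_segment[OF _ ab(2) r])
      fix r r' assume "r \<in> {a..b}" "r' \<in> {a..b}"
      then show "dist (\<gamma> r) (\<gamma> r') \<le> \<bar>r - r'\<bar>"
        using bD by (intro geodesicD(6)[OF \<gamma>]) (auto simp: D_def)
    qed
    have "{a..b} = (\<lambda>u. a + u * (b - a)) ` {0..1}"
    proof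
      show "(\<lambda>u. a + u * (b - a)) ` {0..1} \<subseteq> {a..b}"
      proof (rule image_subsetI)
        fix u :: real assume "u \<in> {0..1}"
        then have "0 \<le> u * (b - a)" "u * (b - a) \<le> b - a"
          using ab(1) by (auto intro!: mult_left_le_one_le)
        then show "a + u * (b - a) \<in> {a..b}" by simp
      qed
      show "{a..b} \<subseteq> (\<lambda>u. a + u * (b - a)) ` {0..1}"
      proof
        fix r assume "r \<in> {a..b}"
        then show "r \<in> (\<lambda>u. a + u * (b - a)) ` {0..1}"
          using ab(1) by (intro image_eqI[of _ _ "(r - a) / (b - a)"]) (auto simp: field_simps)
      qed
    qed
    then have "\<gamma> ` {a..b} = (\<lambda>u. \<gamma> (a + u * (b - a))) ` {0..1}" by (metis image_image)
    also have "\<dots> = (\<lambda>u. (1 - u) *\<^sub>R \<gamma> a + u *\<^sub>R \<gamma> b) ` {0..1}"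
    proof (rule image_cong)
      fix u :: real assume "u \<in> {0..1}"
      then have "0 \<le> u * (b - a)" "u * (b - a) \<le> b - a"
        using ab(1) by (auto intro!: mult_left_le_one_le)
      then have "a + u * (b - a) \<in> {a..b}" by simp
      from lin[OF this] have "\<gamma> (a + u * (b - a)) = \<gamma> a + (u * (b - a)) *\<^sub>R d" by simp
      also have "\<dots> = (1 - u) *\<^sub>R \<gamma> a + u *\<^sub>R (\<gamma> a + (b - a) *\<^sub>R d)" by (simp add: algebra_simps)
      also have "\<gamma> a + (b - a) *\<^sub>R d = \<gamma> b" using lin[of b] ab(1) by simp
      finally show "\<gamma> (a + u * (b - a)) = (1 - u) *\<^sub>R \<gamma> a + u *\<^sub>R \<gamma> b" .
    qed simp
    finally show ?thesis by (simp add: closed_segment_image_interval)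
  qed
  have inj: "inj_on \<gamma> {0..D}" using geodesic_inj_on[OF \<gamma>] by (simp add: D_def)
  have ne: "\<gamma> a \<noteq> \<gamma> b" using ab by auto
  show ?case
  proof (cases ts)
    case Nil
    then show ?thesis using ab seg ne by simp
  next
    case (Cons c ts')
    have IH: "b < last (b # ts)" "arc (polyline (map \<gamma> (b # ts)))"
      "path_image (polyline (map \<gamma> (b # ts))) = \<gamma> ` {b..last (b # ts)}"
      using 3(2) succ 3(5,6) ab(1) Cons by auto
    have "{a..b} \<subseteq> {0..D}" "{b..last (b # ts)} \<subseteq> {0..D}"
      using 3(6) bD ab(1) by (auto simp: D_def)
    then have "\<gamma> ` {a..b} \<inter> \<gamma> ` {b..last (b # ts)} = \<gamma> ` ({a..b} \<inter> {b..last (b # ts)})"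
      by (rule inj_on_image_Int[OF inj, symmetric])
    also have "{a..b} \<inter> {b..last (b # ts)} = {b}" using ab(1) b_last by auto
    finally have int: "\<gamma> ` {a..b} \<inter> \<gamma> ` {b..last (b # ts)} \<subseteq> {\<gamma> b}" by simp
    have "arc (polyline (map \<gamma> (a # b # ts)))"
      using IH(2,3) int ne unfolding Cons seg[symmetric] by (simp add: arc_polyline_Cons del: polyline.simps)
    moreover have "path_image (polyline (map \<gamma> (a # b # ts))) = \<gamma> ` {a..b} \<union> \<gamma> ` {b..last (b # ts)}"
      using IH(3) by (simp add: path_image_polyline_Cons seg)
    moreover have "{a..b} \<union> {b..last (b # ts)} = {a..last (b # ts)}" using ab(1) b_last by auto
    ultimately show ?thesis using ab(1) IH(1) by (simp add: image_Un[symmetric])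
  qed
qed auto

text \<open>Nonemptiness is a genuine obligation: the computed path must be executable in finitely
  many steps. The length holds for every admissible cutting, as the adversary chooses it.\<close>

lemma routes_along_UniquePath:
  assumes "v \<in> T" "w \<in> T" "v \<noteq> w"
  obtains p where "UniquePath T v w = Some p" "routes_along T p v w \<noteq> {}"
    "\<And>rs. rs \<in> routes_along T p v w \<Longrightarrow> chain_length rs = gdist T v w"
proof -
  obtain \<gamma> where \<gamma>: "geodesic T v w \<gamma>" and U: "UniquePath T v w = Some (\<gamma> ` {0..gdist T v w})"
    using UniquePath_geodesic assms by blast
  obtain ts where ts: "ts \<noteq> []" "hd ts = 0" "last ts = gdist T v w"
    "successively (\<lambda>s t. s < t \<and> dist (\<gamma> s) (\<gamma> t) = t - s \<and> route_step T (\<gamma> s) (\<gamma> t)) ts"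
    using geodesic_route_partition[OF \<gamma>] .
  have "gdist T v w \<noteq> 0" using assms dist_le_gdist[of v w] by auto
  then have len: "2 \<le> length ts" using ts(1-3) by (cases ts rule: remdups_adj.cases) auto
  have "successively (\<lambda>s t. s < t \<and> dist (\<gamma> s) (\<gamma> t) = t - s) ts"
    by (rule successively_mono[OF ts(4)]) auto
  then have arc: "arc (polyline (map \<gamma> ts))" "path_image (polyline (map \<gamma> ts)) = \<gamma> ` {0..gdist T v w}"
    using polyline_geodesic[OF \<gamma> len] ts by auto
  have "successively (route_step T) (map \<gamma> ts)"
    unfolding successively_map by (rule successively_mono[OF ts(4)]) auto
  then have "map \<gamma> ts \<in> routes_along T (\<gamma> ` {0..gdist T v w}) v w"
    using arc ts assms geodesicD(3,4)[OF \<gamma>] by (auto simp: routes_along_def route_def hd_map last_map)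
  moreover have "chain_length rs = gdist T v w" if rs: "rs \<in> routes_along T (\<gamma> ` {0..gdist T v w}) v w" for rs
  proof -
    have "rs \<noteq> []" "hd rs = v" "last rs = w" "arc (polyline rs)" "path_image (polyline rs) = \<gamma> ` {0..gdist T v w}"
      using rs by (auto simp: routes_along_def route_def)
    moreover have "2 \<le> length rs" using calculation(1-3) assms(3) by (cases rs rule: remdups_adj.cases) auto
    ultimately show ?thesis using chain_length_arc_in_geodesic[OF \<gamma>, of rs] gdist_refl[OF assms(1)] by simp
  qed
  ultimately show ?thesis using that U by blast
qed

end

section \<open>Local structure of terrains\<close>

definition segments_union :: "(complex \<times> complex) set \<Rightarrow> complex set" where
  "segments_union S = (\<Union>(a, b)\<in>S. closed_segment a b)"

text \<open>The bridge from terrains to \<open>tame_domain\<close>. Similarities map segments to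
  segments and so preserve it, which makes it available for the copy of the terrain on a
  map.\<close>

definition segment_bordered :: "complex set \<Rightarrow> bool" where
  "segment_bordered T \<longleftrightarrow> compact T \<and> connected T \<and>
     (\<exists>S. finite S \<and> frontier T \<subseteq> segments_union S \<and> segments_union S \<subseteq> T)"

section \<open>Radial structure near a point\<close>

lemma closed_segment_param:
  fixes a b :: "'a::real_vector"
  assumes "x \<in> closed_segment a b"
  obtains m where "0 \<le> m" "m \<le> 1" "x = a + m *\<^sub>R (b - a)"
  using assms by (auto simp: in_segment algebra_simps)

text \<open>Near \<open>x\<close> a segment consists of rays from \<open>x\<close>, so scaling about
  \<open>x\<close> preserves it inside a small ball. If \<open>x\<close> is off the segment, the
  ball avoids the segment altogether.\<close>

lemma closed_segment_radial:
  fixes a b x :: "'a::euclidean_space"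
  obtains e where "e > 0" "\<And>y \<tau>. y \<in> closed_segment a b \<Longrightarrow> y \<noteq> x \<Longrightarrow> dist x y < e \<Longrightarrow> 0 < \<tau> \<Longrightarrow>
    dist x (x + \<tau> *\<^sub>R (y - x)) < e \<Longrightarrow> x \<in> closed_segment a b \<and> x + \<tau> *\<^sub>R (y - x) \<in> closed_segment a b"
proof (cases "x \<in> closed_segment a b")
  case False
  moreover have "open (- closed_segment a b)" by (simp add: open_Compl)
  ultimately obtain e where "e > 0" "ball x e \<subseteq> - closed_segment a b"
    by (metis ComplI open_contains_ball)
  then show ?thesis using that[of e] by force
next
  case True
  then obtain m where m: "0 \<le> m" "m \<le> 1" "x = a + m *\<^sub>R (b - a)" by (rule closed_segment_param)
  \<comment> \<open>The distance to the end points other than \<open>x\<close>; the value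
    \<open>1\<close> stands in for an end point equal to \<open>x\<close>, towards which no
    \<open>y\<close> can lie.\<close>
  define e where "e = min (if a = x then 1 else dist x a) (if b = x then 1 else dist x b)"
  have "e > 0" by (simp add: e_def)
  moreover have "x + \<tau> *\<^sub>R (y - x) \<in> closed_segment a b"
    if y: "y \<in> closed_segment a b" "y \<noteq> x" "0 < \<tau>" and near: "dist x (x + \<tau> *\<^sub>R (y - x)) < e" for y \<tau>
  proof -
    obtain n where n: "0 \<le> n" "n \<le> 1" "y = a + n *\<^sub>R (b - a)" using y(1) by (rule closed_segment_param)
    have ab: "a \<noteq> b" "n \<noteq> m" using m n y(2) by auto
    define k where "k = m + \<tau> * (n - m)"
    have yx: "y - x = (n - m) *\<^sub>R (b - a)" by (simp add: m(3) n(3) algebra_simps)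
    have z: "x + \<tau> *\<^sub>R (y - x) = a + k *\<^sub>R (b - a)"
      unfolding yx by (simp add: m(3) k_def algebra_simps)
    have "dist x (x + \<tau> *\<^sub>R (y - x)) = \<tau> * \<bar>n - m\<bar> * norm (b - a)"
      using y(3) by (simp add: yx dist_norm abs_mult)
    then have near': "\<tau> * \<bar>n - m\<bar> * norm (b - a) < e" using near by simp
    have "0 \<le> k \<and> k \<le> 1"
    proof (cases "m < n")
      case True
      have bx: "b - x = (1 - m) *\<^sub>R (b - a)" by (simp add: m(3) algebra_simps)
      then have "b \<noteq> x" using True n(2) ab by auto
      then have "e \<le> dist x b" by (simp add: e_def)
      also have "\<dots> = (1 - m) * norm (b - a)"
        using m(2) by (simp add: dist_norm norm_minus_commute[of x] bx)
      finally have "\<tau> * (n - m) * norm (b - a) < (1 - m) * norm (b - a)" using near' True by simp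
      then have "\<tau> * (n - m) < 1 - m" using ab by (simp add: mult_less_cancel_right_disj)
      moreover have "0 \<le> \<tau> * (n - m)" using y(3) True by simp
      ultimately show ?thesis using m by (simp add: k_def)
    next
      case False
      have ax: "x - a = m *\<^sub>R (b - a)" by (simp add: m(3))
      then have "a \<noteq> x" using False n(1) ab by auto
      then have "e \<le> dist x a" by (simp add: e_def)
      also have "\<dots> = m * norm (b - a)" using m(1) by (simp add: dist_norm ax)
      finally have "\<tau> * (m - n) * norm (b - a) < m * norm (b - a)" using near' False by simp
      then have "\<tau> * (m - n) < m" using ab by (simp add: mult_less_cancel_right_disj)
      moreover have "0 \<le> \<tau> * (m - n)" using y(3) False by simp
      moreover have "k = m - \<tau> * (m - n)" by (simp add: k_def algebra_simps)
      ultimately show ?thesis using m by simp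
    qed
    then show ?thesis unfolding z in_segment by (intro exI[of _ k]) (simp add: algebra_simps)
  qed
  ultimately show ?thesis using that True by blast
qed

lemma segments_union_radial:
  fixes x :: "'a::euclidean_space"
  assumes "finite S"
  obtains e where "e > 0" "\<And>a b y \<tau>. (a, b) \<in> S \<Longrightarrow> y \<in> closed_segment a b \<Longrightarrow> y \<noteq> x \<Longrightarrow> dist x y < e \<Longrightarrow>
    0 < \<tau> \<Longrightarrow> dist x (x + \<tau> *\<^sub>R (y - x)) < e \<Longrightarrow>
    x \<in> closed_segment a b \<and> x + \<tau> *\<^sub>R (y - x) \<in> closed_segment a b"
proof -
  define Q where "Q = (\<lambda>e p. \<forall>y \<tau>. y \<in> closed_segment (fst p) (snd p) \<and> y \<noteq> x \<and> dist x y < e \<and> 0 < \<tau> \<and>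
    dist x (x + \<tau> *\<^sub>R (y - x)) < e \<longrightarrow>
    x \<in> closed_segment (fst p) (snd p) \<and> x + \<tau> *\<^sub>R (y - x) \<in> closed_segment (fst p) (snd p))"
  have "\<exists>e>0. Q e p" for p
    by (rule closed_segment_radial[of "fst p" "snd p" x]) (auto simp: Q_def)
  then obtain E where E: "\<And>p. E p > 0" "\<And>p. Q (E p) p" by metis
  define e where "e = Min (insert 1 (E ` S))"
  have fin: "finite (insert 1 (E ` S))" using assms by simp
  have "e > 0" unfolding e_def using fin E(1) by (subst Min_gr_iff) auto
  moreover have "e \<le> E p" if "p \<in> S" for p unfolding e_def using fin that by (intro Min_le) auto
  then have "Q e p" if "p \<in> S" for p
    using E(2)[of p] that unfolding Q_def by (meson order_less_le_trans)
  ultimately show ?thesis using that[of e] unfolding Q_def by (metis fst_conv snd_conv)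
qed

text \<open>If the ray meets \<open>K\<close> between \<open>y\<close> and its scaled copy, then
  scaling puts \<open>y\<close> into \<open>K\<close>. So either both points lie in
  \<open>K\<close>, or no frontier point separates them. For the frontier claim, an interior image
  point would pull back to a neighbourhood of \<open>y\<close> inside \<open>T\<close>.\<close>

lemma segment_bordered_conic:
  fixes x :: complex
  assumes T: "closed T" and K: "frontier T \<subseteq> K" "K \<subseteq> T"
    and radial: "\<And>y \<tau>. y \<in> K \<Longrightarrow> y \<noteq> x \<Longrightarrow> dist x y < e \<Longrightarrow> 0 < \<tau> \<Longrightarrow>
      dist x (x + \<tau> *\<^sub>R (y - x)) < e \<Longrightarrow> x + \<tau> *\<^sub>R (y - x) \<in> K"
    and y: "y \<noteq> x" "dist x y < e" and \<tau>: "0 < \<tau>" "dist x (x + \<tau> *\<^sub>R (y - x)) < e"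
  shows "y \<in> T \<Longrightarrow> x + \<tau> *\<^sub>R (y - x) \<in> T"
    and "y \<in> frontier T \<Longrightarrow> x + \<tau> *\<^sub>R (y - x) \<in> frontier T"
proof -
  have conic: "x + \<tau> *\<^sub>R (y - x) \<in> T"
    if "y \<in> T" and y: "y \<noteq> x" "dist x y < e" and \<tau>: "0 < \<tau>" "dist x (x + \<tau> *\<^sub>R (y - x)) < e" for y \<tau>
  proof (cases "y \<in> K")
    case True
    then show ?thesis using radial[OF True y \<tau>] K(2) by blast
  next
    case False
    define z where "z = x + \<tau> *\<^sub>R (y - x)"
    have "closed_segment y z \<inter> frontier T = {}"
    proof (rule ccontr)
      assume "closed_segment y z \<inter> frontier T \<noteq> {}"
      then obtain k where k: "k \<in> closed_segment y z" "k \<in> K" using K(1) by blast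
      obtain c where c: "0 \<le> c" "c \<le> 1" "k = (1 - c) *\<^sub>R y + c *\<^sub>R z" using k(1) by (auto simp: in_segment)
      define \<sigma> where "\<sigma> = (1 - c) + c * \<tau>"
      have "\<sigma> > 0" using c(1,2) \<tau>(1) by (cases "c = 1") (auto simp: \<sigma>_def intro!: add_pos_nonneg)
      have kx: "k = x + \<sigma> *\<^sub>R (y - x)" unfolding c(3) z_def \<sigma>_def by (simp add: algebra_simps)
      have "y \<in> ball x e" "z \<in> ball x e" using y(2) \<tau>(2) by (simp_all add: z_def)
      then have "closed_segment y z \<subseteq> ball x e" by (intro closed_segment_subset) auto
      then have "dist x k < e" using k(1) by auto
      moreover have "k \<noteq> x" using kx \<open>\<sigma> > 0\<close> y(1) by simp
      moreover have "x + (1 / \<sigma>) *\<^sub>R (k - x) = y" using kx \<open>\<sigma> > 0\<close> by simp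
      ultimately have "y \<in> K" using radial[OF k(2), of "1 / \<sigma>"] y(2) \<open>\<sigma> > 0\<close> by simp
      then show False using False by simp
    qed
    then have "closed_segment y z \<subseteq> T"
      using connected_Int_frontier[of "closed_segment y z" T] \<open>y \<in> T\<close> by fastforce
    then show ?thesis by (auto simp: z_def)
  qed
  show "y \<in> T \<Longrightarrow> x + \<tau> *\<^sub>R (y - x) \<in> T" using conic y \<tau> by blast
  show "x + \<tau> *\<^sub>R (y - x) \<in> frontier T" if fr: "y \<in> frontier T"
  proof (rule ccontr)
    have "y \<in> T" using fr T frontier_subset_closed by blast
    then have "x + \<tau> *\<^sub>R (y - x) \<in> T" using conic y \<tau> by blast
    moreover assume "x + \<tau> *\<^sub>R (y - x) \<notin> frontier T"
    ultimately have int: "x + \<tau> *\<^sub>R (y - x) \<in> interior T"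
      using T by (simp add: frontier_def)
    define W where "W = (\<lambda>p. x + \<tau> *\<^sub>R (p - x)) -` (interior T \<inter> ball x e) \<inter> (ball x e - {x})"
    have "open ((\<lambda>p. x + \<tau> *\<^sub>R (p - x)) -` (interior T \<inter> ball x e))"
      by (intro open_vimage open_Int open_interior open_ball continuous_intros)
    then have "open W" by (auto simp: W_def open_delete)
    moreover have "W \<subseteq> T"
    proof
      fix p assume p: "p \<in> W"
      define q where "q = x + \<tau> *\<^sub>R (p - x)"
      have q: "q \<in> T" "dist x q < e" "q \<noteq> x" using p \<tau>(1) interior_subset by (auto simp: W_def q_def)
      have "x + (1 / \<tau>) *\<^sub>R (q - x) = p" using \<tau>(1) by (simp add: q_def)
      then show "p \<in> T" using conic[OF q(1,3,2), of "1 / \<tau>"] \<tau>(1) p by (simp add: W_def)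
    qed
    moreover have "y \<in> W" using int y \<tau> by (simp add: W_def)
    ultimately have "y \<in> interior T" by (meson interiorI)
    then show False using fr by (simp add: frontier_def)
  qed
qed

text \<open>Scaling by factors up to one gives the star shape, scaling by arbitrary positive factors
  the dichotomy for rays.\<close>

lemma segment_bordered_star:
  assumes "segment_bordered T"
  obtains e where "e > 0" "\<And>y. y \<in> T \<Longrightarrow> dist x y < e \<Longrightarrow> x \<in> T \<Longrightarrow> closed_segment x y \<subseteq> T"
    "\<And>d. norm d = 1 \<Longrightarrow> (\<forall>r\<in>{0<..<e}. x + r *\<^sub>R d \<in> frontier T) \<or> (\<forall>r\<in>{0<..<e}. x + r *\<^sub>R d \<notin> frontier T)"
proof -
  obtain S where S: "closed T" "finite S" "frontier T \<subseteq> segments_union S" "segments_union S \<subseteq> T"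
    using assms by (auto simp: segment_bordered_def compact_imp_closed)
  obtain e where e: "e > 0" "\<And>a b y \<tau>. (a, b) \<in> S \<Longrightarrow> y \<in> closed_segment a b \<Longrightarrow> y \<noteq> x \<Longrightarrow> dist x y < e \<Longrightarrow>
    0 < \<tau> \<Longrightarrow> dist x (x + \<tau> *\<^sub>R (y - x)) < e \<Longrightarrow>
    x \<in> closed_segment a b \<and> x + \<tau> *\<^sub>R (y - x) \<in> closed_segment a b"
    using segments_union_radial[OF S(2), of x] by blast
  have radial: "x + \<tau> *\<^sub>R (y - x) \<in> segments_union S"
    if "y \<in> segments_union S" "y \<noteq> x" "dist x y < e" "0 < \<tau>" "dist x (x + \<tau> *\<^sub>R (y - x)) < e" for y \<tau>
    using e(2)[OF _ _ that(2-5)] that(1) unfolding segments_union_def by blast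
  note conic = segment_bordered_conic[OF S(1,3,4) radial]
  show ?thesis
  proof (rule that[OF e(1)])
    show "closed_segment x y \<subseteq> T" if y: "y \<in> T" "dist x y < e" "x \<in> T" for y
    proof (cases "y = x")
      case False
      show ?thesis
      proof
        fix z assume "z \<in> closed_segment x y"
        then obtain m where m: "0 \<le> m" "m \<le> 1" "z = x + m *\<^sub>R (y - x)" by (rule closed_segment_param)
        have "dist x z = m * dist x y" using m(1) by (simp add: m(3) dist_norm norm_minus_commute)
        also have "\<dots> \<le> dist x y" using m by (simp add: mult_left_le_one_le)
        finally have "dist x z < e" using y(2) by simp
        then show "z \<in> T" using conic(1)[OF _ _ _ _ _ False y(2)] m y by (cases "m = 0") auto
      qed
    qed (use y in simp)
    show "(\<forall>r\<in>{0<..<e}. x + r *\<^sub>R d \<in> frontier T) \<or> (\<forall>r\<in>{0<..<e}. x + r *\<^sub>R d \<notin> frontier T)"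
      if d: "norm d = 1" for d
    proof (rule ccontr)
      assume "\<not> ?thesis"
      then obtain r s where rs: "r \<in> {0<..<e}" "s \<in> {0<..<e}" "x + r *\<^sub>R d \<in> frontier T" "x + s *\<^sub>R d \<notin> frontier T"
        by blast
      have "r \<noteq> 0" using rs(1) by auto
      then have "x + (s / r) *\<^sub>R ((x + r *\<^sub>R d) - x) = x + s *\<^sub>R d" by simp
      moreover have "x + (s / r) *\<^sub>R ((x + r *\<^sub>R d) - x) \<in> frontier T"
        using rs d by (intro conic(2)) (auto simp: dist_norm)
      ultimately show False using rs(4) by metis
    qed
  qed
qed

text \<open>At a border point outside \<open>V\<close> all bordering segments through it are
  collinear, so near it the border is a full diameter of a disc. On each open half disc membership
  in \<open>T\<close> is constant, so \<open>T\<close> is locally the diameter with none, one or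
  both of the half discs.\<close>

lemma segment_bordered_locally_convex:
  assumes T: "segment_bordered T"
  obtains V where "finite V" "\<And>x. x \<in> T \<Longrightarrow> x \<notin> V \<Longrightarrow>
    \<exists>e>0. \<forall>y\<in>T \<inter> ball x e. \<forall>z\<in>T \<inter> ball x e. closed_segment y z \<subseteq> T"
proof -
  obtain S where S: "closed T" "finite S" "frontier T \<subseteq> segments_union S" "segments_union S \<subseteq> T"
    using assms by (auto simp: segment_bordered_def compact_imp_closed)
  define K where "K = segments_union S"
  define seg where "seg = (\<lambda>p :: complex \<times> complex. closed_segment (fst p) (snd p))"
  have K: "K = (\<Union>p\<in>S. seg p)" by (auto simp: K_def segments_union_def seg_def)
  \<comment> \<open>Ends of segments and isolated crossings. Two segments sharing more than one
    point are collinear and contribute only their ends.\<close>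
  define V where "V = fst ` S \<union> snd ` S \<union> {x. \<exists>p\<in>S. \<exists>q\<in>S. seg p \<inter> seg q = {x}}"
  have "{x. \<exists>p\<in>S. \<exists>q\<in>S. seg p \<inter> seg q = {x}} \<subseteq> (\<lambda>(p, q). the_elem (seg p \<inter> seg q)) ` (S \<times> S)"
  proof
    fix x assume "x \<in> {x. \<exists>p\<in>S. \<exists>q\<in>S. seg p \<inter> seg q = {x}}"
    then obtain p q where pq: "p \<in> S" "q \<in> S" "seg p \<inter> seg q = {x}" by blast
    show "x \<in> (\<lambda>(p, q). the_elem (seg p \<inter> seg q)) ` (S \<times> S)"
      by (rule image_eqI[of _ _ "(p, q)"]) (use pq in auto)
  qed
  then have "finite {x. \<exists>p\<in>S. \<exists>q\<in>S. seg p \<inter> seg q = {x}}"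
    by (rule finite_subset) (intro finite_imageI finite_cartesian_product S(2))
  then have "finite V" using S(2) unfolding V_def by blast
  moreover have "\<exists>e>0. \<forall>y\<in>T \<inter> ball x e. \<forall>z\<in>T \<inter> ball x e. closed_segment y z \<subseteq> T"
    if x: "x \<in> T" "x \<notin> V" for x
  proof (cases "x \<in> K")
    case False
    then have "x \<in> interior T" using x S(1,3) closure_subset by (auto simp: frontier_def K_def)
    then obtain e where e: "e > 0" "ball x e \<subseteq> T" by (auto simp: mem_interior)
    then show ?thesis
    proof (intro exI[of _ e] conjI ballI)
      fix y z assume "y \<in> T \<inter> ball x e" "z \<in> T \<inter> ball x e"
      then have "closed_segment y z \<subseteq> ball x e" by (intro closed_segment_subset convex_ball) auto
      then show "closed_segment y z \<subseteq> T" using e(2) by blast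
    qed
  next
    case True
    then obtain p where p: "p \<in> S" "x \<in> seg p" by (auto simp: K)
    define a b where "a = fst p" and "b = snd p"
    have ab: "(a, b) \<in> S" "x \<in> closed_segment a b" "x \<noteq> a" "x \<noteq> b"
      using p x(2) by (auto simp: a_def b_def seg_def V_def)
    define u where "u = b - a"
    obtain m where m: "0 \<le> m" "m \<le> 1" "x = a + m *\<^sub>R u" using ab(2) unfolding u_def by (rule closed_segment_param)
    have m': "0 < m" "m < 1" using ab(3,4) m by (auto simp: u_def less_le)
    have "u \<noteq> 0" using ab(3) m by auto
    \<comment> \<open>The signed offset from the line through \<open>x\<close> in direction
      \<open>u\<close>, measured in units of \<open>norm u\<close>; it vanishes exactly on that
      line.\<close>
    define h where "h = (\<lambda>y. Im ((y - x) / u))"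
    obtain e where e: "e > 0" "\<And>a b y \<tau>. (a, b) \<in> S \<Longrightarrow> y \<in> closed_segment a b \<Longrightarrow> y \<noteq> x \<Longrightarrow> dist x y < e \<Longrightarrow>
      0 < \<tau> \<Longrightarrow> dist x (x + \<tau> *\<^sub>R (y - x)) < e \<Longrightarrow>
      x \<in> closed_segment a b \<and> x + \<tau> *\<^sub>R (y - x) \<in> closed_segment a b"
      using segments_union_radial[OF S(2), of x] by blast
    have K_iff: "y \<in> K \<longleftrightarrow> h y = 0" if y: "dist x y < e" for y
    proof
      assume "y \<in> K"
      then obtain q where q: "q \<in> S" "y \<in> seg q" by (auto simp: K)
      show "h y = 0"
      proof (cases "y = x")
        case False
        define c d where "c = fst q" and "d = snd q"
        have cd: "(c, d) \<in> S" "y \<in> closed_segment c d" using q by (auto simp: c_def d_def seg_def)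
        then have xq: "x \<in> closed_segment c d" using e(2)[OF cd False y, of 1] y by simp
        then have "x \<in> seg p \<inter> seg q" using p by (simp add: seg_def c_def d_def)
        moreover have "seg p \<inter> seg q \<noteq> {x}" using p(1) q(1) x(2) by (auto simp: V_def)
        ultimately obtain z where z: "z \<noteq> x" "z \<in> closed_segment a b" "z \<in> closed_segment c d"
          unfolding seg_def a_def b_def c_def d_def by blast
        have diff: "\<exists>r::real. v - v' = r *\<^sub>R (d' - c')" if v: "v \<in> closed_segment c' d'" "v' \<in> closed_segment c' d'" for v v' c' d' :: complex
        proof -
          obtain k where "v = c' + k *\<^sub>R (d' - c')" using v(1) by (rule closed_segment_param)
          moreover obtain k' where "v' = c' + k' *\<^sub>R (d' - c')" using v(2) by (rule closed_segment_param)
          ultimately have "v - v' = (k - k') *\<^sub>R (d' - c')" by (simp only: scaleR_diff_left) simp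
          then show ?thesis by blast
        qed
        obtain r1 where r1: "z - x = r1 *\<^sub>R u" using diff[OF z(2) ab(2)] unfolding u_def by blast
        obtain r2 where r2: "z - x = r2 *\<^sub>R (d - c)" using diff[OF z(3) xq] by blast
        obtain r3 where r3: "y - x = r3 *\<^sub>R (d - c)" using diff[OF cd(2) xq] by blast
        have "r2 \<noteq> 0" using r2 z(1) by auto
        then have "d - c = (1 / r2) *\<^sub>R (z - x)" by (simp add: r2)
        then have "y - x = (r3 / r2 * r1) *\<^sub>R u" using r3 r1 by simp
        then show ?thesis using \<open>u \<noteq> 0\<close> by (simp add: h_def scaleR_conv_of_real)
      qed (simp add: h_def)
    next
      assume hy: "h y = 0"
      define c where "c = Re ((y - x) / u)"
      have "(y - x) / u = of_real c" using hy by (simp add: complex_eq_iff c_def h_def)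
      then have yx: "y - x = c *\<^sub>R u" using \<open>u \<noteq> 0\<close> by (simp add: field_simps scaleR_conv_of_real)
      show "y \<in> K"
      proof (cases "c = 0")
        case True
        then show ?thesis using yx \<open>x \<in> K\<close> by simp
      next
        case False
        \<comment> \<open>Nothing yet places \<open>y\<close> between \<open>a\<close> and
          \<open>b\<close>. Shrunk towards \<open>x\<close> by \<open>t\<close> it falls into the
          segment, and the radial property with factor \<open>1 / t\<close> brings it back.\<close>
        define t where "t = min 1 (min ((1 - m) / \<bar>c\<bar>) (m / \<bar>c\<bar>))"
        have t: "0 < t" "t \<le> 1" using m' False by (auto simp: t_def)
        have "t * \<bar>c\<bar> \<le> 1 - m" "t * \<bar>c\<bar> \<le> m"
        proof -
          have "t \<le> (1 - m) / \<bar>c\<bar>" "t \<le> m / \<bar>c\<bar>" by (auto simp: t_def)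
          then show "t * \<bar>c\<bar> \<le> 1 - m" "t * \<bar>c\<bar> \<le> m" using False by (simp_all add: pos_le_divide_eq)
        qed
        moreover have "\<bar>t * c\<bar> = t * \<bar>c\<bar>" using t(1) by (simp add: abs_mult)
        ultimately have tc: "0 \<le> m + t * c" "m + t * c \<le> 1" by linarith+
        define y0 where "y0 = x + t *\<^sub>R (y - x)"
        have "y0 = a + (m + t * c) *\<^sub>R u" unfolding y0_def yx by (simp add: m(3) algebra_simps)
        then have "y0 \<in> closed_segment a b"
          using tc unfolding in_segment u_def by (intro exI[of _ "m + t * c"]) (simp add: algebra_simps)
        moreover have "y0 \<noteq> x" using t False yx \<open>u \<noteq> 0\<close> by (simp add: y0_def)
        moreover have "dist x y0 < e"
        proof -
          have "dist x y0 = t * dist x y" using t(1) by (simp add: y0_def dist_norm norm_minus_commute)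
          also have "\<dots> \<le> dist x y" using t by (simp add: mult_left_le_one_le)
          finally show ?thesis using y by simp
        qed
        moreover have "x + (1 / t) *\<^sub>R (y0 - x) = y" using t(1) by (simp add: y0_def)
        ultimately have "y \<in> closed_segment a b" using e(2)[OF ab(1), of y0 "1 / t"] y t(1) by simp
        then show ?thesis using ab(1) by (auto simp: K_def segments_union_def)
      qed
    qed
    have h_lin: "h ((1 - c) *\<^sub>R y + c *\<^sub>R z) = (1 - c) * h y + c * h z" for c y z
    proof -
      have "((1 - c) *\<^sub>R y + c *\<^sub>R z - x) / u = (1 - c) *\<^sub>R ((y - x) / u) + c *\<^sub>R ((z - x) / u)"
        using \<open>u \<noteq> 0\<close> by (simp add: field_simps scaleR_conv_of_real)
      then show ?thesis by (simp add: h_def)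
    qed
    \<comment> \<open>Between two points strictly on the same side \<open>h\<close> has no zero, so
      no border is met and membership in \<open>T\<close> cannot change.\<close>
    have side: "q \<in> T" if y: "y \<in> T" "dist x y < e" and q: "dist x q < e" and hq: "h y * h q > 0" for y q
    proof -
      have "closed_segment y q \<inter> frontier T = {}"
      proof (rule ccontr)
        assume "closed_segment y q \<inter> frontier T \<noteq> {}"
        then obtain k where k: "k \<in> closed_segment y q" "k \<in> K" using S(3) by (auto simp: K_def)
        have "closed_segment y q \<subseteq> ball x e" using y q by (intro closed_segment_subset) auto
        then have "h k = 0" using K_iff[of k] k by auto
        moreover obtain c where c: "0 \<le> c" "c \<le> 1" "k = (1 - c) *\<^sub>R y + c *\<^sub>R q" using k(1) by (auto simp: in_segment)
        ultimately have "(1 - c) * h y + c * h q = 0" using h_lin by simp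
        then have "((1 - c) * h y + c * h q) * h y = 0" by simp
        then have "(1 - c) * (h y)\<^sup>2 + c * (h y * h q) = 0" by (simp add: power2_eq_square algebra_simps)
        moreover have "h y \<noteq> 0" using hq by auto
        then have "(1 - c) * (h y)\<^sup>2 \<ge> 0" "c * (h y * h q) \<ge> 0" "(1 - c) * (h y)\<^sup>2 + c * (h y * h q) > 0"
          using c hq by (auto intro!: mult_nonneg_nonneg) (cases "c = 1"; auto intro!: add_pos_nonneg)
        ultimately show False by simp
      qed
      then have "closed_segment y q \<subseteq> T"
        using connected_Int_frontier[of "closed_segment y q" T] y(1) by fastforce
      then show ?thesis by auto
    qed
    have "closed_segment y z \<subseteq> T" if yz: "y \<in> T \<inter> ball x e" "z \<in> T \<inter> ball x e" for y z
    proof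
      fix q assume q: "q \<in> closed_segment y z"
      have "closed_segment y z \<subseteq> ball x e" using yz by (intro closed_segment_subset) auto
      then have qe: "dist x q < e" using q by auto
      obtain c where c: "0 \<le> c" "c \<le> 1" "q = (1 - c) *\<^sub>R y + c *\<^sub>R z" using q by (auto simp: in_segment)
      then have hq: "h q = (1 - c) * h y + c * h z" using h_lin by simp
      show "q \<in> T"
      proof (cases "h q = 0")
        case True
        then show ?thesis using K_iff[OF qe] S(4) by (auto simp: K_def)
      next
        case False
        \<comment> \<open>\<open>h q\<close> is a convex combination of \<open>h y\<close> and
          \<open>h z\<close>, so one of these has its sign, and \<open>q\<close> inherits membership
          from that point.\<close>
        then have "0 < h q * h q" by (metis not_real_square_gt_zero)
        also have "h q * h q = (1 - c) * (h y * h q) + c * (h z * h q)"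
          by (subst (1) hq) (simp add: algebra_simps)
        finally have "h y * h q > 0 \<or> h z * h q > 0"
          using c(1,2) by (smt (verit) mult_nonneg_nonpos)
        then show ?thesis using side[of y q] side[of z q] yz qe by auto
      qed
    qed
    then show ?thesis using e(1) by blast
  qed
  ultimately show ?thesis using that by blast
qed

lemma segment_bordered_tame:
  assumes "segment_bordered T"
  obtains V where "tame_domain T V"
proof -
  obtain V where V: "finite V" "\<And>x. x \<in> T \<Longrightarrow> x \<notin> V \<Longrightarrow>
      \<exists>e>0. \<forall>y\<in>T \<inter> ball x e. \<forall>z\<in>T \<inter> ball x e. closed_segment y z \<subseteq> T"
    using segment_bordered_locally_convex[OF assms] by blast
  have "tame_domain T V"
  proof
    show "compact T" "connected T" using assms by (auto simp: segment_bordered_def)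
    show "\<exists>e>0. \<forall>y\<in>T \<inter> ball x e. closed_segment x y \<subseteq> T" if "x \<in> T" for x
    proof (rule segment_bordered_star[OF assms, of x])
      fix e :: real assume "e > 0" "\<And>y. y \<in> T \<Longrightarrow> dist x y < e \<Longrightarrow> x \<in> T \<Longrightarrow> closed_segment x y \<subseteq> T"
      then show ?thesis using that by (intro exI[of _ e]) auto
    qed
    show "\<exists>e>0. \<forall>d. norm d = 1 \<longrightarrow> (\<forall>r\<in>{0<..<e}. x + r *\<^sub>R d \<in> frontier T) \<or>
        (\<forall>r\<in>{0<..<e}. x + r *\<^sub>R d \<notin> frontier T)" if "x \<in> T" for x
      by (rule segment_bordered_star[OF assms, of x]) blast
  qed (use V in auto)
  then show ?thesis using that by blast
qed

section \<open>Polygons and terrains\<close>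

lemma path_image_polyline:
  assumes "xs \<noteq> []"
  obtains S where "finite S" "path_image (polyline xs) = segments_union S"
proof -
  have "\<exists>S. finite S \<and> path_image (polyline xs) = segments_union S"
    using assms
  proof (induction xs rule: polyline.induct)
    case (2 a)
    then show ?case by (intro exI[of _ "{(a, a)}"]) (simp add: segments_union_def)
  next
    case (3 a b)
    then show ?case by (intro exI[of _ "{(a, b)}"]) (simp add: segments_union_def)
  next
    case (4 a b c xs)
    then obtain S where "finite S" "path_image (polyline (b # c # xs)) = segments_union S" by auto
    then show ?case
      by (intro exI[of _ "insert (a, b) S"]) (simp add: path_image_polyline_Cons segments_union_def del: polyline.simps)
  qed simp
  then show ?thesis using that by blast
qed

lemma polygon_curve_props:
  assumes "polygon_curve g"
  shows "simple_path g" "pathfinish g = pathstart g"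
    and "\<exists>S. finite S \<and> path_image g = segments_union S"
proof -
  obtain vs where vs: "length vs \<ge> 3" "g = polyline (vs @ [hd vs])" "simple_path g"
    using assms by (auto simp: polygon_curve_def)
  have "vs \<noteq> []" using vs(1) by auto
  show "simple_path g" by fact
  show "pathfinish g = pathstart g" using polyline_ends[of "vs @ [hd vs]"] \<open>vs \<noteq> []\<close> by (simp add: vs(2))
  show "\<exists>S. finite S \<and> path_image g = segments_union S"
    unfolding vs(2) by (rule path_image_polyline[of "vs @ [hd vs]"]) auto
qed

text \<open>By the Jordan curve theorem a closed polygon is the closure of a connected open set.
  Obstacles are removed one at a time: an open obstacle misses the closure of every obstacle
  disjoint from it, so the next one still has its whole closure in what is left, and its connected
  boundary holds the rest together.\<close>

lemma terrain_segment_bordered: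
  assumes "terrain T"
  shows "segment_bordered T"
proof -
  obtain P0 \<O> where P0: "closed_polygon P0" and \<O>: "finite \<O>" "\<And>P. P \<in> \<O> \<Longrightarrow> open_polygon P \<and> P \<subseteq> P0"
      "pairwise disjnt \<O>" and T: "T = P0 - \<Union>\<O>"
    using assms by (auto simp: terrain_def)
  obtain g where g: "polygon_curve g" "P0 = path_image g \<union> inside (path_image g)"
    using P0 by (auto simp: closed_polygon_def)
  note J = Jordan_inside_outside[OF polygon_curve_props(1,2)[OF g(1)]]
  have P0_closure: "P0 = closure (inside (path_image g))"
    unfolding g(2) closure_Un_frontier using J by auto
  have "closed P0" "connected P0" "compact P0"
    unfolding P0_closure using J by (simp_all add: connected_imp_connected_closure)
  have frP0: "frontier P0 \<subseteq> path_image g"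
  proof -
    have "frontier P0 = closure (inside (path_image g)) - interior P0"
      using \<open>closed P0\<close> P0_closure by (simp add: frontier_def)
    moreover have "inside (path_image g) \<subseteq> interior P0" using J g(2) by (intro interior_maximal) auto
    ultimately show ?thesis unfolding P0_closure[symmetric] g(2) by blast
  qed
  have P: "open P" "closure P \<subseteq> P0" "connected (frontier P)" "frontier P \<inter> P = {}"
    "\<exists>S. finite S \<and> frontier P = segments_union S" if PO: "P \<in> \<O>" for P
  proof -
    obtain h where h: "polygon_curve h" "P = inside (path_image h)" using \<O>(2)[OF PO] by (auto simp: open_polygon_def)
    note J' = Jordan_inside_outside[OF polygon_curve_props(1,2)[OF h(1)]]
    show "open P" using J' h by simp
    then show "frontier P \<inter> P = {}" by (simp add: frontier_disjoint_eq)
    show "closure P \<subseteq> P0" using \<O>(2)[OF PO] \<open>closed P0\<close> by (simp add: closure_minimal)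
    have fr: "frontier P = path_image h" using J' h by simp
    show "connected (frontier P)"
      unfolding fr using polygon_curve_props(1)[OF h(1)] by (intro connected_path_image simple_path_imp_path)
    show "\<exists>S. finite S \<and> frontier P = segments_union S" unfolding fr by (rule polygon_curve_props(3)[OF h(1)])
  qed
  have disj: "closure P \<inter> Q = {}" if "P \<in> \<O>" "Q \<in> \<O>" "P \<noteq> Q" for P Q
    using open_Int_closure_eq_empty[OF P(1)[OF that(2)], of P] \<O>(3) that by (auto simp: pairwise_def disjnt_def)
  have "connected (P0 - \<Union>F)" if "F \<subseteq> \<O>" for F
    using finite_subset[OF that \<O>(1)] that
  proof (induction F rule: finite_induct)
    case empty
    then show ?case using \<open>connected P0\<close> by simp
  next
    case (insert P F)
    have "connected ((P0 - \<Union>F) - P)"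
    proof (rule connected_diff_open_from_closed[of P "closure P"])
      have "Q \<inter> closure P = {}" if "Q \<in> F" for Q
        using disj[of P Q] insert(2,4) that by blast
      then show "closure P \<subseteq> P0 - \<Union>F" using P(2)[of P] insert(4) by blast
      have "closure P - P = frontier P" using P(1)[of P] insert(4) by (simp add: frontier_def interior_open)
      then show "connected (closure P - P)" using P(3)[of P] insert(4) by simp
    qed (use insert P(1)[of P] closure_subset in auto)
    moreover have "P0 - \<Union>F - P = P0 - \<Union>(insert P F)" by auto
    ultimately show ?case by simp
  qed
  then have "connected T" unfolding T by blast
  moreover have "compact T"
    unfolding T by (intro compact_diff \<open>compact P0\<close> open_Union) (use P(1) in blast)
  moreover have "\<exists>S. finite S \<and> frontier T \<subseteq> segments_union S \<and> segments_union S \<subseteq> T"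
  proof -
    obtain S0 where S0: "finite S0" "path_image g = segments_union S0" using polygon_curve_props(3)[OF g(1)] by blast
    obtain SP where SP: "\<And>P. P \<in> \<O> \<Longrightarrow> finite (SP P) \<and> frontier P = segments_union (SP P)"
      using P(5) by metis
    define S where "S = S0 \<union> (\<Union>P\<in>\<O>. SP P)"
    have S: "segments_union S = path_image g \<union> (\<Union>P\<in>\<O>. frontier P)"
      using SP S0(2) unfolding S_def segments_union_def by auto
    have "frontier T \<subseteq> frontier P0 \<union> frontier (\<Union>\<O>)"
      unfolding T Diff_eq using frontier_Int_subset[of P0 "- \<Union>\<O>"] by simp
    also have "\<dots> \<subseteq> segments_union S"
      unfolding S using frP0 frontier_Union_subset[OF \<O>(1)] by blast
    finally have "frontier T \<subseteq> segments_union S" .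
    \<comment> \<open>An obstacle is open and avoids the outside, hence also the closure of the
      outside, which contains the outer curve.\<close>
    moreover have "path_image g \<inter> P = {}" if "P \<in> \<O>" for P
    proof -
      have "outside (path_image g) \<inter> P0 = {}" unfolding g(2) using J outside_no_overlap by blast
      then have "P \<inter> outside (path_image g) = {}" using \<O>(2)[OF that] by blast
      then have "P \<inter> closure (outside (path_image g)) = {}" using open_Int_closure_eq_empty[OF P(1)[OF that]] by blast
      moreover have "path_image g \<subseteq> closure (outside (path_image g))" using J by (auto simp: frontier_def)
      ultimately show ?thesis by blast
    qed
    moreover have "frontier P \<subseteq> P0" "frontier P \<inter> Q = {}" if "P \<in> \<O>" "Q \<in> \<O>" for P Q
      using P(2,4)[OF that(1)] disj[OF that] by (auto simp: frontier_def)
    ultimately have "segments_union S \<subseteq> T"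
      unfolding S T using g(2) by blast
    then show ?thesis using \<open>frontier T \<subseteq> segments_union S\<close> S0(1) SP \<O>(1) by (intro exI[of _ S]) (auto simp: S_def)
  qed
  ultimately show ?thesis by (simp add: segment_bordered_def)
qed

section \<open>Similarities and the maps of the agents\<close>

text \<open>With complex coefficients this is exactly an orientation-preserving similarity;
  \<open>to_map F\<close> and \<open>from_map F\<close> are both instances.\<close>

locale similarity =
  fixes f :: "complex \<Rightarrow> complex" and \<alpha> \<beta> :: complex
  assumes f_eq: "f z = \<alpha> * z + \<beta>" and nonzero: "\<alpha> \<noteq> 0"
begin

lemma inj: "inj f"
  using nonzero by (auto intro: injI simp: f_eq)

lemma dist_f: "dist (f x) (f y) = norm \<alpha> * dist x y"
  by (simp add: f_eq dist_norm norm_mult[symmetric] algebra_simps)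

lemma f_affine: "f ((1 - u) *\<^sub>R x + u *\<^sub>R y) = (1 - u) *\<^sub>R f x + u *\<^sub>R f y"
  by (simp add: f_eq scaleR_conv_of_real algebra_simps)

lemma closed_segment_f: "closed_segment (f a) (f b) = f ` closed_segment a b"
  unfolding closed_segment_image_interval image_image by (simp add: f_affine)

lemma open_segment_f: "open_segment (f a) (f b) = f ` open_segment a b"
  unfolding open_segment_def closed_segment_f using inj by (auto simp: image_set_diff inj_def)

lemma continuous_on_f: "continuous_on S f"
  unfolding f_eq[abs_def] by (intro continuous_intros)

lemma frontier_f: "frontier (f ` S) = f ` frontier S"
proof -
  have lin: "linear ((*) \<alpha>)" "inj ((*) \<alpha>)"
    using nonzero by (auto intro!: linearI injI simp: algebra_simps)
  have f: "f ` A = (+) \<beta> ` (*) \<alpha> ` A" for A by (auto simp: f_eq image_iff)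
  have "closure (f ` S) = f ` closure S" "interior (f ` S) = f ` interior S"
    unfolding f closure_translation interior_translation
    using lin by (simp_all add: closure_injective_linear_image interior_injective_linear_image)
  then show ?thesis by (simp add: frontier_def image_set_diff[OF inj])
qed

lemma segment_bordered_f:
  assumes "segment_bordered T"
  shows "segment_bordered (f ` T)"
proof -
  obtain S where S: "finite S" "frontier T \<subseteq> segments_union S" "segments_union S \<subseteq> T"
    using assms by (auto simp: segment_bordered_def)
  have "segments_union ((\<lambda>(a, b). (f a, f b)) ` S) = f ` segments_union S"
    by (auto simp: segments_union_def closed_segment_f image_UN)
  moreover have "compact (f ` T)" "connected (f ` T)"
    using assms continuous_on_f
    by (auto simp: segment_bordered_def intro: compact_continuous_image connected_continuous_image)
  ultimately show ?thesis
    unfolding segment_bordered_def frontier_f using S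
    by (intro conjI exI[of _ "(\<lambda>(a, b). (f a, f b)) ` S"]) auto
qed

text \<open>Images of chains are chains, which gives one inequality; \<open>gdist_to_map\<close>
  gets the other from the inverse map, again a similarity.\<close>

lemma gdist_f_le:
  assumes "star_space T" "x \<in> T" "y \<in> T"
  shows "gdist (f ` T) (f x) (f y) \<le> norm \<alpha> * gdist T x y"
proof (rule field_le_epsilon)
  fix e :: real assume "e > 0"
  then have "e / norm \<alpha> > 0" using nonzero by simp
  then obtain xs where xs: "poly_chain T x y xs" "chain_length xs < gdist T x y + e / norm \<alpha>"
    using star_space.gdist_approx[OF assms] by blast
  have "gdist (f ` T) (f x) (f y) \<le> chain_length (map f xs)"
    by (rule gdist_lower[OF poly_chain_affine_image[OF xs(1) closed_segment_f]])
  also have "\<dots> = norm \<alpha> * chain_length xs" by (rule chain_length_map_similarity[OF dist_f])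
  also have "\<dots> \<le> norm \<alpha> * (gdist T x y + e / norm \<alpha>)" using xs(2) by (intro mult_left_mono) auto
  also have "\<dots> = norm \<alpha> * gdist T x y + e" using nonzero by (simp add: distrib_left)
  finally show "gdist (f ` T) (f x) (f y) \<le> norm \<alpha> * gdist T x y + e" .
qed

lemma polyline_f: "xs \<noteq> [] \<Longrightarrow> polyline (map f xs) = f \<circ> polyline xs"
proof (induction xs rule: polyline.induct)
  case (4 a b c xs)
  have "linepath (f a) (f b) = f \<circ> linepath a b"
    by (rule ext) (simp add: linepath_def f_affine)
  then show ?case
    using 4 by (simp only: polyline.simps list.map path_compose_join list.distinct simp_thms)
qed (auto simp: linepath_def f_affine)

lemma arc_polyline_f: "xs \<noteq> [] \<Longrightarrow> arc (polyline xs) \<Longrightarrow> arc (polyline (map f xs))"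
  using inj by (auto simp: polyline_f arc_def path_continuous_image continuous_on_f
      intro: comp_inj_on inj_on_subset)

lemma route_f:
  assumes "route T a rs"
  shows "route (f ` T) (f a) (map f rs)"
proof -
  have "route_step (f ` T) (f x) (f y)" if "route_step T x y" for x y
    using that image_Int[OF inj, of "open_segment x y" "frontier T"]
    unfolding route_step_def closed_segment_f open_segment_f frontier_f
    by (metis image_empty image_mono)
  then show ?thesis
    using assms unfolding route_def successively_map
    by (auto simp: hd_map intro: successively_mono)
qed

end

lemma to_map_similarity:
  assumes "valid_frame F"
  shows "similarity (to_map F) (\<i> / (of_real (len_unit F) * north F))
    (- (\<i> / (of_real (len_unit F) * north F)) * map_origin F)"
  using assms by unfold_locales (auto simp: to_map_def valid_frame_def right_diff_distrib diff_divide_distrib)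

lemma from_map_similarity:
  assumes "valid_frame F"
  shows "similarity (from_map F) (of_real (len_unit F) * north F / \<i>) (map_origin F)"
  using assms by unfold_locales (auto simp: from_map_def valid_frame_def)

lemma from_map_to_map: "valid_frame F \<Longrightarrow> from_map F (to_map F z) = z"
  by (auto simp: from_map_def to_map_def valid_frame_def)

lemma gdist_to_map:
  assumes T: "segment_bordered T" and F: "valid_frame F" and xy: "x \<in> T" "y \<in> T"
  shows "len_unit F * gdist (to_map F ` T) (to_map F x) (to_map F y) = gdist T x y"
proof -
  interpret fwd: similarity "to_map F" "\<i> / (of_real (len_unit F) * north F)"
    "- (\<i> / (of_real (len_unit F) * north F)) * map_origin F"
    by (rule to_map_similarity[OF F])
  interpret bwd: similarity "from_map F" "of_real (len_unit F) * north F / \<i>" "map_origin F"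
    by (rule from_map_similarity[OF F])
  have star: "star_space S" if "segment_bordered S" for S
    using segment_bordered_tame[OF that] by (meson planar_star_space_def tame_domain_def)
  have l: "len_unit F > 0" "norm (north F) = 1" using F by (auto simp: valid_frame_def)
  have "gdist (to_map F ` T) (to_map F x) (to_map F y) \<le> (1 / len_unit F) * gdist T x y"
    using fwd.gdist_f_le[OF star[OF T] xy] l by (simp add: norm_divide norm_mult)
  then have "len_unit F * gdist (to_map F ` T) (to_map F x) (to_map F y) \<le> gdist T x y"
    using l by (simp add: field_simps)
  moreover have "from_map F ` to_map F ` T = T" using F by (simp add: image_image from_map_to_map)
  then have "gdist T x y \<le> len_unit F * gdist (to_map F ` T) (to_map F x) (to_map F y)"
    using bwd.gdist_f_le[OF star[OF fwd.segment_bordered_f[OF T]], of "to_map F x" "to_map F y"] xy l F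
    by (simp add: norm_divide norm_mult from_map_to_map)
  ultimately show ?thesis by simp
qed

text \<open>Scale and origin of the map cancel, so the order depends on \<open>north F\<close>
  alone; with coherent compasses the two agents agree on who waits.\<close>

lemma precedes_to_map:
  assumes "valid_frame F"
  shows "precedes (to_map F x) (to_map F y) \<longleftrightarrow> precedes (\<i> * x / north F) (\<i> * y / north F)"
proof -
  have l: "len_unit F > 0" using assms by (simp add: valid_frame_def)
  define c where "c = \<i> * map_origin F / north F / of_real (len_unit F)"
  have "to_map F z = \<i> * z / north F / of_real (len_unit F) - c" for z
    unfolding to_map_def c_def by (simp only: right_diff_distrib diff_divide_distrib divide_divide_eq_left mult.commute)
  then have "Re (to_map F z) = Re (\<i> * z / north F) / len_unit F - Re c"
    "Im (to_map F z) = Im (\<i> * z / north F) / len_unit F - Im c" for z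
    by (simp_all only: minus_complex.sel Re_divide_of_real Im_divide_of_real)
  then show ?thesis
    using l by (simp only: precedes_def) (simp add: divide_less_cancel)
qed

lemma precedes_total: "a \<noteq> b \<Longrightarrow> precedes a b \<or> precedes b a"
  by (auto simp: precedes_def complex_eq_iff)

lemma precedes_asym: "precedes a b \<Longrightarrow> \<not> precedes b a"
  by (auto simp: precedes_def)

lemma agent_routes_inert:
  assumes "valid_frame F" "precedes (to_map F own) (to_map F other)"
  shows "agent_routes RVCM T F own other = {[own]}"
  using assms by (simp add: agent_routes_def RVCM_def from_map_to_map)

text \<open>\<open>UniquePath\<close> is evaluated on the map, so \<open>tame_domain\<close> is
  interpreted there. Carrying the route back multiplies its length by \<open>len_unit F\<close>,
  which is also the ratio of the two distances.\<close>

lemma agent_routes_moving: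
  assumes T: "segment_bordered T" and F: "valid_frame F" and pts: "own \<in> T" "other \<in> T" "own \<noteq> other"
    and not_first: "\<not> precedes (to_map F own) (to_map F other)"
  shows "agent_routes RVCM T F own other \<noteq> {}"
    and "rs \<in> agent_routes RVCM T F own other \<Longrightarrow> route T own rs \<and> last rs = other \<and>
      arc (polyline rs) \<and> chain_length rs = gdist T own other"
proof -
  interpret fwd: similarity "to_map F" "\<i> / (of_real (len_unit F) * north F)"
    "- (\<i> / (of_real (len_unit F) * north F)) * map_origin F"
    by (rule to_map_similarity[OF F])
  interpret bwd: similarity "from_map F" "of_real (len_unit F) * north F / \<i>" "map_origin F"
    by (rule from_map_similarity[OF F])
  obtain V where "tame_domain (to_map F ` T) V"
    using segment_bordered_tame[OF fwd.segment_bordered_f[OF T]] .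
  then interpret tame_domain "to_map F ` T" V .
  have "to_map F own \<noteq> to_map F other" using pts(3) fwd.inj by (auto dest: injD)
  then obtain p where p: "UniquePath (to_map F ` T) (to_map F own) (to_map F other) = Some p"
    "routes_along (to_map F ` T) p (to_map F own) (to_map F other) \<noteq> {}"
    "\<And>rs. rs \<in> routes_along (to_map F ` T) p (to_map F own) (to_map F other) \<Longrightarrow>
      chain_length rs = gdist (to_map F ` T) (to_map F own) (to_map F other)"
    using routes_along_UniquePath[of "to_map F own" "to_map F other"] pts(1,2) by blast
  have routes: "agent_routes RVCM T F own other =
      map (from_map F) ` routes_along (to_map F ` T) p (to_map F own) (to_map F other)"
    using not_first p(1) by (simp add: agent_routes_def RVCM_def)
  then show "agent_routes RVCM T F own other \<noteq> {}" using p(2) by simp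
  assume "rs \<in> agent_routes RVCM T F own other"
  then obtain rs' where rs': "rs = map (from_map F) rs'"
    "rs' \<in> routes_along (to_map F ` T) p (to_map F own) (to_map F other)"
    using routes by blast
  then have r: "route (to_map F ` T) (to_map F own) rs'" "last rs' = to_map F other" "arc (polyline rs')"
    by (auto simp: routes_along_def)
  then have ne: "rs' \<noteq> []" by (simp add: route_def)
  have "chain_length rs = len_unit F * chain_length rs'"
    using chain_length_map_similarity[OF bwd.dist_f, of rs'] F
    by (simp add: rs'(1) valid_frame_def norm_divide norm_mult)
  then have "chain_length rs = gdist T own other"
    using p(3)[OF rs'(2)] gdist_to_map[OF T F pts(1,2)] by simp
  moreover have "route T own rs"
    using bwd.route_f[OF r(1)] F by (simp add: rs'(1) image_image from_map_to_map)
  moreover have "last rs = other" using r(2) ne F by (simp add: rs'(1) last_map from_map_to_map)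
  moreover have "arc (polyline rs)" unfolding rs'(1) by (rule bwd.arc_polyline_f[OF ne r(3)])
  ultimately show "route T own rs \<and> last rs = other \<and> arc (polyline rs) \<and> chain_length rs = gdist T own other"
    by blast
qed

section \<open>Rendezvous and cost\<close>

lemma execution_costsI:
  assumes "r1 \<in> routes1 alg \<sigma>" "r2 \<in> routes2 alg \<sigma>" "walk r1 ts1 f1" "walk r2 ts2 f2" "first_meeting f1 f2 t"
  shows "trajectory_length r1 ts1 f1 t + trajectory_length r2 ts2 f2 t \<in> execution_costs alg \<sigma>"
  unfolding execution_costs_def using assms by blast

text \<open>The cost is exact and not merely bounded: at any meeting the mover stands at the end of
  its arc, so every execution costs the full length, and \<open>walk_exists\<close> provides an
  execution.\<close>

lemma RVCM_scenario:
  assumes \<sigma>: "valid_scenario \<sigma>" "coherent_compasses \<sigma>"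
  shows "guarantees_rendezvous RVCM \<sigma> \<and> execution_costs RVCM \<sigma> = {start_dist \<sigma>}"
proof -
  define T x y where "T = ground \<sigma>" and "x = start1 \<sigma>" and "y = start2 \<sigma>"
  define F G where "F = frame1 \<sigma>" and "G = frame2 \<sigma>"
  note defs = T_def x_def y_def F_def G_def
  have T: "segment_bordered T" and xy: "x \<in> T" "y \<in> T" "x \<noteq> y" and FG: "valid_frame F" "valid_frame G"
    and north: "north F = north G"
    using \<sigma> terrain_segment_bordered by (auto simp: valid_scenario_def coherent_compasses_def defs)
  obtain V where "tame_domain T V" using segment_bordered_tame[OF T] .
  then interpret tame_domain T V .
  have D: "start_dist \<sigma> = gdist T x y"
    using terrain_dist_eq_gdist xy by (simp add: start_dist_def defs)
  have r1: "routes1 RVCM \<sigma> = agent_routes RVCM T F x y" and r2: "routes2 RVCM \<sigma> = agent_routes RVCM T G y x"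
    by (simp_all add: routes1_def routes2_def defs)
  have inert_route: "route T a [a]" if "a \<in> T" for a using that by (simp add: route_def)
  have len2: "2 \<le> length rs" if "route T a rs" "last rs = b" "a \<noteq> b" for rs a b
    using that by (cases rs rule: remdups_adj.cases) (auto simp: route_def)
  have prec: "precedes (to_map F a) (to_map F b) \<longleftrightarrow> precedes (to_map G a) (to_map G b)" for a b
    using precedes_to_map FG north by simp
  have "to_map F x \<noteq> to_map F y" using xy(3) from_map_to_map[OF FG(1)] by metis
  then consider "precedes (to_map F x) (to_map F y)" "\<not> precedes (to_map G y) (to_map G x)"
    | "\<not> precedes (to_map F x) (to_map F y)" "precedes (to_map G y) (to_map G x)"
    using precedes_total precedes_asym prec by blast
  then show ?thesis
  proof cases
    case 1
    have R1: "routes1 RVCM \<sigma> = {[x]}" unfolding r1 by (rule agent_routes_inert[OF FG(1) 1(1)])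
    note moving = agent_routes_moving[OF T FG(2) xy(2,1) xy(3)[symmetric] 1(2), folded r2]
    have "\<exists>t. meet_at f1 f2 t" if w: "walk [x] ts1 f1" "rs \<in> routes2 RVCM \<sigma>" "walk rs ts2 f2" for ts1 f1 rs ts2 f2
    proof -
      obtain t where "0 \<le> t" "f2 t = last rs" using walk_reaches_end[OF w(3)] .
      then show ?thesis using moving(2)[OF w(2)] walk_inert[OF w(1)] by (auto simp: meet_at_def)
    qed
    then have "guarantees_rendezvous RVCM \<sigma>"
      unfolding guarantees_rendezvous_def R1
      using moving inert_route xy by (auto simp: defs[symmetric])
    moreover have "execution_costs RVCM \<sigma> \<subseteq> {gdist T x y}"
    proof
      fix c assume "c \<in> execution_costs RVCM \<sigma>"
      then obtain rs ts1 ts2 f1 f2 t where c: "c = trajectory_length [x] ts1 f1 t + trajectory_length rs ts2 f2 t"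
        "rs \<in> routes2 RVCM \<sigma>" "walk [x] ts1 f1" "walk rs ts2 f2" "first_meeting f1 f2 t"
        unfolding execution_costs_def R1 by blast
      then have "0 \<le> t" "f2 t = last rs"
        using walk_inert[OF c(3)] moving(2)[OF c(2)] by (auto simp: first_meeting_def meet_at_def)
      then show "c \<in> {gdist T x y}"
        using trajectory_length_complete[of rs ts2 f2 t] moving(2)[OF c(2)] c(1,4) gdist_sym[of T]
        by (simp add: trajectory_length_inert)
    qed
    moreover have "execution_costs RVCM \<sigma> \<noteq> {}"
    proof -
      obtain rs where rs: "rs \<in> routes2 RVCM \<sigma>" using moving(1) by blast
      then have m: "route T y rs" "last rs = x" "arc (polyline rs)" using moving(2) by auto
      obtain ts f t where w: "walk rs ts f" "0 \<le> t" "f t = last rs" "\<And>s. 0 \<le> s \<Longrightarrow> s < t \<Longrightarrow> f s \<noteq> last rs"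
        using walk_exists[OF m(3) len2[OF m(1,2) xy(3)[symmetric]]] by blast
      then have "first_meeting (\<lambda>_. x) f t" using m(2) unfolding first_meeting_def meet_at_def by metis
      with R1 have "trajectory_length [x] [0] (\<lambda>_. x) t + trajectory_length rs ts f t \<in> execution_costs RVCM \<sigma>"
        by (intro execution_costsI rs walk_inert_exists w(1)) auto
      then show ?thesis by auto
    qed
    ultimately show ?thesis unfolding D by (metis subset_singletonD)
  next
    case 2
    have R2: "routes2 RVCM \<sigma> = {[y]}" unfolding r2 by (rule agent_routes_inert[OF FG(2) 2(2)])
    note moving = agent_routes_moving[OF T FG(1) xy 2(1), folded r1]
    have "\<exists>t. meet_at f1 f2 t" if w: "walk [y] ts2 f2" "rs \<in> routes1 RVCM \<sigma>" "walk rs ts1 f1" for ts1 f1 rs ts2 f2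
    proof -
      obtain t where "0 \<le> t" "f1 t = last rs" using walk_reaches_end[OF w(3)] .
      then show ?thesis using moving(2)[OF w(2)] walk_inert[OF w(1)] by (auto simp: meet_at_def)
    qed
    then have "guarantees_rendezvous RVCM \<sigma>"
      unfolding guarantees_rendezvous_def R2
      using moving inert_route xy by (auto simp: defs[symmetric])
    moreover have "execution_costs RVCM \<sigma> \<subseteq> {gdist T x y}"
    proof
      fix c assume "c \<in> execution_costs RVCM \<sigma>"
      then obtain rs ts1 ts2 f1 f2 t where c: "c = trajectory_length rs ts1 f1 t + trajectory_length [y] ts2 f2 t"
        "rs \<in> routes1 RVCM \<sigma>" "walk [y] ts2 f2" "walk rs ts1 f1" "first_meeting f1 f2 t"
        unfolding execution_costs_def R2 by blast
      then have "0 \<le> t" "f1 t = last rs"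
        using walk_inert[OF c(3)] moving(2)[OF c(2)] by (auto simp: first_meeting_def meet_at_def)
      then show "c \<in> {gdist T x y}"
        using trajectory_length_complete[of rs ts1 f1 t] moving(2)[OF c(2)] c(1,4)
        by (simp add: trajectory_length_inert)
    qed
    moreover have "execution_costs RVCM \<sigma> \<noteq> {}"
    proof -
      obtain rs where rs: "rs \<in> routes1 RVCM \<sigma>" using moving(1) by blast
      then have m: "route T x rs" "last rs = y" "arc (polyline rs)" using moving(2) by auto
      obtain ts f t where w: "walk rs ts f" "0 \<le> t" "f t = last rs" "\<And>s. 0 \<le> s \<Longrightarrow> s < t \<Longrightarrow> f s \<noteq> last rs"
        using walk_exists[OF m(3) len2[OF m(1,2) xy(3)]] by blast
      then have "first_meeting f (\<lambda>_. y) t" using m(2) unfolding first_meeting_def meet_at_def by metis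
      with R2 have "trajectory_length rs ts f t + trajectory_length [y] [0] (\<lambda>_. y) t \<in> execution_costs RVCM \<sigma>"
        by (intro execution_costsI rs walk_inert_exists w(1)) auto
      then show ?thesis by auto
    qed
    ultimately show ?thesis unfolding D by (metis subset_singletonD)
  qed
qed

text \<open>A right isosceles triangle with legs \<open>D\<close> as terrain and the ends of one leg
  as starting points. It guards against an empty class of scenarios, whose supremum would be
  \<open>-\<infinity>\<close>.\<close>

lemma scenario_exists:
  assumes "D > 0"
  obtains \<sigma> where "valid_scenario \<sigma>" "coherent_compasses \<sigma>" "start_dist \<sigma> = D"
proof -
  define a b c where "a = (0 :: complex)" and "b = complex_of_real D" and "c = \<i> * complex_of_real D"
  note abc = a_def b_def c_def
  have ne: "a \<noteq> b" "b \<noteq> c" "c \<noteq> a" using assms by (auto simp: abc complex_eq_iff)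
  have int1: "closed_segment b c \<inter> closed_segment c a \<subseteq> {c}"
  proof
    fix z assume z: "z \<in> closed_segment b c \<inter> closed_segment c a"
    obtain s where s: "z = (1 - s) *\<^sub>R b + s *\<^sub>R c" using z by (auto simp: in_segment)
    obtain t where t: "z = (1 - t) *\<^sub>R c + t *\<^sub>R a" using z by (auto simp: in_segment)
    have "Re z = (1 - s) * D" using s by (simp add: abc)
    moreover have "Re z = 0" using t by (simp add: abc)
    ultimately have "(1 - s) * D = 0" by simp
    then have "s = 1" using assms by simp
    then show "z \<in> {c}" using s by simp
  qed
  have int2: "closed_segment a b \<inter> (closed_segment b c \<union> closed_segment c a) \<subseteq> {a, b}"
  proof
    fix z assume z: "z \<in> closed_segment a b \<inter> (closed_segment b c \<union> closed_segment c a)"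
    then obtain r where r: "z = (1 - r) *\<^sub>R a + r *\<^sub>R b" by (auto simp: in_segment)
    then have Im: "Im z = 0" by (simp add: abc)
    from z consider "z \<in> closed_segment b c" | "z \<in> closed_segment c a" by blast
    then show "z \<in> {a, b}"
    proof cases
      case 1
      then obtain s where s: "z = (1 - s) *\<^sub>R b + s *\<^sub>R c" by (auto simp: in_segment)
      then have "s * D = 0" using Im by (simp add: abc)
      then show ?thesis using s assms by simp
    next
      case 2
      then obtain s where s: "z = (1 - s) *\<^sub>R c + s *\<^sub>R a" by (auto simp: in_segment)
      then have "(1 - s) * D = 0" using Im by (simp add: abc)
      then show ?thesis using s assms by simp
    qed
  qed
  define g where "g = polyline ([a, b, c] @ [hd [a, b, c]])"
  have g: "g = linepath a b +++ (linepath b c +++ linepath c a)" by (simp add: g_def)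
  have arc: "arc (linepath b c +++ linepath c a)" using ne int1 by (intro arc_join arc_linepath) auto
  have "simple_path g"
    unfolding g using ne int2 arc by (intro simple_path_join_loop arc_linepath) (auto simp: path_image_join)
  then have poly: "polygon_curve g"
    unfolding polygon_curve_def g_def by (intro exI[of _ "[a, b, c]"]) simp
  define T where "T = path_image g \<union> inside (path_image g)"
  have "terrain T"
    unfolding terrain_def closed_polygon_def T_def using poly
    by (intro exI[of _ "path_image g \<union> inside (path_image g)"] exI[of _ "{}"]) (auto simp: pairwise_def)
  have seg: "closed_segment a b \<subseteq> T" by (auto simp: T_def g path_image_join)
  then have abT: "a \<in> T" "b \<in> T" by auto
  define F where "F = \<lparr>north = 1, len_unit = 1, map_origin = 0\<rparr>"
  define \<sigma> where "\<sigma> = \<lparr>ground = T, start1 = a, start2 = b, frame1 = F, frame2 = F\<rparr>"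
  have "valid_scenario \<sigma>" "coherent_compasses \<sigma>"
    using \<open>terrain T\<close> abT ne(1)
    by (simp_all add: valid_scenario_def coherent_compasses_def \<sigma>_def F_def valid_frame_def)
  moreover have "start_dist \<sigma> = D"
  proof -
    obtain V where "tame_domain T V" using segment_bordered_tame[OF terrain_segment_bordered[OF \<open>terrain T\<close>]] .
    then interpret tame_domain T V .
    have "terrain_dist T a b = dist a b"
      using terrain_dist_eq_gdist[OF abT] gdist_segment[OF seg] by simp
    then show ?thesis using assms by (simp add: start_dist_def \<sigma>_def abc)
  qed
  ultimately show ?thesis using that by blast
qed

theorem theorem2p1:
  shows "(\<forall>\<sigma>. valid_scenario \<sigma> \<and> coherent_compasses \<sigma> \<longrightarrow>
            guarantees_rendezvous RVCM \<sigma> \<and>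
            algorithm_cost RVCM {\<sigma>} = ereal (start_dist \<sigma>)) \<and>
         (\<forall>D>0. algorithm_cost RVCM
            {\<sigma>. valid_scenario \<sigma> \<and> coherent_compasses \<sigma> \<and> start_dist \<sigma> = D} = ereal D)"
proof (intro conjI allI impI)
  fix \<sigma> assume "valid_scenario \<sigma> \<and> coherent_compasses \<sigma>"
  then show "guarantees_rendezvous RVCM \<sigma>" "algorithm_cost RVCM {\<sigma>} = ereal (start_dist \<sigma>)"
    using RVCM_scenario by (auto simp: algorithm_cost_def)
next
  fix D :: real assume "D > 0"
  define \<Sigma> where "\<Sigma> = {\<sigma>. valid_scenario \<sigma> \<and> coherent_compasses \<sigma> \<and> start_dist \<sigma> = D}"
  have "execution_costs RVCM \<sigma> = {D}" if "\<sigma> \<in> \<Sigma>" for \<sigma>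
    using RVCM_scenario that by (auto simp: \<Sigma>_def)
  moreover have "\<Sigma> \<noteq> {}" using scenario_exists[OF \<open>D > 0\<close>] by (force simp: \<Sigma>_def)
  ultimately have "(\<Union>\<sigma>\<in>\<Sigma>. execution_costs RVCM \<sigma>) = {D}" by auto
  then show "algorithm_cost RVCM {\<sigma>. valid_scenario \<sigma> \<and> coherent_compasses \<sigma> \<and> start_dist \<sigma> = D} = ereal D"
    by (simp add: algorithm_cost_def \<Sigma>_def)
qed

end
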